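(* Let $\Lambda$ be an Artin algebra and $\mathcal X$ a resolving and contravariantly finite subcategory of $\mathrm{mod}\text{-}\Lambda$. Let $(X_1\xrightarrow{f}X_2)$ be an object of $\mathcal S_{\mathcal X}(\Lambda)$. Then it is an indecomposable projective object of the exact category $\mathcal S^{\rm scw}_{\mathcal X}(\Lambda)$ if and only if it is isomorphic to one of the following objects: (1) $(X\xrightarrow{1}X)$ for some indecomposable object $X$ in $\mathcal X$; (2) $(0\to X)$ for some indecomposable object $X$ in $\mathcal X$; (3) $(\Omega_\Lambda(X)\hookrightarrow P_X)$ for some indecomposable object $X$ in $\mathcal X$. Moreover, $\mathcal S^{\rm scw}_{\mathcal X}(\Lambda)$ has enough projectives.
   Context: $\Lambda$ is an Artin algebra over a commutative artinian ring; $\mathrm{mod}\text{-}\Lambda$ is the category of finitely generated right $\Lambda$-modules and $\mathrm{prj}\text{-}\Lambda$ its subcategory of projectives. Subcategories are full and closed under isomorphism. $\mathcal X$ is resolving if it contains $\mathrm{prj}\text{-}\Lambda$ and is closed under finite direct sums, direct summands, extensions and kernels of epimorphisms; it is contravariantly finite if every module $M$ admits a morphism $f:X\to M$ with $X\in\mathcal X$ through which every morphism from an object of $\mathcal X$ to $M$ factors. For a module $M$, $\pi_M:P_M\to M$ is its projective cover, $\Omega_\Lambda(M)=\mathrm{Ker}\,\pi_M$, and $\Omega_\Lambda(M)\hookrightarrow P_M$ is the inclusion. $\mathrm H(\Lambda)$ is the (abelian) morphism category of $\mathrm{mod}\text{-}\Lambda$: objects are morphisms $(A\xrightarrow{f}B)$,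 morphisms are commutative squares. $\mathcal S_{\mathcal X}(\Lambda)$ is the full subcategory of $\mathrm H(\Lambda)$ of all monomorphisms $(A\xrightarrow{f}B)$ with $A,B,\mathrm{Cok}\,f\in\mathcal X$. $\mathcal S^{\rm scw}_{\mathcal X}(\Lambda)$ is the additive category $\mathcal S_{\mathcal X}(\Lambda)$ with the exact structure $\mathcal E^{\rm scw}_{\mathcal X}$ consisting of all short exact sequences $0\to(X_1\xrightarrow{f}X_2)\to(Z_1\xrightarrow{h}Z_2)\to(Y_1\xrightarrow{g}Y_2)\to0$ of $\mathrm H(\Lambda)$ with terms in $\mathcal S_{\mathcal X}(\Lambda)$ such that $0\to X_i\to Z_i\to Y_i\to0$ ($i=1,2$) and the induced sequence $0\to\mathrm{Cok}\,f\to\mathrm{Cok}\,h\to\mathrm{Cok}\,g\to0$ are all split. Projectivity and enough projectives are relative to this exact structure. *)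

theory Defs
  imports "HOL-Algebra.Algebra"
begin

section \<open>Artin algebras\<close>

definition artinian_ring :: "('r, 's) ring_scheme \<Rightarrow> bool" where
  "artinian_ring R \<longleftrightarrow> ring R \<and>
     (\<forall>I :: nat \<Rightarrow> 'r set. (\<forall>n. ideal (I n) R \<and> I (Suc n) \<subseteq> I n) \<longrightarrow>
        (\<exists>n. \<forall>m\<ge>n. I m = I n))"

text \<open>The library locale \<open>algebra\<close> is restricted to commutative algebras; here \<open>\<Lambda>\<close> is an
  arbitrary ring with a compatible \<open>R\<close>-module structure, so that \<open>R\<close> acts through the centre.\<close>

definition artin_algebra :: "('r, 's) ring_scheme \<Rightarrow> ('r, 'a) module \<Rightarrow> bool" where
  "artin_algebra R \<Lambda> \<longleftrightarrow>
     cring R \<and> artinian_ring R \<and> ring \<Lambda> \<and> module R \<Lambda> \<and>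
     (\<forall>r\<in>carrier R. \<forall>x\<in>carrier \<Lambda>. \<forall>y\<in>carrier \<Lambda>.
        r \<odot>\<^bsub>\<Lambda>\<^esub> (x \<otimes>\<^bsub>\<Lambda>\<^esub> y) = (r \<odot>\<^bsub>\<Lambda>\<^esub> x) \<otimes>\<^bsub>\<Lambda>\<^esub> y \<and>
        r \<odot>\<^bsub>\<Lambda>\<^esub> (x \<otimes>\<^bsub>\<Lambda>\<^esub> y) = x \<otimes>\<^bsub>\<Lambda>\<^esub> (r \<odot>\<^bsub>\<Lambda>\<^esub> y)) \<and>
     (\<exists>S. finite S \<and> S \<subseteq> carrier \<Lambda> \<and>
        (\<forall>N. submodule N R \<Lambda> \<and> S \<subseteq> N \<longrightarrow> N = carrier \<Lambda>))"


section \<open>Right modules\<close>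

text \<open>As for the library record \<open>module\<close>, the fields \<open>mult\<close> and \<open>one\<close> inherited from
  \<open>ring\<close> carry no meaning.\<close>

record ('a, 'b) rmodule = "'b ring" +
  ract :: "['b, 'a] \<Rightarrow> 'b" (infixl \<open>\<triangleleft>\<index>\<close> 70)

locale right_module = R?: ring \<Lambda> + M?: abelian_group M
  for \<Lambda> :: "('a, 's) ring_scheme" (structure) and M :: "('a, 'b) rmodule" (structure) +
  assumes ract_closed [simp, intro]:
      "\<lbrakk>x \<in> carrier M; a \<in> carrier \<Lambda>\<rbrakk> \<Longrightarrow> x \<triangleleft>\<^bsub>M\<^esub> a \<in> carrier M"
    and ract_add:
      "\<lbrakk>x \<in> carrier M; a \<in> carrier \<Lambda>; b \<in> carrier \<Lambda>\<rbrakk> \<Longrightarrow>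
       x \<triangleleft>\<^bsub>M\<^esub> (a \<oplus> b) = x \<triangleleft>\<^bsub>M\<^esub> a \<oplus>\<^bsub>M\<^esub> x \<triangleleft>\<^bsub>M\<^esub> b"
    and add_ract:
      "\<lbrakk>x \<in> carrier M; y \<in> carrier M; a \<in> carrier \<Lambda>\<rbrakk> \<Longrightarrow>
       (x \<oplus>\<^bsub>M\<^esub> y) \<triangleleft>\<^bsub>M\<^esub> a = x \<triangleleft>\<^bsub>M\<^esub> a \<oplus>\<^bsub>M\<^esub> y \<triangleleft>\<^bsub>M\<^esub> a"
    and ract_mult:
      "\<lbrakk>x \<in> carrier M; a \<in> carrier \<Lambda>; b \<in> carrier \<Lambda>\<rbrakk> \<Longrightarrow>
       x \<triangleleft>\<^bsub>M\<^esub> (a \<otimes> b) = (x \<triangleleft>\<^bsub>M\<^esub> a) \<triangleleft>\<^bsub>M\<^esub> b"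
    and ract_one [simp]:
      "x \<in> carrier M \<Longrightarrow> x \<triangleleft>\<^bsub>M\<^esub> \<one> = x"

definition rsubmodule :: "('a, 's) ring_scheme \<Rightarrow> ('a, 'b) rmodule \<Rightarrow> 'b set \<Rightarrow> bool" where
  "rsubmodule \<Lambda> M N \<longleftrightarrow> subgroup N (add_monoid M) \<and>
     (\<forall>x\<in>N. \<forall>a\<in>carrier \<Lambda>. x \<triangleleft>\<^bsub>M\<^esub> a \<in> N)"

definition fg_rmodule :: "('a, 's) ring_scheme \<Rightarrow> ('a, 'b) rmodule \<Rightarrow> bool" where
  "fg_rmodule \<Lambda> M \<longleftrightarrow> right_module \<Lambda> M \<and>
     (\<exists>S. finite S \<and> S \<subseteq> carrier M \<and>
        (\<forall>N. rsubmodule \<Lambda> M N \<and> S \<subseteq> N \<longrightarrow> N = carrier M))"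

text \<open>Homomorphisms are considered up to equality on the carrier of the source.\<close>

definition rhom ::
  "('a, 's) ring_scheme \<Rightarrow> ('a, 'b) rmodule \<Rightarrow> ('a, 'c) rmodule \<Rightarrow> ('b \<Rightarrow> 'c) set" where
  "rhom \<Lambda> M N = {f. f \<in> carrier M \<rightarrow> carrier N \<and>
     (\<forall>x\<in>carrier M. \<forall>y\<in>carrier M. f (x \<oplus>\<^bsub>M\<^esub> y) = f x \<oplus>\<^bsub>N\<^esub> f y) \<and>
     (\<forall>x\<in>carrier M. \<forall>a\<in>carrier \<Lambda>. f (x \<triangleleft>\<^bsub>M\<^esub> a) = f x \<triangleleft>\<^bsub>N\<^esub> a)}"

definition riso :: "('a, 's) ring_scheme \<Rightarrow> ('a, 'b) rmodule \<Rightarrow> ('a, 'c) rmodule \<Rightarrow> bool" where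
  "riso \<Lambda> M N \<longleftrightarrow> (\<exists>f\<in>rhom \<Lambda> M N. bij_betw f (carrier M) (carrier N))"

definition zero_rmodule :: "('a, 'b) rmodule \<Rightarrow> bool" where
  "zero_rmodule M \<longleftrightarrow> carrier M = {\<zero>\<^bsub>M\<^esub>}"

definition dsum :: "('a, 'b) rmodule \<Rightarrow> ('a, 'c) rmodule \<Rightarrow> ('a, 'b \<times> 'c) rmodule" where
  "dsum M N = \<lparr>carrier = carrier M \<times> carrier N, monoid.mult = undefined, monoid.one = undefined,
     ring.zero = (\<zero>\<^bsub>M\<^esub>, \<zero>\<^bsub>N\<^esub>),
     ring.add = (\<lambda>(x, y) (x', y'). (x \<oplus>\<^bsub>M\<^esub> x', y \<oplus>\<^bsub>N\<^esub> y')),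
     ract = (\<lambda>(x, y) a. (x \<triangleleft>\<^bsub>M\<^esub> a, y \<triangleleft>\<^bsub>N\<^esub> a))\<rparr>"

definition ker_rmodule ::
  "('b \<Rightarrow> 'c) \<Rightarrow> ('a, 'b) rmodule \<Rightarrow> ('a, 'c) rmodule \<Rightarrow> ('a, 'b) rmodule" where
  "ker_rmodule f M N = M\<lparr>carrier := a_kernel M N f\<rparr>"

definition zero_sub :: "('a, 'b) rmodule \<Rightarrow> ('a, 'b) rmodule" where
  "zero_sub M = M\<lparr>carrier := {\<zero>\<^bsub>M\<^esub>}\<rparr>"

definition cok :: "('b \<Rightarrow> 'c) \<Rightarrow> ('a, 'b) rmodule \<Rightarrow> ('a, 'c) rmodule \<Rightarrow> ('a, 'c set) rmodule" where
  "cok f A B = (let I = f ` carrier A in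
     \<lparr>carrier = a_rcosets\<^bsub>B\<^esub> I, monoid.mult = undefined, monoid.one = undefined,
      ring.zero = I, ring.add = (<+>\<^bsub>B\<^esub>),
      ract = (\<lambda>S a. \<Union>x\<in>S. I +>\<^bsub>B\<^esub> (x \<triangleleft>\<^bsub>B\<^esub> a))\<rparr>)"

text \<open>The map \<open>Cok f \<rightarrow> Cok f'\<close> induced by \<open>\<beta> : B \<rightarrow> B'\<close>, where \<open>f' : A' \<rightarrow> B'\<close>;
  it sends the coset of \<open>x\<close> to the coset of \<open>\<beta> x\<close>.\<close>

definition cok_map ::
  "('c \<Rightarrow> 'b) \<Rightarrow> ('d \<Rightarrow> 'b) \<Rightarrow> ('a, 'd) rmodule \<Rightarrow> ('a, 'b) rmodule \<Rightarrow> 'c set \<Rightarrow> 'b set" where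
  "cok_map \<beta> f' A' B' S = (\<Union>x\<in>S. (f' ` carrier A') +>\<^bsub>B'\<^esub> \<beta> x)"

definition short_exact ::
  "('a, 's) ring_scheme \<Rightarrow> ('a, 'b) rmodule \<Rightarrow> ('b \<Rightarrow> 'c) \<Rightarrow> ('a, 'c) rmodule \<Rightarrow> ('c \<Rightarrow> 'd) \<Rightarrow>
   ('a, 'd) rmodule \<Rightarrow> bool" where
  "short_exact \<Lambda> L f M g N \<longleftrightarrow> f \<in> rhom \<Lambda> L M \<and> g \<in> rhom \<Lambda> M N \<and>
     inj_on f (carrier L) \<and> f ` carrier L = a_kernel M N g \<and> g ` carrier M = carrier N"

definition split_exact ::
  "('a, 's) ring_scheme \<Rightarrow> ('a, 'b) rmodule \<Rightarrow> ('b \<Rightarrow> 'c) \<Rightarrow> ('a, 'c) rmodule \<Rightarrow> ('c \<Rightarrow> 'd) \<Rightarrow>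
   ('a, 'd) rmodule \<Rightarrow> bool" where
  "split_exact \<Lambda> L f M g N \<longleftrightarrow> short_exact \<Lambda> L f M g N \<and>
     (\<exists>s\<in>rhom \<Lambda> N M. \<forall>y\<in>carrier N. g (s y) = y)"


section \<open>The category of finitely generated right modules\<close>

text \<open>The objects of \<open>mod-\<Lambda>\<close> are the finitely generated right modules whose elements are drawn from a
  fixed type. A quotient of \<open>\<Lambda>\<^sup>n\<close> consists of sets of functions \<open>nat \<Rightarrow> 'a\<close>, so that this
  type contains a copy of every finitely generated module; see \<open>fg_rmodule_represented\<close> below.\<close>

type_synonym 'a univ = "(nat \<Rightarrow> 'a) set"
type_synonym 'a umod = "('a, 'a univ) rmodule"

definition fgmod :: "('a, 's) ring_scheme \<Rightarrow> 'a umod set" where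
  "fgmod \<Lambda> = {M. fg_rmodule \<Lambda> M}"

definition transport :: "('b \<Rightarrow> 'c) \<Rightarrow> ('a, 'b) rmodule \<Rightarrow> ('a, 'c) rmodule" where
  "transport e M = (let g = inv_into (carrier M) e in
     \<lparr>carrier = e ` carrier M, monoid.mult = undefined, monoid.one = undefined,
      ring.zero = e \<zero>\<^bsub>M\<^esub>, ring.add = (\<lambda>S T. e (g S \<oplus>\<^bsub>M\<^esub> g T)), ract = (\<lambda>S a. e (g S \<triangleleft>\<^bsub>M\<^esub> a))\<rparr>)"

lemma transport_right_module:
  assumes "right_module \<Lambda> M" and inj: "inj_on e (carrier M)"
  shows "right_module \<Lambda> (transport e M)" (is "right_module \<Lambda> ?N")
proof -
  interpret right_module \<Lambda> M by fact
  have car: "carrier ?N = e ` carrier M" and zero: "\<zero>\<^bsub>?N\<^esub> = e \<zero>\<^bsub>M\<^esub>"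
    by (simp_all add: transport_def Let_def)
  have add: "e x \<oplus>\<^bsub>?N\<^esub> e y = e (x \<oplus>\<^bsub>M\<^esub> y)" if "x \<in> carrier M" "y \<in> carrier M" for x y
    using that inj by (simp add: transport_def Let_def)
  have act: "e x \<triangleleft>\<^bsub>?N\<^esub> a = e (x \<triangleleft>\<^bsub>M\<^esub> a)" if "x \<in> carrier M" for x a
    using that inj by (simp add: transport_def Let_def)
  have grp: "abelian_group ?N"
  proof (rule abelian_groupI)
    fix S assume "S \<in> carrier ?N"
    then obtain x where x: "x \<in> carrier M" "S = e x" by (auto simp: car)
    then have "e (\<ominus>\<^bsub>M\<^esub> x) \<oplus>\<^bsub>?N\<^esub> S = \<zero>\<^bsub>?N\<^esub>" by (simp add: add zero M.l_neg)
    then show "\<exists>T\<in>carrier ?N. T \<oplus>\<^bsub>?N\<^esub> S = \<zero>\<^bsub>?N\<^esub>" using x by (auto simp: car)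
  qed (auto simp: car zero add M.a_ac)
  show ?thesis
    by (intro right_module.intro right_module_axioms.intro grp R.ring_axioms)
      (auto simp: car add act ract_add add_ract ract_mult)
qed

lemma transport_iso:
  assumes "inj_on e (carrier M)"
  shows "e \<in> rhom \<Lambda> M (transport e M)" "bij_betw e (carrier M) (carrier (transport e M))"
  using assms by (auto simp: rhom_def transport_def Let_def bij_betw_def)

lemma rsubmodule_vimage:
  assumes "right_module \<Lambda> M" "right_module \<Lambda> N" "f \<in> rhom \<Lambda> M N" "rsubmodule \<Lambda> N K"
  shows "rsubmodule \<Lambda> M {x \<in> carrier M. f x \<in> K}"
proof -
  interpret M: right_module \<Lambda> M by fact
  interpret N: right_module \<Lambda> N by fact
  interpret gh: group_hom "add_monoid M" "add_monoid N" f
    using assms(3) M.M.a_group N.M.a_group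
    by (auto simp: group_hom_def group_hom_axioms_def rhom_def hom_def)
  have K: "subgroup K (add_monoid N)" using assms(4) by (simp add: rsubmodule_def)
  interpret K: subgroup K "add_monoid N" by (rule K)
  have "subgroup {x \<in> carrier M. f x \<in> K} (add_monoid M)"
  proof (rule group.subgroupI)
    show "{x \<in> carrier M. f x \<in> K} \<noteq> {}" using gh.hom_one K.one_closed by auto
  next
    fix a assume "a \<in> {x \<in> carrier M. f x \<in> K}"
    then show "inv\<^bsub>add_monoid M\<^esub> a \<in> {x \<in> carrier M. f x \<in> K}"
      using gh.hom_inv[of a] K.m_inv_closed[of "f a"] group.inv_closed[OF M.M.a_group, of a] by simp
  next
    fix a b assume "a \<in> {x \<in> carrier M. f x \<in> K}" "b \<in> {x \<in> carrier M. f x \<in> K}"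
    then show "a \<otimes>\<^bsub>add_monoid M\<^esub> b \<in> {x \<in> carrier M. f x \<in> K}"
      using gh.hom_mult[of a b] K.m_closed[of "f a" "f b"] by simp
  qed (use M.M.a_group in auto)
  then show ?thesis
    using assms(3,4) by (auto simp: rsubmodule_def rhom_def)
qed

lemma fg_rmodule_image:
  assumes "fg_rmodule \<Lambda> M" "right_module \<Lambda> N" "f \<in> rhom \<Lambda> M N" "f ` carrier M = carrier N"
  shows "fg_rmodule \<Lambda> N"
proof -
  obtain S where S: "finite S" "S \<subseteq> carrier M"
      "\<And>K. rsubmodule \<Lambda> M K \<Longrightarrow> S \<subseteq> K \<Longrightarrow> K = carrier M"
    using assms(1) unfolding fg_rmodule_def by blast
  have "K = carrier N" if K: "rsubmodule \<Lambda> N K" "f ` S \<subseteq> K" for K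
  proof -
    have "{x \<in> carrier M. f x \<in> K} = carrier M"
      using assms K S(2) by (intro S(3) rsubmodule_vimage) (auto simp: fg_rmodule_def)
    then have "f ` carrier M \<subseteq> K" by blast
    then have "carrier N \<subseteq> K" using assms(4) by simp
    moreover have "K \<subseteq> carrier N"
      using K(1) subgroup.subset by (fastforce simp: rsubmodule_def)
    ultimately show ?thesis by auto
  qed
  then show ?thesis
    unfolding fg_rmodule_def using S(1,2) assms(2,4) by (intro conjI exI[of _ "f ` S"]) auto
qed

lemma fg_rmodule_represented:
  fixes M :: "('a, 'b) rmodule"
  assumes "fg_rmodule \<Lambda> M"
  shows "\<exists>N\<in>fgmod \<Lambda>. riso \<Lambda> M N"
proof -
  interpret right_module \<Lambda> M using assms by (simp add: fg_rmodule_def)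
  obtain S where S: "finite S" "S \<subseteq> carrier M"
      "\<And>K. rsubmodule \<Lambda> M K \<Longrightarrow> S \<subseteq> K \<Longrightarrow> K = carrier M"
    using assms unfolding fg_rmodule_def by blast
  obtain s and n :: nat where s: "s ` {..<n} = S"
    using S(1) by (metis finite_imp_nat_seg_image_inj_on lessThan_def)
  have sM: "s i \<in> carrier M" if "i < n" for i using that s S(2) by auto
  define lc where "lc c = (\<Oplus>\<^bsub>M\<^esub>i\<in>{..<n}. s i \<triangleleft>\<^bsub>M\<^esub> c i)" for c :: "nat \<Rightarrow> 'a"
  define C where "C = {c :: nat \<Rightarrow> 'a. \<forall>i. c i \<in> carrier \<Lambda>}"
  have lcM: "lc c \<in> carrier M" if "c \<in> C" for c
    unfolding lc_def using that sM by (intro M.finsum_closed) (auto simp: C_def)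
  have lc_add: "lc c \<oplus>\<^bsub>M\<^esub> lc d = lc (\<lambda>i. c i \<oplus>\<^bsub>\<Lambda>\<^esub> d i)" if "c \<in> C" "d \<in> C" for c d
  proof -
    have "lc (\<lambda>i. c i \<oplus>\<^bsub>\<Lambda>\<^esub> d i) = (\<Oplus>\<^bsub>M\<^esub>i\<in>{..<n}. s i \<triangleleft>\<^bsub>M\<^esub> c i \<oplus>\<^bsub>M\<^esub> s i \<triangleleft>\<^bsub>M\<^esub> d i)"
      unfolding lc_def using that sM by (intro M.finsum_cong') (auto simp: C_def ract_add)
    also have "\<dots> = lc c \<oplus>\<^bsub>M\<^esub> lc d"
      unfolding lc_def using that sM by (intro M.finsum_addf) (auto simp: C_def)
    finally show ?thesis by simp
  qed
  have zero_ract: "\<zero>\<^bsub>M\<^esub> \<triangleleft>\<^bsub>M\<^esub> a = \<zero>\<^bsub>M\<^esub>" if "a \<in> carrier \<Lambda>" for a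
    using add_ract[of "\<zero>\<^bsub>M\<^esub>" "\<zero>\<^bsub>M\<^esub>" a] that
    by (metis M.add.r_cancel_one' M.l_zero M.zero_closed ract_closed)
  have ract_zero: "x \<triangleleft>\<^bsub>M\<^esub> \<zero>\<^bsub>\<Lambda>\<^esub> = \<zero>\<^bsub>M\<^esub>" if "x \<in> carrier M" for x
    using ract_add[of x "\<zero>\<^bsub>\<Lambda>\<^esub>" "\<zero>\<^bsub>\<Lambda>\<^esub>"] that
    by (metis M.add.r_cancel_one' R.l_zero R.zero_closed ract_closed)
  have lc_act: "lc c \<triangleleft>\<^bsub>M\<^esub> a = lc (\<lambda>i. c i \<otimes>\<^bsub>\<Lambda>\<^esub> a)" if c: "c \<in> C" and a: "a \<in> carrier \<Lambda>" for c a
  proof -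
    have "(\<Oplus>\<^bsub>M\<^esub>i\<in>{..<m}. s i \<triangleleft>\<^bsub>M\<^esub> c i) \<triangleleft>\<^bsub>M\<^esub> a = (\<Oplus>\<^bsub>M\<^esub>i\<in>{..<m}. s i \<triangleleft>\<^bsub>M\<^esub> (c i \<otimes>\<^bsub>\<Lambda>\<^esub> a))"
      if "m \<le> n" for m
      using that
    proof (induction m)
      case 0
      then show ?case using a zero_ract by simp
    next
      case (Suc m)
      have cl: "(\<lambda>i. s i \<triangleleft>\<^bsub>M\<^esub> c i) \<in> {..<m} \<rightarrow> carrier M"
        "(\<lambda>i. s i \<triangleleft>\<^bsub>M\<^esub> (c i \<otimes>\<^bsub>\<Lambda>\<^esub> a)) \<in> {..<m} \<rightarrow> carrier M"
        using Suc.prems sM c a by (auto simp: C_def)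
      have m: "s m \<in> carrier M" "c m \<in> carrier \<Lambda>" using Suc.prems sM c by (auto simp: C_def)
      show ?case
        using Suc cl m a by (simp add: lessThan_Suc add_ract ract_mult)
    qed
    then show ?thesis by (simp add: lc_def)
  qed
  have "subgroup (lc ` C) (add_monoid M)"
  proof (rule group.subgroupI[OF M.a_group])
    show "lc ` C \<noteq> {}" using R.zero_closed by (auto simp: C_def)
  next
    fix x assume "x \<in> lc ` C"
    then obtain c where c: "c \<in> C" "x = lc c" by auto
    have mc: "(\<lambda>i. \<ominus>\<^bsub>\<Lambda>\<^esub> c i) \<in> C" using c by (auto simp: C_def)
    have "x \<oplus>\<^bsub>M\<^esub> lc (\<lambda>i. \<ominus>\<^bsub>\<Lambda>\<^esub> c i) = lc (\<lambda>i. \<zero>\<^bsub>\<Lambda>\<^esub>)"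
      using c mc lc_add[OF c(1) mc] by (simp add: C_def R.r_neg)
    also have "\<dots> = (\<Oplus>\<^bsub>M\<^esub>i\<in>{..<n}. \<zero>\<^bsub>M\<^esub>)"
      unfolding lc_def by (intro M.finsum_cong') (auto simp: sM ract_zero)
    finally have "x \<oplus>\<^bsub>M\<^esub> lc (\<lambda>i. \<ominus>\<^bsub>\<Lambda>\<^esub> c i) = \<zero>\<^bsub>M\<^esub>" by simp
    then have "\<ominus>\<^bsub>M\<^esub> x = lc (\<lambda>i. \<ominus>\<^bsub>\<Lambda>\<^esub> c i)"
      using c mc lcM by (intro M.minus_equality) (simp_all add: M.a_comm)
    then show "inv\<^bsub>add_monoid M\<^esub> x \<in> lc ` C" using mc by (simp add: a_inv_def)
  next
    fix x y assume "x \<in> lc ` C" "y \<in> lc ` C"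
    then obtain c d where cd: "c \<in> C" "x = lc c" "d \<in> C" "y = lc d" by auto
    then have "(\<lambda>i. c i \<oplus>\<^bsub>\<Lambda>\<^esub> d i) \<in> C" by (simp add: C_def)
    with cd show "x \<otimes>\<^bsub>add_monoid M\<^esub> y \<in> lc ` C" by (simp add: lc_add)
  qed (use lcM in auto)
  moreover have "lc c \<triangleleft>\<^bsub>M\<^esub> a \<in> lc ` C" if "c \<in> C" "a \<in> carrier \<Lambda>" for c a
    using that by (simp add: lc_act) (simp add: C_def)
  ultimately have "rsubmodule \<Lambda> M (lc ` C)" by (auto simp: rsubmodule_def)
  moreover have "S \<subseteq> lc ` C"
  proof
    fix x assume "x \<in> S"
    then obtain j where j: "j < n" "x = s j" using s by auto
    define c where "c i = (if i = j then \<one>\<^bsub>\<Lambda>\<^esub> else \<zero>\<^bsub>\<Lambda>\<^esub>)" for i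
    have "lc c = (\<Oplus>\<^bsub>M\<^esub>i\<in>{..<n}. if j = i then s i else \<zero>\<^bsub>M\<^esub>)"
      unfolding lc_def by (intro M.finsum_cong') (auto simp: sM ract_zero c_def)
    also have "\<dots> = s j" using j sM by (intro M.add.finprod_singleton) auto
    finally have "x = lc c" using j by simp
    moreover have "c \<in> C" by (simp add: C_def c_def)
    ultimately show "x \<in> lc ` C" by blast
  qed
  ultimately have surj: "lc ` C = carrier M" by (rule S(3))
  define e where "e x = {c \<in> C. lc c = x}" for x
  have inj: "inj_on e (carrier M)"
  proof (rule inj_onI)
    fix x y assume "x \<in> carrier M" and eq: "e x = e y"
    then have "x \<in> lc ` C" using surj by simp
    then obtain c where "c \<in> C" "lc c = x" by auto
    then have "c \<in> e y" using eq by (auto simp: e_def)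
    then show "x = y" using \<open>lc c = x\<close> by (simp add: e_def)
  qed
  have "fg_rmodule \<Lambda> (transport e M)"
    using fg_rmodule_image[OF assms transport_right_module[OF right_module_axioms inj]
        transport_iso(1)[OF inj]] transport_iso(2)[OF inj] by (simp add: bij_betw_def)
  then show ?thesis
    using transport_iso[OF inj] by (auto simp: fgmod_def riso_def)
qed

lemma cok_fg:
  assumes A: "right_module \<Lambda> A" and B: "fg_rmodule \<Lambda> B" and f: "f \<in> rhom \<Lambda> A B"
  shows "fg_rmodule \<Lambda> (cok f A B)"
    and "(\<lambda>x. f ` carrier A +>\<^bsub>B\<^esub> x) \<in> rhom \<Lambda> B (cok f A B)"
proof -
  interpret A: right_module \<Lambda> A by fact
  interpret B: right_module \<Lambda> B using B by (simp add: fg_rmodule_def)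
  let ?I = "f ` carrier A" and ?C = "cok f A B"
  interpret gh: group_hom "add_monoid A" "add_monoid B" f
    using f A.M.a_group B.M.a_group
    by (auto simp: group_hom_def group_hom_axioms_def rhom_def hom_def)
  have "subgroup ?I (add_monoid B)" using gh.img_is_subgroup by simp
  then interpret I: abelian_subgroup ?I B
    by (intro abelian_subgroupI3 additive_subgroup.intro B.M.abelian_group_axioms)
  have IB: "x \<in> carrier B" if "x \<in> ?I" for x using that by (rule I.a_Hcarr)
  have Iact: "x \<triangleleft>\<^bsub>B\<^esub> a \<in> ?I" if xI: "x \<in> ?I" and a: "a \<in> carrier \<Lambda>" for x a
  proof -
    obtain z where z: "z \<in> carrier A" "x = f z" using xI by auto
    then have "f (z \<triangleleft>\<^bsub>A\<^esub> a) = x \<triangleleft>\<^bsub>B\<^esub> a" using f a by (simp add: rhom_def)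
    then show ?thesis using z a by (metis A.ract_closed imageI)
  qed
  have car: "carrier ?C = (\<lambda>x. ?I +>\<^bsub>B\<^esub> x) ` carrier B"
    by (auto simp: cok_def Let_def A_RCOSETS_def')
  have zero: "\<zero>\<^bsub>?C\<^esub> = ?I +>\<^bsub>B\<^esub> \<zero>\<^bsub>B\<^esub>"
    using IB by (simp add: cok_def Let_def subsetI)
  have add: "(?I +>\<^bsub>B\<^esub> x) \<oplus>\<^bsub>?C\<^esub> (?I +>\<^bsub>B\<^esub> y) = ?I +>\<^bsub>B\<^esub> (x \<oplus>\<^bsub>B\<^esub> y)"
    if "x \<in> carrier B" "y \<in> carrier B" for x y
    using that by (simp add: cok_def Let_def I.a_rcos_sum)
  have act: "(?I +>\<^bsub>B\<^esub> x) \<triangleleft>\<^bsub>?C\<^esub> a = ?I +>\<^bsub>B\<^esub> (x \<triangleleft>\<^bsub>B\<^esub> a)"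
    if x: "x \<in> carrier B" and a: "a \<in> carrier \<Lambda>" for x a
  proof -
    have "?I +>\<^bsub>B\<^esub> (y \<triangleleft>\<^bsub>B\<^esub> a) = ?I +>\<^bsub>B\<^esub> (x \<triangleleft>\<^bsub>B\<^esub> a)" if y: "y \<in> ?I +>\<^bsub>B\<^esub> x" for y
    proof -
      obtain h where h: "h \<in> ?I" "y = h \<oplus>\<^bsub>B\<^esub> x"
        using y unfolding a_r_coset_def' by blast
      have "y \<triangleleft>\<^bsub>B\<^esub> a = h \<triangleleft>\<^bsub>B\<^esub> a \<oplus>\<^bsub>B\<^esub> x \<triangleleft>\<^bsub>B\<^esub> a"
        using h IB[OF h(1)] x a by (simp add: B.add_ract)
      then have "y \<triangleleft>\<^bsub>B\<^esub> a \<in> ?I +>\<^bsub>B\<^esub> (x \<triangleleft>\<^bsub>B\<^esub> a)"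
        using Iact[OF h(1) a] unfolding a_r_coset_def' by blast
      then show ?thesis
        by (rule I.a_repr_independence'[OF _ B.ract_closed[OF x a], symmetric])
    qed
    moreover have "x \<in> ?I +>\<^bsub>B\<^esub> x" using x by (rule I.a_rcos_self)
    ultimately have "(\<Union>y\<in>?I +>\<^bsub>B\<^esub> x. ?I +>\<^bsub>B\<^esub> (y \<triangleleft>\<^bsub>B\<^esub> a)) = ?I +>\<^bsub>B\<^esub> (x \<triangleleft>\<^bsub>B\<^esub> a)"
      by blast
    then show ?thesis by (simp add: cok_def Let_def)
  qed
  have grp: "abelian_group ?C"
  proof (rule abelian_groupI)
    fix S assume "S \<in> carrier ?C"
    then obtain x where x: "x \<in> carrier B" "S = ?I +>\<^bsub>B\<^esub> x" by (auto simp: car)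
    then have "(?I +>\<^bsub>B\<^esub> (\<ominus>\<^bsub>B\<^esub> x)) \<oplus>\<^bsub>?C\<^esub> S = \<zero>\<^bsub>?C\<^esub>" by (simp only: add zero B.M.l_neg B.M.a_inv_closed)
    moreover have "?I +>\<^bsub>B\<^esub> (\<ominus>\<^bsub>B\<^esub> x) \<in> carrier ?C" using x by (simp add: car)
    ultimately show "\<exists>T\<in>carrier ?C. T \<oplus>\<^bsub>?C\<^esub> S = \<zero>\<^bsub>?C\<^esub>" by blast
  next
    fix S T assume "S \<in> carrier ?C" "T \<in> carrier ?C"
    then obtain x y where xy: "x \<in> carrier B" "y \<in> carrier B" "S = ?I +>\<^bsub>B\<^esub> x" "T = ?I +>\<^bsub>B\<^esub> y"
      unfolding car by blast
    show "S \<oplus>\<^bsub>?C\<^esub> T \<in> carrier ?C" using xy by (simp add: add) (simp add: car)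
    show "S \<oplus>\<^bsub>?C\<^esub> T = T \<oplus>\<^bsub>?C\<^esub> S" using xy by (simp add: add B.M.a_comm)
    fix U assume "U \<in> carrier ?C"
    then obtain z where "z \<in> carrier B" "U = ?I +>\<^bsub>B\<^esub> z" by (auto simp: car)
    then show "S \<oplus>\<^bsub>?C\<^esub> T \<oplus>\<^bsub>?C\<^esub> U = S \<oplus>\<^bsub>?C\<^esub> (T \<oplus>\<^bsub>?C\<^esub> U)"
      using xy by (simp add: add B.M.a_assoc)
  next
    show "\<zero>\<^bsub>?C\<^esub> \<in> carrier ?C" unfolding zero car by (rule imageI) simp
    fix S assume "S \<in> carrier ?C"
    then obtain x where x: "x \<in> carrier B" "S = ?I +>\<^bsub>B\<^esub> x" by (auto simp: car)
    then show "\<zero>\<^bsub>?C\<^esub> \<oplus>\<^bsub>?C\<^esub> S = S" by (simp only: zero add B.M.zero_closed B.M.l_zero)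
  qed
  have C: "right_module \<Lambda> ?C"
  proof (rule right_module.intro[OF A.R.ring_axioms grp right_module_axioms.intro])
    fix S a assume "S \<in> carrier ?C" and a: "a \<in> carrier \<Lambda>"
    then obtain x where x: "x \<in> carrier B" "S = ?I +>\<^bsub>B\<^esub> x" by (auto simp: car)
    show "S \<triangleleft>\<^bsub>?C\<^esub> a \<in> carrier ?C" using x a by (simp add: act) (simp add: car)
    fix b assume b: "b \<in> carrier \<Lambda>"
    show "S \<triangleleft>\<^bsub>?C\<^esub> (a \<oplus>\<^bsub>\<Lambda>\<^esub> b) = S \<triangleleft>\<^bsub>?C\<^esub> a \<oplus>\<^bsub>?C\<^esub> S \<triangleleft>\<^bsub>?C\<^esub> b"
      using x a b by (simp add: act add B.ract_add)
    show "S \<triangleleft>\<^bsub>?C\<^esub> (a \<otimes>\<^bsub>\<Lambda>\<^esub> b) = S \<triangleleft>\<^bsub>?C\<^esub> a \<triangleleft>\<^bsub>?C\<^esub> b"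
      using x a b by (simp add: act B.ract_mult)
  next
    fix S T a assume "S \<in> carrier ?C" "T \<in> carrier ?C" and a: "a \<in> carrier \<Lambda>"
    then obtain x y where xy: "x \<in> carrier B" "y \<in> carrier B" "S = ?I +>\<^bsub>B\<^esub> x" "T = ?I +>\<^bsub>B\<^esub> y"
      unfolding car by blast
    then show "(S \<oplus>\<^bsub>?C\<^esub> T) \<triangleleft>\<^bsub>?C\<^esub> a = S \<triangleleft>\<^bsub>?C\<^esub> a \<oplus>\<^bsub>?C\<^esub> T \<triangleleft>\<^bsub>?C\<^esub> a"
      using a by (simp add: act add B.add_ract)
  next
    fix S assume "S \<in> carrier ?C"
    then show "S \<triangleleft>\<^bsub>?C\<^esub> \<one>\<^bsub>\<Lambda>\<^esub> = S" by (auto simp: car act)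
  qed
  show hom: "(\<lambda>x. ?I +>\<^bsub>B\<^esub> x) \<in> rhom \<Lambda> B ?C"
    by (auto simp: rhom_def add act) (auto simp: car)
  show "fg_rmodule \<Lambda> ?C"
    by (rule fg_rmodule_image[OF B C hom]) (simp add: car)
qed

text \<open>Direct sums and cokernels of objects of \<open>fgmod \<Lambda>\<close> have elements in another type. Such a
  module belongs to an isomorphism-closed subcategory when it has an isomorphic copy there.\<close>

definition in_sub :: "('a, 's) ring_scheme \<Rightarrow> 'a umod set \<Rightarrow> ('a, 'b) rmodule \<Rightarrow> bool" where
  "in_sub \<Lambda> \<C> M \<longleftrightarrow> (\<exists>C\<in>\<C>. riso \<Lambda> M C)"

definition prj :: "('a, 's) ring_scheme \<Rightarrow> 'a umod set" where
  "prj \<Lambda> = {P \<in> fgmod \<Lambda>. \<forall>M\<in>fgmod \<Lambda>. \<forall>N\<in>fgmod \<Lambda>. \<forall>g\<in>rhom \<Lambda> M N. \<forall>h\<in>rhom \<Lambda> P N.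
     g ` carrier M = carrier N \<longrightarrow> (\<exists>k\<in>rhom \<Lambda> P M. \<forall>x\<in>carrier P. g (k x) = h x)}"

definition projective_cover ::
  "('a, 's) ring_scheme \<Rightarrow> 'a umod \<Rightarrow> ('a univ \<Rightarrow> 'a univ) \<Rightarrow> 'a umod \<Rightarrow> bool" where
  "projective_cover \<Lambda> P \<pi> M \<longleftrightarrow> P \<in> prj \<Lambda> \<and> \<pi> \<in> rhom \<Lambda> P M \<and> \<pi> ` carrier P = carrier M \<and>
     (\<forall>N. rsubmodule \<Lambda> P N \<and> N <+>\<^bsub>P\<^esub> a_kernel P M \<pi> = carrier P \<longrightarrow> N = carrier P)"

definition indecomposable :: "('a, 's) ring_scheme \<Rightarrow> 'a umod \<Rightarrow> bool" where
  "indecomposable \<Lambda> M \<longleftrightarrow> M \<in> fgmod \<Lambda> \<and> \<not> zero_rmodule M \<and>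
     (\<forall>A\<in>fgmod \<Lambda>. \<forall>B\<in>fgmod \<Lambda>. riso \<Lambda> M (dsum A B) \<longrightarrow> zero_rmodule A \<or> zero_rmodule B)"

definition subcategory :: "('a, 's) ring_scheme \<Rightarrow> 'a umod set \<Rightarrow> bool" where
  "subcategory \<Lambda> \<C> \<longleftrightarrow> \<C> \<subseteq> fgmod \<Lambda> \<and>
     (\<forall>M\<in>\<C>. \<forall>N\<in>fgmod \<Lambda>. riso \<Lambda> M N \<longrightarrow> N \<in> \<C>)"

definition resolving :: "('a, 's) ring_scheme \<Rightarrow> 'a umod set \<Rightarrow> bool" where
  "resolving \<Lambda> \<C> \<longleftrightarrow> subcategory \<Lambda> \<C> \<and> prj \<Lambda> \<subseteq> \<C> \<and>
     (\<forall>M\<in>\<C>. \<forall>N\<in>\<C>. in_sub \<Lambda> \<C> (dsum M N)) \<and>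
     (\<forall>M\<in>fgmod \<Lambda>. \<forall>N\<in>fgmod \<Lambda>. in_sub \<Lambda> \<C> (dsum M N) \<longrightarrow> M \<in> \<C> \<and> N \<in> \<C>) \<and>
     (\<forall>L\<in>\<C>. \<forall>N\<in>\<C>. \<forall>M\<in>fgmod \<Lambda>. \<forall>f g. short_exact \<Lambda> L f M g N \<longrightarrow> M \<in> \<C>) \<and>
     (\<forall>M\<in>\<C>. \<forall>N\<in>\<C>. \<forall>g\<in>rhom \<Lambda> M N. g ` carrier M = carrier N \<longrightarrow> ker_rmodule g M N \<in> \<C>)"

definition contravariantly_finite :: "('a, 's) ring_scheme \<Rightarrow> 'a umod set \<Rightarrow> bool" where
  "contravariantly_finite \<Lambda> \<C> \<longleftrightarrow> subcategory \<Lambda> \<C> \<and>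
     (\<forall>M\<in>fgmod \<Lambda>. \<exists>U\<in>\<C>. \<exists>f\<in>rhom \<Lambda> U M.
        \<forall>X'\<in>\<C>. \<forall>g\<in>rhom \<Lambda> X' M. \<exists>h\<in>rhom \<Lambda> X' U. \<forall>x\<in>carrier X'. f (h x) = g x)"


section \<open>The morphism category\<close>

type_synonym ('a, 'b, 'c) harrow = "('a, 'b) rmodule \<times> ('b \<Rightarrow> 'c) \<times> ('a, 'c) rmodule"
type_synonym 'a hobj = "('a, 'a univ, 'a univ) harrow"
type_synonym 'a hmor = "('a univ \<Rightarrow> 'a univ) \<times> ('a univ \<Rightarrow> 'a univ)"

definition Hobj :: "('a, 's) ring_scheme \<Rightarrow> 'a hobj set" where
  "Hobj \<Lambda> = {(A, f, B). A \<in> fgmod \<Lambda> \<and> B \<in> fgmod \<Lambda> \<and> f \<in> rhom \<Lambda> A B}"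

fun Hhom ::
  "('a, 's) ring_scheme \<Rightarrow> ('a, 'b, 'c) harrow \<Rightarrow> ('a, 'd, 'e) harrow \<Rightarrow> (('b \<Rightarrow> 'd) \<times> ('c \<Rightarrow> 'e)) set"
where
  "Hhom \<Lambda> (A, f, B) (A', f', B') =
     {(\<alpha>, \<beta>). \<alpha> \<in> rhom \<Lambda> A A' \<and> \<beta> \<in> rhom \<Lambda> B B' \<and> (\<forall>x\<in>carrier A. \<beta> (f x) = f' (\<alpha> x))}"

fun Hcomp :: "('d \<Rightarrow> 'f) \<times> ('e \<Rightarrow> 'g) \<Rightarrow> ('b \<Rightarrow> 'd) \<times> ('c \<Rightarrow> 'e) \<Rightarrow> ('b \<Rightarrow> 'f) \<times> ('c \<Rightarrow> 'g)" where
  "Hcomp (\<alpha>, \<beta>) (\<alpha>', \<beta>') = (\<alpha> \<circ> \<alpha>', \<beta> \<circ> \<beta>')"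

text \<open>Equality of two morphisms with the given source.\<close>

fun Heq :: "('a, 'b, 'c) harrow \<Rightarrow> ('b \<Rightarrow> 'd) \<times> ('c \<Rightarrow> 'e) \<Rightarrow> ('b \<Rightarrow> 'd) \<times> ('c \<Rightarrow> 'e) \<Rightarrow> bool" where
  "Heq (A, f, B) (\<alpha>, \<beta>) (\<alpha>', \<beta>') \<longleftrightarrow>
     (\<forall>x\<in>carrier A. \<alpha> x = \<alpha>' x) \<and> (\<forall>y\<in>carrier B. \<beta> y = \<beta>' y)"

definition Hiso ::
  "('a, 's) ring_scheme \<Rightarrow> ('a, 'b, 'c) harrow \<Rightarrow> ('a, 'd, 'e) harrow \<Rightarrow> bool" where
  "Hiso \<Lambda> U Y \<longleftrightarrow> (\<exists>\<phi>\<in>Hhom \<Lambda> U Y. \<exists>\<psi>\<in>Hhom \<Lambda> Y U.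
     Heq U (Hcomp \<psi> \<phi>) (id, id) \<and> Heq Y (Hcomp \<phi> \<psi>) (id, id))"

fun Hzero :: "('a, 'b, 'c) harrow \<Rightarrow> bool" where
  "Hzero (A, f, B) \<longleftrightarrow> zero_rmodule A \<and> zero_rmodule B"

fun Hdsum ::
  "('a, 'b, 'c) harrow \<Rightarrow> ('a, 'd, 'e) harrow \<Rightarrow> ('a, 'b \<times> 'd, 'c \<times> 'e) harrow" where
  "Hdsum (A, f, B) (A', f', B') = (dsum A A', map_prod f f', dsum B B')"

definition Smono :: "('a, 's) ring_scheme \<Rightarrow> 'a umod set \<Rightarrow> 'a hobj set" where
  "Smono \<Lambda> \<C> = {(A, f, B). (A, f, B) \<in> Hobj \<Lambda> \<and> inj_on f (carrier A) \<and>
     A \<in> \<C> \<and> B \<in> \<C> \<and> in_sub \<Lambda> \<C> (cok f A B)}"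

text \<open>Indecomposability in a full subcategory \<open>\<S>\<close> of the morphism category.\<close>

definition Hindecomposable :: "('a, 's) ring_scheme \<Rightarrow> 'a hobj set \<Rightarrow> 'a hobj \<Rightarrow> bool" where
  "Hindecomposable \<Lambda> \<S> M \<longleftrightarrow> M \<in> \<S> \<and> \<not> Hzero M \<and>
     (\<forall>U\<in>\<S>. \<forall>Y\<in>\<S>. Hiso \<Lambda> M (Hdsum U Y) \<longrightarrow> Hzero U \<or> Hzero Y)"


section \<open>Exact structures\<close>

text \<open>An exact structure on a full subcategory \<open>\<S>\<close> of the morphism category is given as a set \<open>\<E>\<close>
  of short exact sequences \<open>(U, i, Z, p, Y)\<close>, where \<open>i : U \<rightarrow> Z\<close> and \<open>p : Z \<rightarrow> Y\<close>.\<close>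

type_synonym 'a hseq = "'a hobj \<times> 'a hmor \<times> 'a hobj \<times> 'a hmor \<times> 'a hobj"

definition ex_projective ::
  "('a, 's) ring_scheme \<Rightarrow> 'a hobj set \<Rightarrow> 'a hseq set \<Rightarrow> 'a hobj \<Rightarrow> bool" where
  "ex_projective \<Lambda> \<S> \<E> P \<longleftrightarrow> P \<in> \<S> \<and>
     (\<forall>U i Z p Y. (U, i, Z, p, Y) \<in> \<E> \<longrightarrow>
        (\<forall>\<phi>\<in>Hhom \<Lambda> P Y. \<exists>\<psi>\<in>Hhom \<Lambda> P Z. Heq P (Hcomp p \<psi>) \<phi>))"

definition ex_enough_projectives ::
  "('a, 's) ring_scheme \<Rightarrow> 'a hobj set \<Rightarrow> 'a hseq set \<Rightarrow> bool" where
  "ex_enough_projectives \<Lambda> \<S> \<E> \<longleftrightarrow>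
     (\<forall>Y\<in>\<S>. \<exists>U i P p. (U, i, P, p, Y) \<in> \<E> \<and> ex_projective \<Lambda> \<S> \<E> P)"

text \<open>Exactness in the morphism category is componentwise, so a sequence of morphisms which is
  split exact in each component is in particular short exact there.\<close>

definition Escw :: "('a, 's) ring_scheme \<Rightarrow> 'a umod set \<Rightarrow> 'a hseq set" where
  "Escw \<Lambda> \<C> = {((X\<^sub>1, f, X\<^sub>2), (i\<^sub>1, i\<^sub>2), (Z\<^sub>1, h, Z\<^sub>2), (p\<^sub>1, p\<^sub>2), (Y\<^sub>1, g, Y\<^sub>2)) |
       X\<^sub>1 f X\<^sub>2 i\<^sub>1 i\<^sub>2 Z\<^sub>1 h Z\<^sub>2 p\<^sub>1 p\<^sub>2 Y\<^sub>1 g Y\<^sub>2.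
     (X\<^sub>1, f, X\<^sub>2) \<in> Smono \<Lambda> \<C> \<and> (Z\<^sub>1, h, Z\<^sub>2) \<in> Smono \<Lambda> \<C> \<and> (Y\<^sub>1, g, Y\<^sub>2) \<in> Smono \<Lambda> \<C> \<and>
     (i\<^sub>1, i\<^sub>2) \<in> Hhom \<Lambda> (X\<^sub>1, f, X\<^sub>2) (Z\<^sub>1, h, Z\<^sub>2) \<and>
     (p\<^sub>1, p\<^sub>2) \<in> Hhom \<Lambda> (Z\<^sub>1, h, Z\<^sub>2) (Y\<^sub>1, g, Y\<^sub>2) \<and>
     split_exact \<Lambda> X\<^sub>1 i\<^sub>1 Z\<^sub>1 p\<^sub>1 Y\<^sub>1 \<and> split_exact \<Lambda> X\<^sub>2 i\<^sub>2 Z\<^sub>2 p\<^sub>2 Y\<^sub>2 \<and>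
     split_exact \<Lambda> (cok f X\<^sub>1 X\<^sub>2) (cok_map i\<^sub>2 h Z\<^sub>1 Z\<^sub>2) (cok h Z\<^sub>1 Z\<^sub>2)
       (cok_map p\<^sub>2 g Y\<^sub>1 Y\<^sub>2) (cok g Y\<^sub>1 Y\<^sub>2)}"

end

theory Submission
  imports Defs
begin

text \<open>Three kinds of objects of \<open>\<S>\<^sub>\<X>\<close> are projective for easy reasons. In a sequence of the exact structure
  the first terms, the second terms and the cokernels all split. A morphism from \<open>(X = X)\<close> is determined by
  its first component and lifts by a section of the first terms; a morphism from \<open>(0 \<rightarrow> X)\<close> lifts by a
  section of the second terms; and for \<open>K \<subseteq> F\<close> with \<open>F\<close> projective, a morphism from \<open>(K \<rightarrow> F)\<close> lifts modulo
  the images by a section of the cokernels, after which the error is corrected by a section of the first terms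
  (\<open>scw_lifts_identity\<close>, \<open>scw_lifts_zero\<close>, \<open>scw_lifts_kernel\<close>). Conversely, for an object
  \<open>(Y\<^sub>1 \<rightarrow> Y\<^sub>2)\<close> and an epimorphism \<open>F \<rightarrow> Y\<^sub>2\<close> from a projective module, let \<open>K\<close> be the kernel of the composite
  \<open>F \<rightarrow> Y\<^sub>2 \<rightarrow> Cok\<close>. Then \<open>(Y\<^sub>1 = Y\<^sub>1) \<oplus> (0 \<rightarrow> Y\<^sub>2) \<oplus> (K \<rightarrow> F)\<close> maps onto the object, and each summand provides
  one of the three splittings (\<open>cover_deflation\<close>). So there are enough projectives.

  Let \<open>(A \<rightarrow> B)\<close> now be indecomposable and projective. It is a summand of its cover, which writes the identity
  as a sum of three endomorphisms through the three summands (\<open>projective_identity_decomposition\<close>). The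
  endomorphism ring is local, so one of the three is invertible, and accordingly \<open>A \<rightarrow> B\<close> is an isomorphism, or
  \<open>A = 0\<close>, or \<open>B\<close> is projective (\<open>projective_trichotomy\<close>). In the last case, unless \<open>A \<rightarrow> B\<close> is an
  isomorphism, \<open>B\<close> is a projective cover of an indecomposable cokernel: endomorphisms of the cokernel lift to
  endomorphisms of the object, which are nilpotent or invertible (\<open>kernel_cover\<close>). In the other direction, a
  decomposition of an object of one of the three kinds induces one of the indecomposable module from which it
  is built (\<open>Hindecomposable_second\<close>, \<open>Hindecomposable_cover\<close>).

  Locality rests on a form of Fitting's lemma that uses only descending chains (\<open>fitting_idempotent\<close>,
  \<open>fitting\<close>): the endomorphisms form an artinian module over the base ring, because homomorphisms between
  finitely generated modules embed in a finite power of the target (\<open>dcc_rhom\<close>). Hence for an endomorphism \<open>e\<close>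
  both \<open>e\<^sup>n E\<close> and \<open>E e\<^sup>n\<close> stabilise, which makes a power of \<open>e\<close> generate the same one-sided ideals as an
  idempotent, and that idempotent splits the object.\<close>


section \<open>Homomorphisms of right modules\<close>

lemma rhomI:
  assumes "\<And>x. x \<in> carrier M \<Longrightarrow> f x \<in> carrier N"
    and "\<And>x y. x \<in> carrier M \<Longrightarrow> y \<in> carrier M \<Longrightarrow> f (x \<oplus>\<^bsub>M\<^esub> y) = f x \<oplus>\<^bsub>N\<^esub> f y"
    and "\<And>x a. x \<in> carrier M \<Longrightarrow> a \<in> carrier \<Lambda> \<Longrightarrow> f (x \<triangleleft>\<^bsub>M\<^esub> a) = f x \<triangleleft>\<^bsub>N\<^esub> a"
  shows "f \<in> rhom \<Lambda> M N"
  using assms by (auto simp: rhom_def)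

lemma rhom_closed: "f \<in> rhom \<Lambda> M N \<Longrightarrow> x \<in> carrier M \<Longrightarrow> f x \<in> carrier N"
  by (auto simp: rhom_def)

lemma rhom_add: "f \<in> rhom \<Lambda> M N \<Longrightarrow> x \<in> carrier M \<Longrightarrow> y \<in> carrier M \<Longrightarrow>
    f (x \<oplus>\<^bsub>M\<^esub> y) = f x \<oplus>\<^bsub>N\<^esub> f y"
  by (auto simp: rhom_def)

lemma rhom_act: "f \<in> rhom \<Lambda> M N \<Longrightarrow> x \<in> carrier M \<Longrightarrow> a \<in> carrier \<Lambda> \<Longrightarrow>
    f (x \<triangleleft>\<^bsub>M\<^esub> a) = f x \<triangleleft>\<^bsub>N\<^esub> a"
  by (auto simp: rhom_def)

lemma rhom_image: "f \<in> rhom \<Lambda> M N \<Longrightarrow> f ` carrier M \<subseteq> carrier N"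
  by (auto simp: rhom_def)

lemma rhom_id: "id \<in> rhom \<Lambda> M M" "(\<lambda>x. x) \<in> rhom \<Lambda> M M"
  by (auto simp: rhom_def)

lemma rhom_comp: "g \<in> rhom \<Lambda> N L \<Longrightarrow> f \<in> rhom \<Lambda> M N \<Longrightarrow> (\<lambda>x. g (f x)) \<in> rhom \<Lambda> M L"
  by (rule rhomI) (simp_all add: rhom_add rhom_act rhom_closed)

lemma rhom_comp': "g \<in> rhom \<Lambda> N L \<Longrightarrow> f \<in> rhom \<Lambda> M N \<Longrightarrow> g \<circ> f \<in> rhom \<Lambda> M L"
  using rhom_comp by (simp add: comp_def)

lemma rhom_cong:
  assumes f: "f \<in> rhom \<Lambda> M N" and M: "right_module \<Lambda> M" and e: "\<And>x. x \<in> carrier M \<Longrightarrow> f x = g x"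
  shows "g \<in> rhom \<Lambda> M N"
proof -
  interpret M: right_module \<Lambda> M by fact
  show ?thesis
    by (rule rhomI) (use f in \<open>simp_all add: e[symmetric] rhom_add rhom_act rhom_closed\<close>)
qed

lemma rhom_funpow: "f \<in> rhom \<Lambda> M M \<Longrightarrow> f ^^ n \<in> rhom \<Lambda> M M"
  by (induction n) (auto simp: rhom_id intro: rhom_comp')

context right_module
begin

lemma zero_ract [simp]: "a \<in> carrier \<Lambda> \<Longrightarrow> \<zero>\<^bsub>M\<^esub> \<triangleleft>\<^bsub>M\<^esub> a = \<zero>\<^bsub>M\<^esub>"
  using add_ract[of "\<zero>\<^bsub>M\<^esub>" "\<zero>\<^bsub>M\<^esub>" a]
  by (metis M.add.r_cancel_one' M.l_zero M.zero_closed ract_closed)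

lemma ract_zero [simp]: "x \<in> carrier M \<Longrightarrow> x \<triangleleft>\<^bsub>M\<^esub> \<zero>\<^bsub>\<Lambda>\<^esub> = \<zero>\<^bsub>M\<^esub>"
  using ract_add[of x "\<zero>\<^bsub>\<Lambda>\<^esub>" "\<zero>\<^bsub>\<Lambda>\<^esub>"]
  by (metis M.add.r_cancel_one' R.l_zero R.zero_closed ract_closed)

lemma neg_ract: "x \<in> carrier M \<Longrightarrow> a \<in> carrier \<Lambda> \<Longrightarrow> (\<ominus>\<^bsub>M\<^esub> x) \<triangleleft>\<^bsub>M\<^esub> a = \<ominus>\<^bsub>M\<^esub> (x \<triangleleft>\<^bsub>M\<^esub> a)"
  using add_ract[of "\<ominus>\<^bsub>M\<^esub> x" x a] by (simp add: M.l_neg M.minus_equality)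

lemma ract_neg: "x \<in> carrier M \<Longrightarrow> a \<in> carrier \<Lambda> \<Longrightarrow> x \<triangleleft>\<^bsub>M\<^esub> (\<ominus>\<^bsub>\<Lambda>\<^esub> a) = \<ominus>\<^bsub>M\<^esub> (x \<triangleleft>\<^bsub>M\<^esub> a)"
  using ract_add[of x "\<ominus>\<^bsub>\<Lambda>\<^esub> a" a] by (simp add: R.l_neg M.minus_equality)

lemma minus_add_cancel [simp]: "x \<in> carrier M \<Longrightarrow> y \<in> carrier M \<Longrightarrow> x \<ominus>\<^bsub>M\<^esub> y \<oplus>\<^bsub>M\<^esub> y = x"
  by (simp add: a_minus_def M.a_assoc M.l_neg)

lemma add_minus_cancel [simp]: "x \<in> carrier M \<Longrightarrow> y \<in> carrier M \<Longrightarrow> y \<oplus>\<^bsub>M\<^esub> (x \<ominus>\<^bsub>M\<^esub> y) = x"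
  by (metis M.a_comm M.minus_closed minus_add_cancel)

lemma eq_iff_minus: "x \<in> carrier M \<Longrightarrow> y \<in> carrier M \<Longrightarrow> x \<ominus>\<^bsub>M\<^esub> y = \<zero>\<^bsub>M\<^esub> \<longleftrightarrow> x = y"
  using minus_add_cancel[of x y] by (auto simp: a_minus_def M.r_neg simp del: minus_add_cancel)

lemma minus_ract: "x \<in> carrier M \<Longrightarrow> y \<in> carrier M \<Longrightarrow> a \<in> carrier \<Lambda> \<Longrightarrow>
    (x \<ominus>\<^bsub>M\<^esub> y) \<triangleleft>\<^bsub>M\<^esub> a = x \<triangleleft>\<^bsub>M\<^esub> a \<ominus>\<^bsub>M\<^esub> y \<triangleleft>\<^bsub>M\<^esub> a"
  by (simp add: a_minus_def add_ract neg_ract)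

lemma minus_add_minus: "x \<in> carrier M \<Longrightarrow> y \<in> carrier M \<Longrightarrow> x' \<in> carrier M \<Longrightarrow> y' \<in> carrier M \<Longrightarrow>
    (x \<oplus>\<^bsub>M\<^esub> x') \<ominus>\<^bsub>M\<^esub> (y \<oplus>\<^bsub>M\<^esub> y') = (x \<ominus>\<^bsub>M\<^esub> y) \<oplus>\<^bsub>M\<^esub> (x' \<ominus>\<^bsub>M\<^esub> y')"
  by (simp add: a_minus_def M.minus_add M.a_ac)

lemma rhom_add_map:
  assumes "f \<in> rhom \<Lambda> L M" "g \<in> rhom \<Lambda> L M"
  shows "(\<lambda>x. f x \<oplus>\<^bsub>M\<^esub> g x) \<in> rhom \<Lambda> L M"
  using assms by (intro rhomI) (auto simp: rhom_add rhom_act add_ract rhom_closed M.a_ac)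

lemma rhom_minus_map:
  assumes "f \<in> rhom \<Lambda> L M" "g \<in> rhom \<Lambda> L M"
  shows "(\<lambda>x. f x \<ominus>\<^bsub>M\<^esub> g x) \<in> rhom \<Lambda> L M"
  using assms
  by (intro rhomI) (auto simp: rhom_add rhom_act minus_ract rhom_closed minus_add_minus)

lemma rhom_zero_map: "(\<lambda>x. \<zero>\<^bsub>M\<^esub>) \<in> rhom \<Lambda> L M"
  by (intro rhomI) auto

end

lemma rhom_zero:
  assumes "right_module \<Lambda> M" "right_module \<Lambda> N" "f \<in> rhom \<Lambda> M N"
  shows "f \<zero>\<^bsub>M\<^esub> = \<zero>\<^bsub>N\<^esub>"
proof -
  interpret M: right_module \<Lambda> M by fact
  interpret N: right_module \<Lambda> N by fact
  show ?thesis
    using rhom_add[OF assms(3), of "\<zero>\<^bsub>M\<^esub>" "\<zero>\<^bsub>M\<^esub>"] rhom_closed[OF assms(3), of "\<zero>\<^bsub>M\<^esub>"]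
    by (metis M.M.l_zero M.M.zero_closed N.M.add.r_cancel_one')
qed

lemma rhom_minus:
  assumes "right_module \<Lambda> M" "right_module \<Lambda> N" "f \<in> rhom \<Lambda> M N" "x \<in> carrier M" "y \<in> carrier M"
  shows "f (x \<ominus>\<^bsub>M\<^esub> y) = f x \<ominus>\<^bsub>N\<^esub> f y"
proof -
  interpret M: right_module \<Lambda> M by fact
  interpret N: right_module \<Lambda> N by fact
  have "f (x \<ominus>\<^bsub>M\<^esub> y) \<oplus>\<^bsub>N\<^esub> f y = f x"
    using assms(4,5) rhom_add[OF assms(3), of "x \<ominus>\<^bsub>M\<^esub> y" y] by simp
  then show ?thesis
    using assms(4,5) rhom_closed[OF assms(3)]
    by (metis M.M.minus_closed N.M.add.right_cancel N.M.minus_closed N.minus_add_cancel)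
qed

lemma a_kernel_iff: "x \<in> a_kernel M N f \<longleftrightarrow> x \<in> carrier M \<and> f x = \<zero>\<^bsub>N\<^esub>"
  by (auto simp: a_kernel_def kernel_def)

lemma rhom_inj_iff:
  assumes "right_module \<Lambda> M" "right_module \<Lambda> N" "f \<in> rhom \<Lambda> M N"
  shows "inj_on f (carrier M) \<longleftrightarrow> (\<forall>x\<in>carrier M. f x = \<zero>\<^bsub>N\<^esub> \<longrightarrow> x = \<zero>\<^bsub>M\<^esub>)"
proof -
  interpret M: right_module \<Lambda> M by fact
  interpret N: right_module \<Lambda> N by fact
  show ?thesis
  proof
    assume "inj_on f (carrier M)"
    then show "\<forall>x\<in>carrier M. f x = \<zero>\<^bsub>N\<^esub> \<longrightarrow> x = \<zero>\<^bsub>M\<^esub>"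
      using rhom_zero[OF assms] M.M.zero_closed by (metis inj_onD)
  next
    assume *: "\<forall>x\<in>carrier M. f x = \<zero>\<^bsub>N\<^esub> \<longrightarrow> x = \<zero>\<^bsub>M\<^esub>"
    show "inj_on f (carrier M)"
    proof (rule inj_onI)
      fix x y assume xy: "x \<in> carrier M" "y \<in> carrier M" "f x = f y"
      then have "f (x \<ominus>\<^bsub>M\<^esub> y) = \<zero>\<^bsub>N\<^esub>"
        using rhom_minus[OF assms xy(1,2)] rhom_closed[OF assms(3)] by (simp add: N.eq_iff_minus)
      then show "x = y" using * xy M.eq_iff_minus[of x y] by auto
    qed
  qed
qed

lemma rhom_inv_into:
  assumes "right_module \<Lambda> M" "f \<in> rhom \<Lambda> M N" "bij_betw f (carrier M) (carrier N)"
  shows "inv_into (carrier M) f \<in> rhom \<Lambda> N M"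
proof -
  interpret M: right_module \<Lambda> M by fact
  let ?g = "inv_into (carrier M) f"
  have cl: "?g y \<in> carrier M" and fg: "f (?g y) = y" if "y \<in> carrier N" for y
    using assms(3) that by (auto simp: bij_betw_def inv_into_into f_inv_into_f)
  have gf: "?g (f x) = x" if "x \<in> carrier M" for x
    using assms(3) that by (simp add: bij_betw_def)
  show ?thesis
  proof (rule rhomI)
    fix x y assume "x \<in> carrier N" "y \<in> carrier N"
    then show "?g (x \<oplus>\<^bsub>N\<^esub> y) = ?g x \<oplus>\<^bsub>M\<^esub> ?g y"
      using gf[of "?g x \<oplus>\<^bsub>M\<^esub> ?g y"] by (simp add: rhom_add[OF assms(2)] cl fg)
  next
    fix x a assume "x \<in> carrier N" "a \<in> carrier \<Lambda>"
    then show "?g (x \<triangleleft>\<^bsub>N\<^esub> a) = ?g x \<triangleleft>\<^bsub>M\<^esub> a"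
      using gf[of "?g x \<triangleleft>\<^bsub>M\<^esub> a"] by (simp add: rhom_act[OF assms(2)] cl fg)
  qed (rule cl)
qed

lemma rhom_factor:
  assumes M: "right_module \<Lambda> M" and N: "right_module \<Lambda> N" and L: "right_module \<Lambda> L"
    and q: "q \<in> rhom \<Lambda> M N" "q ` carrier M = carrier N" and k: "k \<in> rhom \<Lambda> M L"
    and ker: "\<And>x. x \<in> carrier M \<Longrightarrow> q x = \<zero>\<^bsub>N\<^esub> \<Longrightarrow> k x = \<zero>\<^bsub>L\<^esub>"
  shows "\<exists>s\<in>rhom \<Lambda> N L. \<forall>x\<in>carrier M. s (q x) = k x"
proof -
  interpret M: right_module \<Lambda> M by fact
  interpret N: right_module \<Lambda> N by fact
  interpret L: right_module \<Lambda> L by fact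
  define s where "s y = k (inv_into (carrier M) q y)" for y
  have sq: "s (q x) = k x" if x: "x \<in> carrier M" for x
  proof -
    let ?x' = "inv_into (carrier M) q (q x)"
    have x': "?x' \<in> carrier M" "q ?x' = q x" using x by (auto simp: inv_into_into f_inv_into_f)
    then have "q (?x' \<ominus>\<^bsub>M\<^esub> x) = \<zero>\<^bsub>N\<^esub>"
      using x rhom_minus[OF M N q(1)] rhom_closed[OF q(1)] by (simp add: N.eq_iff_minus)
    then have "k (?x' \<ominus>\<^bsub>M\<^esub> x) = \<zero>\<^bsub>L\<^esub>" using x x' by (intro ker) auto
    then show ?thesis
      using x x' rhom_minus[OF M L k] rhom_closed[OF k] by (simp add: L.eq_iff_minus s_def)
  qed
  have "s \<in> rhom \<Lambda> N L"
  proof (rule rhomI)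
    fix y assume "y \<in> carrier N"
    then obtain x where x: "x \<in> carrier M" "y = q x" using q(2) by blast
    then show "s y \<in> carrier L" by (simp add: sq rhom_closed[OF k])
    fix a assume a: "a \<in> carrier \<Lambda>"
    show "s (y \<triangleleft>\<^bsub>N\<^esub> a) = s y \<triangleleft>\<^bsub>L\<^esub> a"
      using x a sq[of "x \<triangleleft>\<^bsub>M\<^esub> a"] by (simp add: rhom_act[OF q(1)] rhom_act[OF k] sq)
  next
    fix y z assume "y \<in> carrier N" "z \<in> carrier N"
    then obtain x w where x: "x \<in> carrier M" "y = q x" "w \<in> carrier M" "z = q w"
      using q(2) by blast
    then show "s (y \<oplus>\<^bsub>N\<^esub> z) = s y \<oplus>\<^bsub>L\<^esub> s z"
      using sq[of "x \<oplus>\<^bsub>M\<^esub> w"] by (simp add: rhom_add[OF q(1)] rhom_add[OF k] sq)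
  qed
  then show ?thesis using sq by (intro bexI[of _ s]) simp_all
qed

lemma fgmodD: "M \<in> fgmod \<Lambda> \<Longrightarrow> fg_rmodule \<Lambda> M" "M \<in> fgmod \<Lambda> \<Longrightarrow> right_module \<Lambda> M"
  by (auto simp: fgmod_def fg_rmodule_def)

lemma fg_rmodule_right: "fg_rmodule \<Lambda> M \<Longrightarrow> right_module \<Lambda> M"
  by (simp add: fg_rmodule_def)

lemma fg_rmodule_gens:
  assumes "fg_rmodule \<Lambda> M"
  obtains S where "finite S" "S \<subseteq> carrier M" "\<And>K. rsubmodule \<Lambda> M K \<Longrightarrow> S \<subseteq> K \<Longrightarrow> K = carrier M"
  using assms unfolding fg_rmodule_def by blast

lemma riso_sym:
  assumes "right_module \<Lambda> M" "riso \<Lambda> M N"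
  shows "riso \<Lambda> N M"
  using assms rhom_inv_into[of \<Lambda> M] bij_betw_inv_into unfolding riso_def by blast

lemma riso_trans: "riso \<Lambda> M N \<Longrightarrow> riso \<Lambda> N L \<Longrightarrow> riso \<Lambda> M L"
  unfolding riso_def by (metis rhom_comp' bij_betw_trans)

lemma riso_refl: "riso \<Lambda> M M"
  unfolding riso_def by (rule bexI[of _ id]) (auto simp: rhom_id)

lemma riso_zero:
  assumes "right_module \<Lambda> M" "right_module \<Lambda> N" "riso \<Lambda> M N"
  shows "zero_rmodule M \<longleftrightarrow> zero_rmodule N"
proof -
  obtain f where f: "f \<in> rhom \<Lambda> M N" "bij_betw f (carrier M) (carrier N)"
    using assms(3) by (auto simp: riso_def)
  interpret M: right_module \<Lambda> M by fact
  interpret N: right_module \<Lambda> N by fact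
  have f0: "f \<zero>\<^bsub>M\<^esub> = \<zero>\<^bsub>N\<^esub>" by (rule rhom_zero[OF assms(1,2) f(1)])
  have img: "f ` carrier M = carrier N" and inj: "inj_on f (carrier M)"
    using f(2) by (auto simp: bij_betw_def)
  show ?thesis unfolding zero_rmodule_def
  proof
    assume "carrier M = {\<zero>\<^bsub>M\<^esub>}" then show "carrier N = {\<zero>\<^bsub>N\<^esub>}" using img f0 by auto
  next
    assume N: "carrier N = {\<zero>\<^bsub>N\<^esub>}"
    show "carrier M = {\<zero>\<^bsub>M\<^esub>}"
    proof (intro equalityI subsetI)
      fix x assume x: "x \<in> carrier M"
      then have "f x = f \<zero>\<^bsub>M\<^esub>" using N f0 rhom_closed[OF f(1) x] by auto
      then show "x \<in> {\<zero>\<^bsub>M\<^esub>}" using inj x by (simp add: inj_on_eq_iff)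
    qed auto
  qed
qed


subsection \<open>Submodules\<close>

lemma rsubmoduleI:
  assumes "right_module \<Lambda> M" "N \<subseteq> carrier M" "\<zero>\<^bsub>M\<^esub> \<in> N"
    and "\<And>x y. x \<in> N \<Longrightarrow> y \<in> N \<Longrightarrow> x \<oplus>\<^bsub>M\<^esub> y \<in> N"
    and act: "\<And>x a. x \<in> N \<Longrightarrow> a \<in> carrier \<Lambda> \<Longrightarrow> x \<triangleleft>\<^bsub>M\<^esub> a \<in> N"
  shows "rsubmodule \<Lambda> M N"
proof -
  interpret M: right_module \<Lambda> M by fact
  have "subgroup N (add_monoid M)"
  proof (rule group.subgroupI[OF M.M.a_group])
    fix x assume x: "x \<in> N"
    then have "x \<triangleleft>\<^bsub>M\<^esub> (\<ominus>\<^bsub>\<Lambda>\<^esub> \<one>\<^bsub>\<Lambda>\<^esub>) = \<ominus>\<^bsub>M\<^esub> x"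
      using assms(2) by (subst M.ract_neg) auto
    then show "inv\<^bsub>add_monoid M\<^esub> x \<in> N"
      using act[OF x, of "\<ominus>\<^bsub>\<Lambda>\<^esub> \<one>\<^bsub>\<Lambda>\<^esub>"] by (simp add: a_inv_def)
  qed (use assms in auto)
  then show ?thesis using act by (simp add: rsubmodule_def)
qed

lemma rsubmoduleD:
  assumes "rsubmodule \<Lambda> M N"
  shows "N \<subseteq> carrier M" "\<zero>\<^bsub>M\<^esub> \<in> N" "\<And>x y. x \<in> N \<Longrightarrow> y \<in> N \<Longrightarrow> x \<oplus>\<^bsub>M\<^esub> y \<in> N"
    "\<And>x a. x \<in> N \<Longrightarrow> a \<in> carrier \<Lambda> \<Longrightarrow> x \<triangleleft>\<^bsub>M\<^esub> a \<in> N"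
    "\<And>x. x \<in> N \<Longrightarrow> \<ominus>\<^bsub>M\<^esub> x \<in> N"
  using assms subgroup.subset[of N "add_monoid M"] subgroup.one_closed[of N "add_monoid M"]
    subgroup.m_closed[of N "add_monoid M"] subgroup.m_inv_closed[of N "add_monoid M"]
  by (auto simp: rsubmodule_def a_inv_def)

lemma rsubmodule_right_module:
  assumes "right_module \<Lambda> M" "rsubmodule \<Lambda> M N"
  shows "right_module \<Lambda> (M\<lparr>carrier := N\<rparr>)"
proof -
  interpret M: right_module \<Lambda> M by fact
  note N = rsubmoduleD[OF assms(2)]
  have "abelian_group (M\<lparr>carrier := N\<rparr>)"
  proof (rule abelian_groupI)
    fix x assume "x \<in> carrier (M\<lparr>carrier := N\<rparr>)"
    then show "\<exists>y\<in>carrier (M\<lparr>carrier := N\<rparr>). y \<oplus>\<^bsub>M\<lparr>carrier := N\<rparr>\<^esub> x = \<zero>\<^bsub>M\<lparr>carrier := N\<rparr>\<^esub>"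
      using N(1,5) by (auto intro!: bexI[of _ "\<ominus>\<^bsub>M\<^esub> x"] simp: M.M.l_neg subset_iff)
  qed (use N in \<open>auto simp: M.M.a_ac subset_iff\<close>)
  then show ?thesis
    by (intro right_module.intro right_module_axioms.intro M.R.ring_axioms)
      (use N in \<open>auto simp: subset_iff M.ract_add M.add_ract M.ract_mult\<close>)
qed

lemma rsubmodule_a_kernel:
  assumes "right_module \<Lambda> M" "right_module \<Lambda> N" "f \<in> rhom \<Lambda> M N"
  shows "rsubmodule \<Lambda> M (a_kernel M N f)"
proof -
  interpret M: right_module \<Lambda> M by fact
  interpret N: right_module \<Lambda> N by fact
  show ?thesis
    by (rule rsubmoduleI)
      (use rhom_zero[OF assms] in \<open>auto simp: a_kernel_iff rhom_add[OF assms(3)] rhom_act[OF assms(3)] assms(1)\<close>)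
qed

lemma rsubmodule_image:
  assumes "right_module \<Lambda> M" "right_module \<Lambda> N" "f \<in> rhom \<Lambda> M N"
  shows "rsubmodule \<Lambda> N (f ` carrier M)"
proof -
  interpret M: right_module \<Lambda> M by fact
  interpret N: right_module \<Lambda> N by fact
  show ?thesis
  proof (rule rsubmoduleI)
    show "f ` carrier M \<subseteq> carrier N" using assms(3) by (rule rhom_image)
    show "\<zero>\<^bsub>N\<^esub> \<in> f ` carrier M" using rhom_zero[OF assms] M.M.zero_closed by (metis imageI)
    fix x assume "x \<in> f ` carrier M"
    then obtain x' where x: "x' \<in> carrier M" "x = f x'" by auto
    show "x \<triangleleft>\<^bsub>N\<^esub> a \<in> f ` carrier M" if "a \<in> carrier \<Lambda>" for a
      using x that rhom_act[OF assms(3), of x' a] by (metis M.ract_closed imageI)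
    fix y assume "y \<in> f ` carrier M"
    then obtain y' where y: "y' \<in> carrier M" "y = f y'" by auto
    show "x \<oplus>\<^bsub>N\<^esub> y \<in> f ` carrier M"
      using x y rhom_add[OF assms(3), of x' y'] by (metis M.M.add.m_closed imageI)
  qed (rule assms)
qed

lemma ker_rmodule_simps [simp]:
  "carrier (ker_rmodule f M N) = {x \<in> carrier M. f x = \<zero>\<^bsub>N\<^esub>}" "\<zero>\<^bsub>ker_rmodule f M N\<^esub> = \<zero>\<^bsub>M\<^esub>"
  "x \<oplus>\<^bsub>ker_rmodule f M N\<^esub> y = x \<oplus>\<^bsub>M\<^esub> y" "x \<triangleleft>\<^bsub>ker_rmodule f M N\<^esub> a = x \<triangleleft>\<^bsub>M\<^esub> a"
  by (auto simp: ker_rmodule_def a_kernel_iff)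

lemma rhom_restrict: "f \<in> rhom \<Lambda> M N \<Longrightarrow> K \<subseteq> carrier M \<Longrightarrow> f \<in> rhom \<Lambda> (M\<lparr>carrier := K\<rparr>) N"
  by (rule rhomI) (auto simp: rhom_add rhom_act rhom_closed subset_iff)

lemma rhom_into: "f \<in> rhom \<Lambda> M N \<Longrightarrow> f ` carrier M \<subseteq> K \<Longrightarrow> f \<in> rhom \<Lambda> M (N\<lparr>carrier := K\<rparr>)"
  by (auto simp: rhom_def)

lemma mono_lift:
  assumes A: "right_module \<Lambda> A" and f: "f \<in> rhom \<Lambda> A B" "inj_on f (carrier A)"
    and k: "k \<in> rhom \<Lambda> L B" "\<And>x. x \<in> carrier L \<Longrightarrow> k x \<in> f ` carrier A"
  shows "\<exists>l\<in>rhom \<Lambda> L A. \<forall>x\<in>carrier L. f (l x) = k x"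
proof -
  let ?I = "B\<lparr>carrier := f ` carrier A\<rparr>"
  have f': "f \<in> rhom \<Lambda> A ?I" by (rule rhom_into[OF f(1)]) simp
  have bij: "bij_betw f (carrier A) (carrier ?I)" using f(2) by (simp add: bij_betw_def)
  have k': "k \<in> rhom \<Lambda> L ?I" by (rule rhom_into[OF k(1)]) (use k(2) in auto)
  show ?thesis
    by (rule bexI[OF _ rhom_comp[OF rhom_inv_into[OF A f' bij] k']]) (simp add: k(2) f_inv_into_f)
qed

lemma rhom_eq_on_gens:
  assumes "right_module \<Lambda> M" "right_module \<Lambda> N" "f \<in> rhom \<Lambda> M N" "g \<in> rhom \<Lambda> M N"
    and gen: "\<And>K. rsubmodule \<Lambda> M K \<Longrightarrow> S \<subseteq> K \<Longrightarrow> K = carrier M"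
    and "S \<subseteq> carrier M" "\<And>s. s \<in> S \<Longrightarrow> f s = g s" and x: "x \<in> carrier M"
  shows "f x = g x"
proof -
  interpret M: right_module \<Lambda> M by fact
  interpret N: right_module \<Lambda> N by fact
  have "rsubmodule \<Lambda> M {x \<in> carrier M. f x = g x}"
    by (rule rsubmoduleI)
      (use assms(1-4) in \<open>auto simp: rhom_zero[OF assms(1,2)] rhom_add rhom_act\<close>)
  then have "{x \<in> carrier M. f x = g x} = carrier M" using assms(6,7) by (intro gen) auto
  then show ?thesis using x by blast
qed


subsection \<open>Direct sums\<close>

lemma dsum_simps [simp]:
  "carrier (dsum M N) = carrier M \<times> carrier N" "\<zero>\<^bsub>dsum M N\<^esub> = (\<zero>\<^bsub>M\<^esub>, \<zero>\<^bsub>N\<^esub>)"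
  "(x, y) \<oplus>\<^bsub>dsum M N\<^esub> (x', y') = (x \<oplus>\<^bsub>M\<^esub> x', y \<oplus>\<^bsub>N\<^esub> y')"
  "(x, y) \<triangleleft>\<^bsub>dsum M N\<^esub> a = (x \<triangleleft>\<^bsub>M\<^esub> a, y \<triangleleft>\<^bsub>N\<^esub> a)"
  by (simp_all add: dsum_def)

lemma dsum_right_module:
  assumes "right_module \<Lambda> M" "right_module \<Lambda> N"
  shows "right_module \<Lambda> (dsum M N)"
proof -
  interpret M: right_module \<Lambda> M by fact
  interpret N: right_module \<Lambda> N by fact
  have "abelian_group (dsum M N)"
  proof (rule abelian_groupI)
    fix x assume "x \<in> carrier (dsum M N)"
    then show "\<exists>y\<in>carrier (dsum M N). y \<oplus>\<^bsub>dsum M N\<^esub> x = \<zero>\<^bsub>dsum M N\<^esub>"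
      by (auto intro!: bexI[of _ "(\<ominus>\<^bsub>M\<^esub> (fst x), \<ominus>\<^bsub>N\<^esub> (snd x))"] simp: M.M.l_neg N.M.l_neg)
  qed (auto simp: M.M.a_ac N.M.a_ac)
  then show ?thesis
    by (intro right_module.intro right_module_axioms.intro M.R.ring_axioms)
      (auto simp: M.ract_add N.ract_add M.add_ract N.add_ract M.ract_mult N.ract_mult)
qed

lemma rhom_fst: "fst \<in> rhom \<Lambda> (dsum M N) M" and rhom_snd: "snd \<in> rhom \<Lambda> (dsum M N) N"
  by (auto simp: rhom_def)

lemma rhom_inl:
  assumes "right_module \<Lambda> N"
  shows "(\<lambda>x. (x, \<zero>\<^bsub>N\<^esub>)) \<in> rhom \<Lambda> M (dsum M N)"
proof -
  interpret right_module \<Lambda> N by fact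
  show ?thesis by (auto simp: rhom_def)
qed

lemma rhom_inr:
  assumes "right_module \<Lambda> M"
  shows "(\<lambda>x. (\<zero>\<^bsub>M\<^esub>, x)) \<in> rhom \<Lambda> N (dsum M N)"
proof -
  interpret right_module \<Lambda> M by fact
  show ?thesis by (auto simp: rhom_def)
qed

lemma rhom_Pair: "f \<in> rhom \<Lambda> L M \<Longrightarrow> g \<in> rhom \<Lambda> L N \<Longrightarrow> (\<lambda>x. (f x, g x)) \<in> rhom \<Lambda> L (dsum M N)"
  by (auto simp: rhom_def)

lemma rhom_map_prod:
  "f \<in> rhom \<Lambda> M M' \<Longrightarrow> g \<in> rhom \<Lambda> N N' \<Longrightarrow> map_prod f g \<in> rhom \<Lambda> (dsum M N) (dsum M' N')"
  by (auto simp: rhom_def)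

lemma rhom_copair:
  assumes "right_module \<Lambda> L" "f \<in> rhom \<Lambda> M L" "g \<in> rhom \<Lambda> N L"
  shows "(\<lambda>z. f (fst z) \<oplus>\<^bsub>L\<^esub> g (snd z)) \<in> rhom \<Lambda> (dsum M N) L"
  using right_module.rhom_add_map[OF assms(1) rhom_comp[OF assms(2) rhom_fst] rhom_comp[OF assms(3) rhom_snd]] .

lemma dsum_fg:
  assumes "fg_rmodule \<Lambda> M" "fg_rmodule \<Lambda> N"
  shows "fg_rmodule \<Lambda> (dsum M N)"
proof -
  note M = fg_rmodule_right[OF assms(1)] and N = fg_rmodule_right[OF assms(2)]
  interpret M: right_module \<Lambda> M by (rule M)
  interpret N: right_module \<Lambda> N by (rule N)
  obtain S where S: "finite S" "S \<subseteq> carrier M" "\<And>K. rsubmodule \<Lambda> M K \<Longrightarrow> S \<subseteq> K \<Longrightarrow> K = carrier M"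
    by (rule fg_rmodule_gens[OF assms(1)]) blast
  obtain T where T: "finite T" "T \<subseteq> carrier N" "\<And>K. rsubmodule \<Lambda> N K \<Longrightarrow> T \<subseteq> K \<Longrightarrow> K = carrier N"
    by (rule fg_rmodule_gens[OF assms(2)]) blast
  let ?D = "dsum M N" and ?S = "(\<lambda>x. (x, \<zero>\<^bsub>N\<^esub>)) ` S \<union> (\<lambda>x. (\<zero>\<^bsub>M\<^esub>, x)) ` T"
  have D: "right_module \<Lambda> ?D" using M N by (rule dsum_right_module)
  have "K = carrier ?D" if K: "rsubmodule \<Lambda> ?D K" "?S \<subseteq> K" for K
  proof -
    have "{x \<in> carrier M. (x, \<zero>\<^bsub>N\<^esub>) \<in> K} = carrier M"
      using K S(2) by (intro S(3) rsubmodule_vimage[OF M D rhom_inl[OF N]]) auto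
    moreover have "{x \<in> carrier N. (\<zero>\<^bsub>M\<^esub>, x) \<in> K} = carrier N"
      using K T(2) by (intro T(3) rsubmodule_vimage[OF N D rhom_inr[OF M]]) auto
    ultimately have "(x, \<zero>\<^bsub>N\<^esub>) \<in> K" "(\<zero>\<^bsub>M\<^esub>, y) \<in> K" if "x \<in> carrier M" "y \<in> carrier N" for x y
      using that by blast+
    then have "(x, \<zero>\<^bsub>N\<^esub>) \<oplus>\<^bsub>?D\<^esub> (\<zero>\<^bsub>M\<^esub>, y) \<in> K" if "x \<in> carrier M" "y \<in> carrier N" for x y
      using that rsubmoduleD(3)[OF K(1)] by blast
    then have "carrier ?D \<subseteq> K" by auto
    then show ?thesis using rsubmoduleD(1)[OF K(1)] by blast
  qed
  then show ?thesis
    unfolding fg_rmodule_def using D S(1,2) T(1,2)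
    by (intro conjI exI[of _ ?S]) auto
qed

lemma dsum_riso:
  assumes "riso \<Lambda> M M'" "riso \<Lambda> N N'"
  shows "riso \<Lambda> (dsum M N) (dsum M' N')"
proof -
  obtain f g where f: "f \<in> rhom \<Lambda> M M'" "bij_betw f (carrier M) (carrier M')"
    and g: "g \<in> rhom \<Lambda> N N'" "bij_betw g (carrier N) (carrier N')"
    using assms unfolding riso_def by blast
  have "bij_betw (map_prod f g) (carrier (dsum M N)) (carrier (dsum M' N'))"
    using f(2) g(2) by (simp add: bij_betw_map_prod)
  then show ?thesis unfolding riso_def using rhom_map_prod[OF f(1) g(1)] by blast
qed


subsection \<open>Cokernels\<close>

text \<open>Cosets are met only in this lemma and the next: everything else about \<open>Cok f\<close> and the maps between
  cokernels follows from the projection \<open>q\<close>.\<close>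

lemma cok_proj:
  assumes A: "right_module \<Lambda> A" and B: "fg_rmodule \<Lambda> B" and f: "f \<in> rhom \<Lambda> A B"
  obtains q where "q = (\<lambda>x. f ` carrier A +>\<^bsub>B\<^esub> x)" "q \<in> rhom \<Lambda> B (cok f A B)"
    "q ` carrier B = carrier (cok f A B)"
    "\<forall>x\<in>carrier B. q x = \<zero>\<^bsub>cok f A B\<^esub> \<longleftrightarrow> x \<in> f ` carrier A"
proof -
  define q where "q = (\<lambda>x. f ` carrier A +>\<^bsub>B\<^esub> x)"
  interpret A: right_module \<Lambda> A by fact
  interpret B: right_module \<Lambda> B using B by (simp add: fg_rmodule_def)
  have "subgroup (f ` carrier A) (add_monoid B)"
    using rsubmodule_image[OF A fg_rmodule_right[OF B] f] by (simp add: rsubmodule_def)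
  then interpret I: abelian_subgroup "f ` carrier A" B
    by (intro abelian_subgroupI3 additive_subgroup.intro B.M.abelian_group_axioms)
  have "q x = \<zero>\<^bsub>cok f A B\<^esub> \<longleftrightarrow> x \<in> f ` carrier A" if x: "x \<in> carrier B" for x
  proof -
    have "\<zero>\<^bsub>cok f A B\<^esub> = f ` carrier A" by (simp add: cok_def Let_def)
    then show ?thesis
      using x I.a_rcos_self[OF x] I.a_rcos_const unfolding q_def by auto
  qed
  moreover have "q ` carrier B = carrier (cok f A B)"
    by (auto simp: cok_def Let_def A_RCOSETS_def' q_def)
  ultimately show ?thesis using that[of q] cok_fg(2)[OF A B f] by (simp add: q_def)
qed

lemma cok_map_proj:
  assumes A: "right_module \<Lambda> A" and B: "fg_rmodule \<Lambda> B" and f: "f \<in> rhom \<Lambda> A B"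
    and A': "right_module \<Lambda> A'" and B': "fg_rmodule \<Lambda> B'" and f': "f' \<in> rhom \<Lambda> A' B'"
    and \<beta>: "\<beta> \<in> rhom \<Lambda> B B'" and \<beta>f: "\<And>x. x \<in> carrier A \<Longrightarrow> \<beta> (f x) \<in> f' ` carrier A'"
    and x: "x \<in> carrier B"
  shows "cok_map \<beta> f' A' B' (f ` carrier A +>\<^bsub>B\<^esub> x) = f' ` carrier A' +>\<^bsub>B'\<^esub> \<beta> x"
proof -
  interpret A: right_module \<Lambda> A by fact
  interpret B: right_module \<Lambda> B using B by (simp add: fg_rmodule_def)
  interpret B': right_module \<Lambda> B' using B' by (simp add: fg_rmodule_def)
  let ?I = "f ` carrier A" and ?I' = "f' ` carrier A'"
  have "subgroup ?I (add_monoid B)"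
    using rsubmodule_image[OF A fg_rmodule_right[OF B] f] by (simp add: rsubmodule_def)
  then interpret I: abelian_subgroup ?I B
    by (intro abelian_subgroupI3 additive_subgroup.intro B.M.abelian_group_axioms)
  have "subgroup ?I' (add_monoid B')"
    using rsubmodule_image[OF A' fg_rmodule_right[OF B'] f'] by (simp add: rsubmodule_def)
  then interpret I': abelian_subgroup ?I' B'
    by (intro abelian_subgroupI3 additive_subgroup.intro B'.M.abelian_group_axioms)
  have "?I' +>\<^bsub>B'\<^esub> \<beta> y = ?I' +>\<^bsub>B'\<^esub> \<beta> x" if y: "y \<in> ?I +>\<^bsub>B\<^esub> x" for y
  proof -
    obtain z where z: "z \<in> carrier A" "y = f z \<oplus>\<^bsub>B\<^esub> x" using y unfolding a_r_coset_def' by blast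
    then have "\<beta> y = \<beta> (f z) \<oplus>\<^bsub>B'\<^esub> \<beta> x" using x rhom_closed[OF f] by (simp add: rhom_add[OF \<beta>])
    then have "\<beta> y \<in> ?I' +>\<^bsub>B'\<^esub> \<beta> x" using \<beta>f[OF z(1)] unfolding a_r_coset_def' by blast
    then show ?thesis
      by (rule I'.a_repr_independence'[OF _ rhom_closed[OF \<beta> x], symmetric])
  qed
  moreover have "x \<in> ?I +>\<^bsub>B\<^esub> x" using x by (rule I.a_rcos_self)
  ultimately show ?thesis unfolding cok_map_def by blast
qed

text \<open>With this, any convenient epimorphism with kernel \<open>Im f\<close> can take the place of the coset model when
  membership of \<open>Cok f\<close> in a subcategory is to be shown.\<close>

lemma cok_riso:
  assumes A: "right_module \<Lambda> A" and B: "fg_rmodule \<Lambda> B" and f: "f \<in> rhom \<Lambda> A B"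
    and D: "right_module \<Lambda> D" and r: "r \<in> rhom \<Lambda> B D" "r ` carrier B = carrier D"
    and ker: "\<And>x. x \<in> carrier B \<Longrightarrow> r x = \<zero>\<^bsub>D\<^esub> \<longleftrightarrow> x \<in> f ` carrier A"
  shows "riso \<Lambda> (cok f A B) D"
proof -
  obtain q where q: "q = (\<lambda>x. f ` carrier A +>\<^bsub>B\<^esub> x)" "q \<in> rhom \<Lambda> B (cok f A B)"
    "q ` carrier B = carrier (cok f A B)"
    "\<forall>x\<in>carrier B. q x = \<zero>\<^bsub>cok f A B\<^esub> \<longleftrightarrow> x \<in> f ` carrier A"
    by (rule cok_proj[OF A B f])
  have C: "right_module \<Lambda> (cok f A B)" using cok_fg(1)[OF A B f] by (rule fg_rmodule_right)
  have "\<exists>s\<in>rhom \<Lambda> (cok f A B) D. \<forall>x\<in>carrier B. s (q x) = r x"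
    by (rule rhom_factor[OF fg_rmodule_right[OF B] C D q(2,3) r(1)]) (use ker q(4) in auto)
  then obtain s where s: "s \<in> rhom \<Lambda> (cok f A B) D" "\<forall>x\<in>carrier B. s (q x) = r x" ..
  have "inj_on s (carrier (cok f A B))"
    unfolding rhom_inj_iff[OF C D s(1)]
    using s(2) ker q(4) by (auto simp: q(3)[symmetric])
  moreover have "s ` carrier (cok f A B) = carrier D"
    using r(2) s(2) unfolding q(3)[symmetric] by (simp add: image_image)
  ultimately show ?thesis unfolding riso_def using s(1) by (intro bexI[of _ s]) (simp_all add: bij_betw_def)
qed

section \<open>Subcategories and projective modules\<close>

lemma fg_rep:
  assumes "fg_rmodule \<Lambda> M"
  obtains N e where "N \<in> fgmod \<Lambda>" "e \<in> rhom \<Lambda> M N" "bij_betw e (carrier M) (carrier N)"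
    "inv_into (carrier M) e \<in> rhom \<Lambda> N M"
  using fg_rmodule_represented[OF assms] rhom_inv_into[OF fg_rmodule_right[OF assms]]
  unfolding riso_def by blast

lemma in_sub_riso: "riso \<Lambda> M N \<Longrightarrow> in_sub \<Lambda> \<C> N \<Longrightarrow> in_sub \<Lambda> \<C> M"
  unfolding in_sub_def using riso_trans by blast

lemma in_subI: "M \<in> \<C> \<Longrightarrow> in_sub \<Lambda> \<C> M"
  unfolding in_sub_def using riso_refl by blast

lemma resolvingD:
  assumes "resolving \<Lambda> \<C>"
  shows "\<C> \<subseteq> fgmod \<Lambda>" "prj \<Lambda> \<subseteq> \<C>"
    "\<forall>M\<in>\<C>. \<forall>N\<in>\<C>. in_sub \<Lambda> \<C> (dsum M N)"
    "\<forall>M\<in>fgmod \<Lambda>. \<forall>N\<in>fgmod \<Lambda>. in_sub \<Lambda> \<C> (dsum M N) \<longrightarrow> M \<in> \<C> \<and> N \<in> \<C>"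
    "\<forall>M\<in>\<C>. \<forall>N\<in>\<C>. \<forall>g\<in>rhom \<Lambda> M N. g ` carrier M = carrier N \<longrightarrow> ker_rmodule g M N \<in> \<C>"
  using assms unfolding resolving_def subcategory_def by - (elim conjE, assumption)+

lemma resolving_fgmod: "resolving \<Lambda> \<C> \<Longrightarrow> M \<in> \<C> \<Longrightarrow> M \<in> fgmod \<Lambda>"
  using resolvingD(1) by (rule subsetD)

lemma resolving_right_module: "resolving \<Lambda> \<C> \<Longrightarrow> M \<in> \<C> \<Longrightarrow> right_module \<Lambda> M"
  by (rule fgmodD(2)[OF resolving_fgmod])

lemma resolving_prj: "resolving \<Lambda> \<C> \<Longrightarrow> P \<in> prj \<Lambda> \<Longrightarrow> P \<in> \<C>"
  using resolvingD(2) by (rule subsetD)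

lemma resolving_dsum:
  assumes "resolving \<Lambda> \<C>" "in_sub \<Lambda> \<C> M" "in_sub \<Lambda> \<C> N"
  shows "in_sub \<Lambda> \<C> (dsum M N)"
proof -
  obtain M' where M: "M' \<in> \<C>" "riso \<Lambda> M M'" using assms(2) unfolding in_sub_def by (elim bexE)
  obtain N' where N: "N' \<in> \<C>" "riso \<Lambda> N N'" using assms(3) unfolding in_sub_def by (elim bexE)
  have "in_sub \<Lambda> \<C> (dsum M' N')"
    using resolvingD(3)[OF assms(1)] M(1) N(1) by blast
  then show ?thesis by (rule in_sub_riso[OF dsum_riso[OF M(2) N(2)]])
qed

lemma resolving_summand:
  assumes "resolving \<Lambda> \<C>" "M \<in> fgmod \<Lambda>" "N \<in> fgmod \<Lambda>" "in_sub \<Lambda> \<C> (dsum M N)"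
  shows "M \<in> \<C>"
  using resolvingD(4)[OF assms(1)] assms(2-4) by blast

lemma resolving_kernel:
  assumes "resolving \<Lambda> \<C>" "M \<in> \<C>" "N \<in> \<C>" "g \<in> rhom \<Lambda> M N" "g ` carrier M = carrier N"
  shows "ker_rmodule g M N \<in> \<C>"
  using resolvingD(5)[OF assms(1)] assms(2-5) by blast


subsection \<open>Summands cut out by idempotents\<close>

text \<open>For an idempotent \<open>g\<close> this is the image of \<open>g\<close>; as a set of fixed points it is visibly closed under
  the operations.\<close>

definition fix_mod :: "('b \<Rightarrow> 'b) \<Rightarrow> ('a, 'b) rmodule \<Rightarrow> ('a, 'b) rmodule" where
  "fix_mod g M = M\<lparr>carrier := {x \<in> carrier M. g x = x}\<rparr>"

lemma fix_mod_simps [simp]: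
  "carrier (fix_mod g M) = {x \<in> carrier M. g x = x}" "\<zero>\<^bsub>fix_mod g M\<^esub> = \<zero>\<^bsub>M\<^esub>"
  "x \<oplus>\<^bsub>fix_mod g M\<^esub> y = x \<oplus>\<^bsub>M\<^esub> y" "x \<triangleleft>\<^bsub>fix_mod g M\<^esub> a = x \<triangleleft>\<^bsub>M\<^esub> a"
  by (simp_all add: fix_mod_def)

lemma fix_mod_right_module:
  assumes M: "right_module \<Lambda> M" and g: "g \<in> rhom \<Lambda> M M"
  shows "right_module \<Lambda> (fix_mod g M)"
proof -
  interpret M: right_module \<Lambda> M by fact
  have "rsubmodule \<Lambda> M {x \<in> carrier M. g x = x}"
    by (rule rsubmoduleI)
      (use M rhom_zero[OF M M g] in \<open>auto simp: rhom_add[OF g] rhom_act[OF g]\<close>)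
  then show ?thesis unfolding fix_mod_def using rsubmodule_right_module[OF M] by blast
qed

lemma fix_mod_fgmod:
  assumes M: "M \<in> fgmod \<Lambda>" and g: "g \<in> rhom \<Lambda> M M"
    and idem: "\<And>x. x \<in> carrier M \<Longrightarrow> g (g x) = g x"
  shows "fix_mod g M \<in> fgmod \<Lambda>"
proof -
  have "g \<in> rhom \<Lambda> M (fix_mod g M)"
    by (rule rhomI) (auto simp: idem rhom_closed[OF g] rhom_add[OF g] rhom_act[OF g])
  moreover have "g ` carrier M = carrier (fix_mod g M)"
  proof (intro equalityI subsetI)
    fix x assume "x \<in> carrier (fix_mod g M)"
    then show "x \<in> g ` carrier M" by (simp add: image_iff) (metis (no_types))
  qed (auto simp: idem rhom_closed[OF g])
  ultimately show ?thesis
    using fg_rmodule_image[OF fgmodD(1)[OF M] fix_mod_right_module[OF fgmodD(2)[OF M] g]]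
    by (auto simp: fgmod_def)
qed

lemma complement_idempotent:
  assumes M: "right_module \<Lambda> M" and g: "g \<in> rhom \<Lambda> M M"
    and idem: "\<And>x. x \<in> carrier M \<Longrightarrow> g (g x) = g x" and x: "x \<in> carrier M"
  shows "g (x \<ominus>\<^bsub>M\<^esub> g x) = \<zero>\<^bsub>M\<^esub>"
    "(x \<ominus>\<^bsub>M\<^esub> g x) \<ominus>\<^bsub>M\<^esub> g (x \<ominus>\<^bsub>M\<^esub> g x) = x \<ominus>\<^bsub>M\<^esub> g x"
    "x \<ominus>\<^bsub>M\<^esub> g x = x \<longleftrightarrow> g x = \<zero>\<^bsub>M\<^esub>"
proof -
  interpret M: right_module \<Lambda> M by fact
  note gc = rhom_closed[OF g]
  show 1: "g (x \<ominus>\<^bsub>M\<^esub> g x) = \<zero>\<^bsub>M\<^esub>"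
    using x by (simp add: rhom_minus[OF M M g] gc idem M.eq_iff_minus)
  show "(x \<ominus>\<^bsub>M\<^esub> g x) \<ominus>\<^bsub>M\<^esub> g (x \<ominus>\<^bsub>M\<^esub> g x) = x \<ominus>\<^bsub>M\<^esub> g x"
    using x gc by (simp add: 1) (simp add: a_minus_def)
  have "x \<ominus>\<^bsub>M\<^esub> g x \<oplus>\<^bsub>M\<^esub> g x = x" using x gc by simp
  then show "x \<ominus>\<^bsub>M\<^esub> g x = x \<longleftrightarrow> g x = \<zero>\<^bsub>M\<^esub>"
  proof (safe)
    assume "x \<ominus>\<^bsub>M\<^esub> g x = x"
    with \<open>x \<ominus>\<^bsub>M\<^esub> g x \<oplus>\<^bsub>M\<^esub> g x = x\<close> have "x \<oplus>\<^bsub>M\<^esub> g x = x" by simp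
    then show "g x = \<zero>\<^bsub>M\<^esub>" using x gc[OF x] M.M.add.r_cancel_one'[of x "g x"] by auto
  next
    assume "g x = \<zero>\<^bsub>M\<^esub>" then show "x \<ominus>\<^bsub>M\<^esub> g x = x" using x by (simp add: a_minus_def)
  qed
qed

lemma fix_mod_dsum:
  assumes M: "right_module \<Lambda> M" and g: "g \<in> rhom \<Lambda> M M"
    and idem: "\<And>x. x \<in> carrier M \<Longrightarrow> g (g x) = g x"
  defines "D \<equiv> dsum (fix_mod g M) (fix_mod (\<lambda>x. x \<ominus>\<^bsub>M\<^esub> g x) M)"
  shows "(\<lambda>z. fst z \<oplus>\<^bsub>M\<^esub> snd z) \<in> rhom \<Lambda> D M"
    "bij_betw (\<lambda>z. fst z \<oplus>\<^bsub>M\<^esub> snd z) (carrier D) (carrier M)"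
proof -
  interpret M: right_module \<Lambda> M by fact
  let ?h = "\<lambda>x. x \<ominus>\<^bsub>M\<^esub> g x"
  have h: "?h \<in> rhom \<Lambda> M M" by (rule M.rhom_minus_map[OF rhom_id(2) g])
  have D: "right_module \<Lambda> D"
    unfolding D_def by (intro dsum_right_module fix_mod_right_module M g h)
  note gc = rhom_closed[OF g]
  show hom: "(\<lambda>z. fst z \<oplus>\<^bsub>M\<^esub> snd z) \<in> rhom \<Lambda> D M"
    by (rule rhomI) (auto simp: D_def M.M.a_ac M.add_ract)
  have gz: "g (fst z \<oplus>\<^bsub>M\<^esub> snd z) = fst z" and z: "fst z \<in> carrier M" "snd z \<in> carrier M"
    if "z \<in> carrier D" for z
  proof -
    show z: "fst z \<in> carrier M" "snd z \<in> carrier M" using that by (auto simp: D_def)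
    have "g (fst z) = fst z" "g (snd z) = \<zero>\<^bsub>M\<^esub>"
      using that complement_idempotent(3)[where g = g, OF M g idem z(2)] by (auto simp: D_def)
    then show "g (fst z \<oplus>\<^bsub>M\<^esub> snd z) = fst z" using z by (simp add: rhom_add[OF g])
  qed
  show "bij_betw (\<lambda>z. fst z \<oplus>\<^bsub>M\<^esub> snd z) (carrier D) (carrier M)"
    unfolding bij_betw_def
  proof
    show "inj_on (\<lambda>z. fst z \<oplus>\<^bsub>M\<^esub> snd z) (carrier D)"
    proof (rule inj_onI)
      fix z w assume zw: "z \<in> carrier D" "w \<in> carrier D"
        and eq: "fst z \<oplus>\<^bsub>M\<^esub> snd z = fst w \<oplus>\<^bsub>M\<^esub> snd w"
      have "fst z = fst w" using gz[OF zw(1)] gz[OF zw(2)] eq by simp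
      moreover have "snd z = snd w"
        using eq z[OF zw(1)] z[OF zw(2)] M.M.add.l_cancel[of "fst w" "snd z" "snd w"] calculation by simp
      ultimately show "z = w" by (rule prod_eqI)
    qed
    show "(\<lambda>z. fst z \<oplus>\<^bsub>M\<^esub> snd z) ` carrier D = carrier M"
    proof (intro equalityI subsetI)
      fix x assume x: "x \<in> carrier M"
      then have "(g x, x \<ominus>\<^bsub>M\<^esub> g x) \<in> carrier D"
        using complement_idempotent(2)[where g = g, OF M g idem x] by (simp add: D_def gc idem)
      moreover have "x = fst (g x, x \<ominus>\<^bsub>M\<^esub> g x) \<oplus>\<^bsub>M\<^esub> snd (g x, x \<ominus>\<^bsub>M\<^esub> g x)" using x gc by simp
      ultimately show "x \<in> (\<lambda>z. fst z \<oplus>\<^bsub>M\<^esub> snd z) ` carrier D" by (rule image_eqI[rotated])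
    qed (use rhom_closed[OF hom] in auto)
  qed
qed

lemma fix_mod_resolving:
  assumes C: "resolving \<Lambda> \<C>" and MC: "M \<in> \<C>" and g: "g \<in> rhom \<Lambda> M M"
    and idem: "\<And>x. x \<in> carrier M \<Longrightarrow> g (g x) = g x"
  shows "fix_mod g M \<in> \<C>"
proof (rule resolving_summand[OF C])
  have M: "M \<in> fgmod \<Lambda>" using resolving_fgmod[OF C MC] .
  interpret M: right_module \<Lambda> M using fgmodD(2)[OF M] .
  show "fix_mod g M \<in> fgmod \<Lambda>" by (rule fix_mod_fgmod[where g = g, OF M g idem])
  show "fix_mod (\<lambda>x. x \<ominus>\<^bsub>M\<^esub> g x) M \<in> fgmod \<Lambda>"
    by (rule fix_mod_fgmod[where g = "\<lambda>x. x \<ominus>\<^bsub>M\<^esub> g x", OF M M.rhom_minus_map[OF rhom_id(2) g]])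
      (rule complement_idempotent(2)[where g = g, OF fgmodD(2)[OF M] g idem])
  show "in_sub \<Lambda> \<C> (dsum (fix_mod g M) (fix_mod (\<lambda>x. x \<ominus>\<^bsub>M\<^esub> g x) M))"
    using MC fix_mod_dsum[where g = g, OF fgmodD(2)[OF M] g idem] unfolding in_sub_def riso_def by blast
qed


subsection \<open>Projective modules\<close>

lemma prj_fgmod: "P \<in> prj \<Lambda> \<Longrightarrow> P \<in> fgmod \<Lambda>"
  by (simp only: prj_def mem_Collect_eq)

lemma prjD:
  assumes "P \<in> prj \<Lambda>" "M \<in> fgmod \<Lambda>" "N \<in> fgmod \<Lambda>" "g \<in> rhom \<Lambda> M N"
    "h \<in> rhom \<Lambda> P N" "g ` carrier M = carrier N"
  shows "\<exists>k\<in>rhom \<Lambda> P M. \<forall>x\<in>carrier P. g (k x) = h x"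
proof -
  have "\<forall>M\<in>fgmod \<Lambda>. \<forall>N\<in>fgmod \<Lambda>. \<forall>g\<in>rhom \<Lambda> M N. \<forall>h\<in>rhom \<Lambda> P N.
     g ` carrier M = carrier N \<longrightarrow> (\<exists>k\<in>rhom \<Lambda> P M. \<forall>x\<in>carrier P. g (k x) = h x)"
    using assms(1) unfolding prj_def mem_Collect_eq by (elim conjE)
  from this[THEN bspec, OF assms(2), THEN bspec, OF assms(3), THEN bspec, OF assms(4),
      THEN bspec, OF assms(5), THEN mp, OF assms(6)]
  show ?thesis .
qed

lemma prj_lift:
  assumes P: "P \<in> prj \<Lambda>" and M: "fg_rmodule \<Lambda> M" and N: "fg_rmodule \<Lambda> N"
    and g: "g \<in> rhom \<Lambda> M N" "g ` carrier M = carrier N" and h: "h \<in> rhom \<Lambda> P N"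
  shows "\<exists>k\<in>rhom \<Lambda> P M. \<forall>x\<in>carrier P. g (k x) = h x"
proof -
  obtain M' i where i: "M' \<in> fgmod \<Lambda>" "i \<in> rhom \<Lambda> M M'" "bij_betw i (carrier M) (carrier M')"
    "inv_into (carrier M) i \<in> rhom \<Lambda> M' M" by (rule fg_rep[OF M])
  obtain N' j where j: "N' \<in> fgmod \<Lambda>" "j \<in> rhom \<Lambda> N N'" "bij_betw j (carrier N) (carrier N')"
    "inv_into (carrier N) j \<in> rhom \<Lambda> N' N" by (rule fg_rep[OF N])
  let ?i' = "inv_into (carrier M) i"
  let ?g = "\<lambda>y. j (g (?i' y))"
  have g': "?g \<in> rhom \<Lambda> M' N'" by (intro rhom_comp[OF j(2)] rhom_comp[OF g(1)] i(4))
  have surj: "?g ` carrier M' = carrier N'"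
  proof -
    have "?i' ` carrier M' = carrier M" using bij_betw_inv_into[OF i(3)] by (simp add: bij_betw_def)
    then show ?thesis using g(2) j(3) by (metis bij_betw_imp_surj_on image_image)
  qed
  have h': "(\<lambda>x. j (h x)) \<in> rhom \<Lambda> P N'" by (rule rhom_comp[OF j(2) h])
  obtain k where k: "k \<in> rhom \<Lambda> P M'" "\<forall>x\<in>carrier P. ?g (k x) = j (h x)"
    using prjD[OF P i(1) j(1) g' h' surj] by (elim bexE)
  show ?thesis
  proof (intro bexI ballI)
    show "(\<lambda>x. ?i' (k x)) \<in> rhom \<Lambda> P M" by (rule rhom_comp[OF i(4) k(1)])
    fix x assume x: "x \<in> carrier P"
    then have "g (?i' (k x)) \<in> carrier N" "h x \<in> carrier N"
      using rhom_closed[OF g(1)] rhom_closed[OF i(4)] rhom_closed[OF k(1)] rhom_closed[OF h] by auto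
    then show "g (?i' (k x)) = h x" using bspec[OF k(2) x] j(3) by (auto simp: bij_betw_def inj_on_eq_iff)
  qed
qed

lemma prj_retract:
  assumes P: "P \<in> prj \<Lambda>" and Q: "Q \<in> fgmod \<Lambda>" and i: "i \<in> rhom \<Lambda> Q P" and r: "r \<in> rhom \<Lambda> P Q"
    and ri: "\<And>x. x \<in> carrier Q \<Longrightarrow> r (i x) = x"
  shows "Q \<in> prj \<Lambda>"
  unfolding prj_def
proof (intro CollectI conjI ballI impI)
  fix M N g h
  assume MN: "M \<in> fgmod \<Lambda>" "N \<in> fgmod \<Lambda>" and g: "g \<in> rhom \<Lambda> M N" "g ` carrier M = carrier N"
    and h: "h \<in> rhom \<Lambda> Q N"
  obtain k where k: "k \<in> rhom \<Lambda> P M" "\<forall>x\<in>carrier P. g (k x) = h (r x)"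
    using prj_lift[OF P fgmodD(1)[OF MN(1)] fgmodD(1)[OF MN(2)] g rhom_comp[OF h r]] by (elim bexE)
  show "\<exists>k\<in>rhom \<Lambda> Q M. \<forall>x\<in>carrier Q. g (k x) = h x"
    using rhom_comp[OF k(1) i] k(2) ri rhom_closed[OF i] by (intro bexI[of _ "\<lambda>x. k (i x)"]) simp_all
qed (rule Q)

lemma prj_dsum:
  assumes P: "P \<in> prj \<Lambda>" and Q: "Q \<in> prj \<Lambda>"
  obtains S e e' where "S \<in> prj \<Lambda>" "e \<in> rhom \<Lambda> (dsum P Q) S" "e' \<in> rhom \<Lambda> S (dsum P Q)"
    "\<forall>z\<in>carrier (dsum P Q). e' (e z) = z"
proof -
  let ?D = "dsum P Q"
  note fP = fgmodD[OF prj_fgmod[OF P]] and fQ = fgmodD[OF prj_fgmod[OF Q]]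
  interpret P: right_module \<Lambda> P by (rule fP(2))
  interpret Q: right_module \<Lambda> Q by (rule fQ(2))
  obtain S e where e: "S \<in> fgmod \<Lambda>" "e \<in> rhom \<Lambda> ?D S" "bij_betw e (carrier ?D) (carrier S)"
    "inv_into (carrier ?D) e \<in> rhom \<Lambda> S ?D" by (rule fg_rep[OF dsum_fg[OF fP(1) fQ(1)]])
  let ?e' = "inv_into (carrier ?D) e"
  have "S \<in> prj \<Lambda>"
    unfolding prj_def
  proof (intro CollectI conjI ballI impI)
    fix M N g h
    assume MN: "M \<in> fgmod \<Lambda>" "N \<in> fgmod \<Lambda>" and g: "g \<in> rhom \<Lambda> M N" "g ` carrier M = carrier N"
      and h: "h \<in> rhom \<Lambda> S N"
    note fM = fgmodD[OF MN(1)] and fN = fgmodD[OF MN(2)]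
    have he: "(\<lambda>z. h (e z)) \<in> rhom \<Lambda> ?D N" by (rule rhom_comp[OF h e(2)])
    obtain k where k: "k \<in> rhom \<Lambda> P M" "\<forall>x\<in>carrier P. g (k x) = h (e (x, \<zero>\<^bsub>Q\<^esub>))"
      using prj_lift[OF P fM(1) fN(1) g rhom_comp[OF he rhom_inl[OF fQ(2)]]] by (elim bexE)
    obtain l where l: "l \<in> rhom \<Lambda> Q M" "\<forall>x\<in>carrier Q. g (l x) = h (e (\<zero>\<^bsub>P\<^esub>, x))"
      using prj_lift[OF Q fM(1) fN(1) g rhom_comp[OF he rhom_inr[OF fP(2)]]] by (elim bexE)
    let ?m = "\<lambda>z. k (fst z) \<oplus>\<^bsub>M\<^esub> l (snd z)"
    have m: "?m \<in> rhom \<Lambda> ?D M" by (rule rhom_copair[OF fM(2) k(1) l(1)])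
    have gm: "g (?m z) = h (e z)" if z: "z \<in> carrier ?D" for z
    proof -
      obtain x y where xy: "z = (x, y)" "x \<in> carrier P" "y \<in> carrier Q" using z by auto
      then have "g (?m z) = h (e (x, \<zero>\<^bsub>Q\<^esub>)) \<oplus>\<^bsub>N\<^esub> h (e (\<zero>\<^bsub>P\<^esub>, y))"
        using k l by (simp add: rhom_add[OF g(1)] rhom_closed[OF k(1)] rhom_closed[OF l(1)])
      also have "\<dots> = h (e ((x, \<zero>\<^bsub>Q\<^esub>) \<oplus>\<^bsub>?D\<^esub> (\<zero>\<^bsub>P\<^esub>, y)))"
        using rhom_add[OF he, of "(x, \<zero>\<^bsub>Q\<^esub>)" "(\<zero>\<^bsub>P\<^esub>, y)"] xy by simp
      finally show ?thesis using xy by simp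
    qed
    show "\<exists>k\<in>rhom \<Lambda> S M. \<forall>x\<in>carrier S. g (k x) = h x"
    proof (intro bexI ballI)
      show "(\<lambda>x. ?m (?e' x)) \<in> rhom \<Lambda> S M" by (rule rhom_comp[OF m e(4)])
      fix x assume "x \<in> carrier S"
      then show "g (?m (?e' x)) = h x"
        using gm[of "?e' x"] rhom_closed[OF e(4)] bij_betw_inv_into_right[OF e(3)] by simp
    qed
  qed (rule e(1))
  then show ?thesis using that[of S e ?e'] e(2,4) bij_betw_inv_into_left[OF e(3)] by simp
qed

definition regular :: "('a, 's) ring_scheme \<Rightarrow> ('a, 'a) rmodule" where
  "regular \<Lambda> = \<lparr>carrier = carrier \<Lambda>, monoid.mult = undefined, monoid.one = undefined,
     ring.zero = \<zero>\<^bsub>\<Lambda>\<^esub>, ring.add = (\<oplus>\<^bsub>\<Lambda>\<^esub>), ract = (\<otimes>\<^bsub>\<Lambda>\<^esub>)\<rparr>"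

lemma regular_simps: "carrier (regular \<Lambda>) = carrier \<Lambda>" "\<zero>\<^bsub>regular \<Lambda>\<^esub> = \<zero>\<^bsub>\<Lambda>\<^esub>"
  "x \<oplus>\<^bsub>regular \<Lambda>\<^esub> y = x \<oplus>\<^bsub>\<Lambda>\<^esub> y" "x \<triangleleft>\<^bsub>regular \<Lambda>\<^esub> a = x \<otimes>\<^bsub>\<Lambda>\<^esub> a"
  by (simp_all add: regular_def)

lemma regular_right_module:
  assumes "ring \<Lambda>"
  shows "right_module \<Lambda> (regular \<Lambda>)"
proof -
  interpret R: ring \<Lambda> by fact
  have "abelian_group (regular \<Lambda>)"
  proof (rule abelian_groupI)
    fix x assume "x \<in> carrier (regular \<Lambda>)"
    then show "\<exists>y\<in>carrier (regular \<Lambda>). y \<oplus>\<^bsub>regular \<Lambda>\<^esub> x = \<zero>\<^bsub>regular \<Lambda>\<^esub>"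
      by (auto intro!: bexI[of _ "\<ominus>\<^bsub>\<Lambda>\<^esub> x"] simp: regular_simps R.l_neg)
  qed (auto simp: regular_simps R.a_ac)
  then show ?thesis
    by (intro right_module.intro right_module_axioms.intro R.ring_axioms)
      (auto simp: regular_simps R.l_distr R.r_distr R.m_assoc)
qed

text \<open>\<open>F\<close> is a copy of \<open>\<Lambda>\<^sub>\<Lambda>\<close> among the modules over the universal type, with \<open>u\<close> in the place of \<open>1\<close>.\<close>

lemma prj_free_generator:
  assumes "ring \<Lambda>"
  obtains F u where "F \<in> prj \<Lambda>" "u \<in> carrier F"
    "\<forall>M :: 'a umod. right_module \<Lambda> M \<longrightarrow> (\<forall>y\<in>carrier M. \<exists>h\<in>rhom \<Lambda> F M. h u = y)"
proof -
  interpret R: ring \<Lambda> by fact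
  let ?L = "regular \<Lambda>"
  note simps = regular_simps and L = regular_right_module[OF assms]
  have "fg_rmodule \<Lambda> ?L"
    unfolding fg_rmodule_def
  proof (intro conjI exI[of _ "{\<one>\<^bsub>\<Lambda>\<^esub>}"] allI impI)
    fix N assume N: "rsubmodule \<Lambda> ?L N \<and> {\<one>\<^bsub>\<Lambda>\<^esub>} \<subseteq> N"
    have "x \<in> N" if "x \<in> carrier \<Lambda>" for x
      using rsubmoduleD(4)[of \<Lambda> ?L N "\<one>\<^bsub>\<Lambda>\<^esub>" x] N that by (simp add: simps)
    then show "N = carrier ?L" using N rsubmoduleD(1)[of \<Lambda> ?L N] by (auto simp: simps)
  qed (auto simp: simps L)
  then obtain F e where e: "F \<in> fgmod \<Lambda>" "e \<in> rhom \<Lambda> ?L F" "bij_betw e (carrier ?L) (carrier F)"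
    "inv_into (carrier ?L) e \<in> rhom \<Lambda> F ?L" by (rule fg_rep)
  let ?e' = "inv_into (carrier ?L) e"
  have ex: "\<exists>h\<in>rhom \<Lambda> F M. h (e \<one>\<^bsub>\<Lambda>\<^esub>) = y"
    if M: "right_module \<Lambda> M" and y: "y \<in> carrier M" for M :: "'a umod" and y
  proof -
    interpret M: right_module \<Lambda> M by fact
    have "(\<lambda>x. y \<triangleleft>\<^bsub>M\<^esub> x) \<in> rhom \<Lambda> ?L M"
      by (rule rhomI) (use y in \<open>auto simp: simps M.ract_add M.ract_mult\<close>)
    then have "(\<lambda>x. y \<triangleleft>\<^bsub>M\<^esub> ?e' x) \<in> rhom \<Lambda> F M" using rhom_comp e(4) by fast
    moreover have "?e' (e \<one>\<^bsub>\<Lambda>\<^esub>) = \<one>\<^bsub>\<Lambda>\<^esub>" using bij_betw_inv_into_left[OF e(3)] by (simp add: simps)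
    ultimately show ?thesis using y by (intro bexI[of _ "\<lambda>x. y \<triangleleft>\<^bsub>M\<^esub> ?e' x"]) simp_all
  qed
  have u: "e \<one>\<^bsub>\<Lambda>\<^esub> \<in> carrier F" using rhom_closed[OF e(2)] by (simp add: simps)
  have gen: "\<exists>a\<in>carrier \<Lambda>. x = e \<one>\<^bsub>\<Lambda>\<^esub> \<triangleleft>\<^bsub>F\<^esub> a" if x: "x \<in> carrier F" for x
  proof -
    obtain a where "a \<in> carrier \<Lambda>" "x = e a" using x e(3) by (auto simp: bij_betw_def simps)
    then show ?thesis using rhom_act[OF e(2), of "\<one>\<^bsub>\<Lambda>\<^esub>" a] by (auto simp: simps)
  qed
  have "F \<in> prj \<Lambda>"
    unfolding prj_def
  proof (intro CollectI conjI ballI impI)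
    fix M N g h
    assume MN: "M \<in> fgmod \<Lambda>" "N \<in> fgmod \<Lambda>" and g: "g \<in> rhom \<Lambda> M N" "g ` carrier M = carrier N"
      and h: "h \<in> rhom \<Lambda> F N"
    obtain y where y: "y \<in> carrier M" "g y = h (e \<one>\<^bsub>\<Lambda>\<^esub>)"
      using rhom_closed[OF h u] g(2) by (metis imageE)
    obtain k where k: "k \<in> rhom \<Lambda> F M" "k (e \<one>\<^bsub>\<Lambda>\<^esub>) = y" using ex fgmodD(2)[OF MN(1)] y(1) by blast
    have "g (k x) = h x" if x: "x \<in> carrier F" for x
      using gen[OF x] u y k by (auto simp: rhom_act[OF k(1)] rhom_act[OF g(1)] rhom_act[OF h])
    then show "\<exists>k\<in>rhom \<Lambda> F M. \<forall>x\<in>carrier F. g (k x) = h x" using k(1) by blast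
  qed (rule e(1))
  then show ?thesis using that[of F "e \<one>\<^bsub>\<Lambda>\<^esub>"] u ex by simp
qed

text \<open>Add one copy of the free module for every element to be hit. As only finitely many elements are
  prescribed, the target may fail to be finitely generated: in the minimality proof for projective covers
  it is an arbitrary submodule.\<close>

lemma prj_hits_finite_set:
  fixes M :: "'a umod"
  assumes M: "right_module \<Lambda> M" and "finite S" "S \<subseteq> carrier M"
  shows "\<exists>F\<in>prj \<Lambda>. \<exists>h\<in>rhom \<Lambda> F M. S \<subseteq> h ` carrier F"
proof -
  interpret M: right_module \<Lambda> M by fact
  obtain L u where L: "L \<in> prj \<Lambda>" "u \<in> carrier L"
    "\<forall>M :: 'a umod. right_module \<Lambda> M \<longrightarrow> (\<forall>y\<in>carrier M. \<exists>h\<in>rhom \<Lambda> L M. h u = y)"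
    by (rule prj_free_generator[OF M.R.ring_axioms])
  show ?thesis using assms(2,3)
  proof (induction S)
    case empty
    then show ?case using L(1) M.rhom_zero_map by blast
  next
    case (insert y S)
    then obtain F h where F: "F \<in> prj \<Lambda>" "h \<in> rhom \<Lambda> F M" "S \<subseteq> h ` carrier F" by auto
    obtain k where k: "k \<in> rhom \<Lambda> L M" "k u = y" using L(3) M insert.prems by blast
    obtain G e e' where G: "G \<in> prj \<Lambda>" "e \<in> rhom \<Lambda> (dsum F L) G" "e' \<in> rhom \<Lambda> G (dsum F L)"
      "\<forall>z\<in>carrier (dsum F L). e' (e z) = z" by (rule prj_dsum[OF F(1) L(1)])
    let ?m = "\<lambda>z. h (fst z) \<oplus>\<^bsub>M\<^esub> k (snd z)"
    have m: "?m \<in> rhom \<Lambda> (dsum F L) M" by (rule rhom_copair[OF M F(2) k(1)])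
    have hit: "?m z \<in> (\<lambda>x. ?m (e' x)) ` carrier G" if "z \<in> carrier (dsum F L)" for z
      using imageI[OF rhom_closed[OF G(2) that], of "\<lambda>x. ?m (e' x)"] bspec[OF G(4) that] by simp
    note FM = fgmodD(2)[OF prj_fgmod[OF F(1)]] and LM = fgmodD(2)[OF prj_fgmod[OF L(1)]]
    interpret F: right_module \<Lambda> F by (rule FM)
    interpret L: right_module \<Lambda> L by (rule LM)
    have "S \<subseteq> (\<lambda>x. ?m (e' x)) ` carrier G"
    proof
      fix s assume "s \<in> S"
      then obtain x where "x \<in> carrier F" "s = h x" using F(3) by auto
      then show "s \<in> (\<lambda>x. ?m (e' x)) ` carrier G"
        using hit[of "(x, \<zero>\<^bsub>L\<^esub>)"] rhom_zero[OF LM M k(1)] rhom_closed[OF F(2)] by simp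
    qed
    moreover have "y \<in> (\<lambda>x. ?m (e' x)) ` carrier G"
      using hit[of "(\<zero>\<^bsub>F\<^esub>, u)"] rhom_zero[OF FM M F(2)] L(2) k(2) insert.prems by simp
    ultimately show ?case
      using G(1) rhom_comp[OF m G(3)] by (intro bexI[of _ G] bexI[of _ "\<lambda>x. ?m (e' x)"]) auto
  qed
qed

lemma prj_cover:
  assumes "M \<in> fgmod \<Lambda>"
  obtains F h where "F \<in> prj \<Lambda>" "h \<in> rhom \<Lambda> F M" "h ` carrier F = carrier M"
proof -
  note M = fgmodD[OF assms]
  obtain S where S: "finite S" "S \<subseteq> carrier M" "\<And>K. rsubmodule \<Lambda> M K \<Longrightarrow> S \<subseteq> K \<Longrightarrow> K = carrier M"
    by (rule fg_rmodule_gens[OF M(1)]) blast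
  obtain F h where F: "F \<in> prj \<Lambda>" "h \<in> rhom \<Lambda> F M" "S \<subseteq> h ` carrier F"
    using prj_hits_finite_set[OF M(2) S(1,2)] by (elim bexE)
  have "h ` carrier F = carrier M"
    using S(3)[OF rsubmodule_image[OF fgmodD(2)[OF prj_fgmod[OF F(1)]] M(2) F(2)] F(3)] .
  then show ?thesis by (rule that[OF F(1,2)])
qed

section \<open>Descending chains of homomorphisms\<close>

text \<open>Chains run through submodules of \<open>M\<close>, but their stabilisation is only measured on \<open>W\<close>. This makes it
  possible to enlarge \<open>W\<close> step by step without passing to quotient modules.\<close>

definition dcc :: "('r, 's) ring_scheme \<Rightarrow> ('r, 'b) rmodule \<Rightarrow> 'b set \<Rightarrow> bool" where
  "dcc R M W \<longleftrightarrow> (\<forall>D :: nat \<Rightarrow> 'b set. (\<forall>n. rsubmodule R M (D n) \<and> D (Suc n) \<subseteq> D n) \<longrightarrow>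
     (\<exists>n. \<forall>m\<ge>n. D n \<inter> W \<subseteq> D m))"

lemma dccD:
  assumes "dcc R M W" "\<And>n. rsubmodule R M (D n)" "\<And>n. D (Suc n) \<subseteq> D n"
  shows "\<exists>n. \<forall>m\<ge>n. D n \<inter> W \<subseteq> D m"
  using assms unfolding dcc_def by simp

text \<open>Extensions of modules with the descending chain condition have it too. Here \<open>W + \<phi>(T)\<close>
  is built from \<open>W\<close>; a chain is controlled by its trace on \<open>W\<close> and by the submodules of those \<open>t\<close> for
  which some \<open>w + \<phi>(t)\<close> belongs to it.\<close>

lemma dcc_extend:
  assumes M: "right_module R M" and T: "right_module R T" and \<phi>: "\<phi> \<in> rhom R T M"
    and W: "rsubmodule R M W" "dcc R M W" and "dcc R T (carrier T)"
  shows "dcc R M {w \<oplus>\<^bsub>M\<^esub> \<phi> t | w t. w \<in> W \<and> t \<in> carrier T}"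
  unfolding dcc_def
proof (intro allI impI)
  interpret M: right_module R M by fact
  interpret T: right_module R T by fact
  fix D :: "nat \<Rightarrow> _" assume D: "\<forall>n. rsubmodule R M (D n) \<and> D (Suc n) \<subseteq> D n"
  have dec: "m \<ge> n \<Longrightarrow> D m \<subseteq> D n" for m n by (rule lift_Suc_antimono_le[where f = D]) (use D in auto)
  have sub: "rsubmodule R M (D n)" for n using D by blast
  note WD = rsubmoduleD[OF W(1)] and DD = rsubmoduleD[OF sub]
  have minus: "x \<ominus>\<^bsub>M\<^esub> y \<in> K" if "rsubmodule R M K" "x \<in> K" "y \<in> K" for x y K
    unfolding a_minus_def by (intro rsubmoduleD(3,5)[OF that(1)] that)
  have Wc: "w \<in> carrier M" if "w \<in> W" for w using WD(1) that by auto
  note \<phi>c = rhom_closed[OF \<phi>]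
  define J where "J n = {t \<in> carrier T. \<exists>w\<in>W. w \<oplus>\<^bsub>M\<^esub> \<phi> t \<in> D n}" for n
  have "rsubmodule R T (J n)" for n
  proof (rule rsubmoduleI[OF T])
    show "J n \<subseteq> carrier T" by (auto simp: J_def)
    have "\<zero>\<^bsub>M\<^esub> \<oplus>\<^bsub>M\<^esub> \<phi> \<zero>\<^bsub>T\<^esub> \<in> D n" using DD(2) rhom_zero[OF T M \<phi>] by simp
    then show "\<zero>\<^bsub>T\<^esub> \<in> J n" unfolding J_def using WD(2) by blast
    fix t assume "t \<in> J n"
    then obtain w where t: "t \<in> carrier T" "w \<in> W" "w \<oplus>\<^bsub>M\<^esub> \<phi> t \<in> D n" unfolding J_def by blast
    show "t \<triangleleft>\<^bsub>T\<^esub> a \<in> J n" if a: "a \<in> carrier R" for a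
    proof -
      have "w \<triangleleft>\<^bsub>M\<^esub> a \<oplus>\<^bsub>M\<^esub> \<phi> (t \<triangleleft>\<^bsub>T\<^esub> a) \<in> D n"
        using DD(4)[OF t(3) a] t a Wc by (simp add: M.add_ract \<phi>c rhom_act[OF \<phi>])
      then show ?thesis unfolding J_def using WD(4)[OF t(2) a] t(1) a by blast
    qed
    fix t' assume "t' \<in> J n"
    then obtain w' where t': "t' \<in> carrier T" "w' \<in> W" "w' \<oplus>\<^bsub>M\<^esub> \<phi> t' \<in> D n" unfolding J_def by blast
    have "(w \<oplus>\<^bsub>M\<^esub> w') \<oplus>\<^bsub>M\<^esub> \<phi> (t \<oplus>\<^bsub>T\<^esub> t') \<in> D n"
      using DD(3)[OF t(3) t'(3)] t t' Wc by (simp add: rhom_add[OF \<phi>] \<phi>c M.M.a_ac)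
    then show "t \<oplus>\<^bsub>T\<^esub> t' \<in> J n" unfolding J_def using WD(3)[OF t(2) t'(2)] t(1) t'(1) by blast
  qed
  moreover have "J (Suc n) \<subseteq> J n" for n using D unfolding J_def by blast
  ultimately obtain n2 where n2: "\<forall>m\<ge>n2. J n2 \<inter> carrier T \<subseteq> J m"
    using dccD[OF \<open>dcc R T (carrier T)\<close>, of J] by blast
  obtain n1 where n1: "\<forall>m\<ge>n1. D n1 \<inter> W \<subseteq> D m" using dccD[OF W(2), of D] D by blast
  show "\<exists>n. \<forall>m\<ge>n. D n \<inter> {w \<oplus>\<^bsub>M\<^esub> \<phi> t | w t. w \<in> W \<and> t \<in> carrier T} \<subseteq> D m"
  proof (intro exI[of _ "max n1 n2"] allI impI subsetI)
    fix m c assume m: "m \<ge> max n1 n2" and "c \<in> D (max n1 n2) \<inter> {w \<oplus>\<^bsub>M\<^esub> \<phi> t | w t. w \<in> W \<and> t \<in> carrier T}"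
    then obtain w t where c: "c \<in> D n1" "c \<in> D n2" and wt: "c = w \<oplus>\<^bsub>M\<^esub> \<phi> t" "w \<in> W" "t \<in> carrier T"
      using dec[of n1 "max n1 n2"] dec[of n2 "max n1 n2"] by auto
    then have "t \<in> J n2 \<inter> carrier T" unfolding J_def by blast
    then have "t \<in> J m" using n2 m by auto
    then obtain w' where w': "w' \<in> W" "w' \<oplus>\<^bsub>M\<^esub> \<phi> t \<in> D m" unfolding J_def by blast
    have "c \<ominus>\<^bsub>M\<^esub> (w' \<oplus>\<^bsub>M\<^esub> \<phi> t) = w \<ominus>\<^bsub>M\<^esub> w'"
      using wt w' Wc \<phi>c[OF wt(3)] by (simp add: a_minus_def M.M.minus_add M.M.a_ac M.M.r_neg M.M.r_neg1 M.M.r_neg2)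
    moreover have "c \<ominus>\<^bsub>M\<^esub> (w' \<oplus>\<^bsub>M\<^esub> \<phi> t) \<in> D n1"
      using c(1) w'(2) dec[of n1 m] m by (intro minus[OF sub]) auto
    ultimately have "w \<ominus>\<^bsub>M\<^esub> w' \<in> D m" using n1 m minus[OF W(1) wt(2) w'(1)] by auto
    then have "(w \<ominus>\<^bsub>M\<^esub> w') \<oplus>\<^bsub>M\<^esub> (w' \<oplus>\<^bsub>M\<^esub> \<phi> t) \<in> D m" using w'(2) by (rule DD(3))
    moreover have "(w \<ominus>\<^bsub>M\<^esub> w') \<oplus>\<^bsub>M\<^esub> (w' \<oplus>\<^bsub>M\<^esub> \<phi> t) = c"
      using wt w' Wc \<phi>c[OF wt(3)] by (simp add: a_minus_def M.M.a_assoc M.M.r_neg1)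
    ultimately show "c \<in> D m" by simp
  qed
qed

text \<open>A finitely generated \<open>S\<close>-module inherits the descending chain condition for \<open>R\<close>-submodules from
  \<open>S\<close>: adjoin the generators one at a time. Here \<open>M'\<close> and \<open>T\<close> stand for \<open>M\<close> and \<open>S\<close>, regarded as
  \<open>R\<close>-modules.\<close>

lemma dcc_generated:
  assumes fg: "fg_rmodule S M" and M': "right_module R M'" and T: "right_module R T"
    and same: "\<zero>\<^bsub>M'\<^esub> = \<zero>\<^bsub>M\<^esub>" "\<And>x y. x \<oplus>\<^bsub>M'\<^esub> y = x \<oplus>\<^bsub>M\<^esub> y" "carrier T = carrier S"
    and orbit: "\<And>u. u \<in> carrier M \<Longrightarrow> (\<lambda>a. u \<triangleleft>\<^bsub>M\<^esub> a) \<in> rhom R T M'"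
    and restr: "\<And>W. rsubmodule S M W \<Longrightarrow> rsubmodule R M' W" and "dcc R T (carrier T)"
  shows "dcc R M' (carrier M)"
proof -
  note M = fg_rmodule_right[OF fg]
  interpret M: right_module S M by (rule M)
  obtain G where G: "finite G" "G \<subseteq> carrier M" "\<And>K. rsubmodule S M K \<Longrightarrow> G \<subseteq> K \<Longrightarrow> K = carrier M"
    by (rule fg_rmodule_gens[OF fg]) blast
  have "\<exists>W. rsubmodule S M W \<and> G \<subseteq> W \<and> dcc R M' W"
    using G(1,2)
  proof (induction G)
    case empty
    have "rsubmodule S M {\<zero>\<^bsub>M\<^esub>}" by (rule rsubmoduleI[OF M]) auto
    moreover have "dcc R M' {\<zero>\<^bsub>M\<^esub>}" unfolding dcc_def using rsubmoduleD(2)[of R M'] same(1) by auto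
    ultimately show ?case by blast
  next
    case (insert u G)
    then obtain W where W: "rsubmodule S M W" "G \<subseteq> W" "dcc R M' W" by auto
    have u: "u \<in> carrier M" using insert.prems by simp
    note WE = rsubmoduleD[OF W(1)]
    let ?W = "{w \<oplus>\<^bsub>M\<^esub> u \<triangleleft>\<^bsub>M\<^esub> a | w a. w \<in> W \<and> a \<in> carrier S}"
    have I: "w \<oplus>\<^bsub>M\<^esub> u \<triangleleft>\<^bsub>M\<^esub> a \<in> ?W" if "w \<in> W" "a \<in> carrier S" for w a using that by blast
    have Wc: "w \<in> carrier M" if "w \<in> W" for w using WE(1) that by auto
    have "rsubmodule S M ?W"
    proof (rule rsubmoduleI[OF M])
      show "?W \<subseteq> carrier M" using Wc u by auto
      show "\<zero>\<^bsub>M\<^esub> \<in> ?W" using I[OF WE(2) M.R.zero_closed] u by simp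
      fix x assume "x \<in> ?W"
      then obtain w a where x: "w \<in> W" "a \<in> carrier S" "x = w \<oplus>\<^bsub>M\<^esub> u \<triangleleft>\<^bsub>M\<^esub> a" by blast
      show "x \<triangleleft>\<^bsub>M\<^esub> b \<in> ?W" if b: "b \<in> carrier S" for b
        using I[OF WE(4)[OF x(1) b] M.R.m_closed[OF x(2) b]] x u b Wc by (simp add: M.add_ract M.ract_mult)
      fix y assume "y \<in> ?W"
      then obtain w' a' where y: "w' \<in> W" "a' \<in> carrier S" "y = w' \<oplus>\<^bsub>M\<^esub> u \<triangleleft>\<^bsub>M\<^esub> a'" by blast
      show "x \<oplus>\<^bsub>M\<^esub> y \<in> ?W"
        using I[OF WE(3)[OF x(1) y(1)] M.R.a_closed[OF x(2) y(2)]] x y u Wc by (simp add: M.ract_add M.M.a_ac)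
    qed
    moreover have "dcc R M' ?W"
      using dcc_extend[OF M' T orbit[OF u] restr[OF W(1)] W(3) \<open>dcc R T (carrier T)\<close>] by (simp add: same)
    moreover have "insert u G \<subseteq> ?W"
    proof -
      have "u \<in> ?W" using I[OF WE(2) M.R.one_closed] u by simp
      moreover have "w \<in> ?W" if "w \<in> W" for w
        using I[OF that M.R.zero_closed] u Wc[OF that] by simp
      ultimately show ?thesis using W(2) by blast
    qed
    ultimately show ?case by blast
  qed
  then obtain W where W: "rsubmodule S M W" "G \<subseteq> W" "dcc R M' W" by blast
  show ?thesis using G(3)[OF W(1,2)] W(3) by simp
qed

locale artin =
  fixes R :: "('r, 's) ring_scheme" and \<Lambda> :: "('r, 'a) module"
  assumes artin: "artin_algebra R \<Lambda>"
begin

sublocale R: cring R using artin by (simp add: artin_algebra_def)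
sublocale L: ring \<Lambda> using artin by (simp add: artin_algebra_def)
sublocale RL: module R \<Lambda> using artin by (simp add: artin_algebra_def)

lemma smult_mult:
  assumes "r \<in> carrier R" "x \<in> carrier \<Lambda>" "y \<in> carrier \<Lambda>"
  shows "r \<odot>\<^bsub>\<Lambda>\<^esub> (x \<otimes>\<^bsub>\<Lambda>\<^esub> y) = (r \<odot>\<^bsub>\<Lambda>\<^esub> x) \<otimes>\<^bsub>\<Lambda>\<^esub> y"
    "r \<odot>\<^bsub>\<Lambda>\<^esub> (x \<otimes>\<^bsub>\<Lambda>\<^esub> y) = x \<otimes>\<^bsub>\<Lambda>\<^esub> (r \<odot>\<^bsub>\<Lambda>\<^esub> y)"
  using artin assms unfolding artin_algebra_def by blast+

text \<open>The structure map \<open>R \<rightarrow> \<Lambda>\<close>, whose image is central.\<close>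

definition sc :: "'r \<Rightarrow> 'a" where "sc r = r \<odot>\<^bsub>\<Lambda>\<^esub> \<one>\<^bsub>\<Lambda>\<^esub>"

lemma sc_closed [simp]: "r \<in> carrier R \<Longrightarrow> sc r \<in> carrier \<Lambda>"
  by (simp add: sc_def)

lemma sc_mult: "r \<in> carrier R \<Longrightarrow> a \<in> carrier \<Lambda> \<Longrightarrow> sc r \<otimes>\<^bsub>\<Lambda>\<^esub> a = r \<odot>\<^bsub>\<Lambda>\<^esub> a"
  "r \<in> carrier R \<Longrightarrow> a \<in> carrier \<Lambda> \<Longrightarrow> a \<otimes>\<^bsub>\<Lambda>\<^esub> sc r = r \<odot>\<^bsub>\<Lambda>\<^esub> a"
  using smult_mult(1)[of r "\<one>\<^bsub>\<Lambda>\<^esub>" a] smult_mult(2)[of r a "\<one>\<^bsub>\<Lambda>\<^esub>"] by (simp_all add: sc_def)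

lemma sc_hom:
  "sc \<zero>\<^bsub>R\<^esub> = \<zero>\<^bsub>\<Lambda>\<^esub>" "sc \<one>\<^bsub>R\<^esub> = \<one>\<^bsub>\<Lambda>\<^esub>" "sc (\<ominus>\<^bsub>R\<^esub> \<one>\<^bsub>R\<^esub>) = \<ominus>\<^bsub>\<Lambda>\<^esub> \<one>\<^bsub>\<Lambda>\<^esub>"
  "r \<in> carrier R \<Longrightarrow> s \<in> carrier R \<Longrightarrow> sc (r \<oplus>\<^bsub>R\<^esub> s) = sc r \<oplus>\<^bsub>\<Lambda>\<^esub> sc s"
  "r \<in> carrier R \<Longrightarrow> s \<in> carrier R \<Longrightarrow> sc (r \<otimes>\<^bsub>R\<^esub> s) = sc r \<otimes>\<^bsub>\<Lambda>\<^esub> sc s"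
  by (simp_all add: sc_mult(1)) (simp_all add: sc_def RL.smult_l_null RL.smult_one RL.smult_l_minus
    RL.smult_l_distr RL.smult_assoc1)

text \<open>Restriction of scalars along the structure map.\<close>

definition res :: "('a, 'b) rmodule \<Rightarrow> ('r, 'b) rmodule" where
  "res M = \<lparr>carrier = carrier M, monoid.mult = undefined, monoid.one = undefined,
     ring.zero = \<zero>\<^bsub>M\<^esub>, ring.add = (\<oplus>\<^bsub>M\<^esub>), ract = (\<lambda>x r. x \<triangleleft>\<^bsub>M\<^esub> sc r)\<rparr>"

lemma res_simps [simp]: "carrier (res M) = carrier M" "\<zero>\<^bsub>res M\<^esub> = \<zero>\<^bsub>M\<^esub>"
  "x \<oplus>\<^bsub>res M\<^esub> y = x \<oplus>\<^bsub>M\<^esub> y" "x \<triangleleft>\<^bsub>res M\<^esub> r = x \<triangleleft>\<^bsub>M\<^esub> sc r"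
  by (simp_all add: res_def)

lemma res_right_module:
  assumes "right_module \<Lambda> M"
  shows "right_module R (res M)"
proof -
  interpret M: right_module \<Lambda> M by fact
  have "abelian_group (res M)"
  proof (rule abelian_groupI)
    fix x assume "x \<in> carrier (res M)"
    then show "\<exists>y\<in>carrier (res M). y \<oplus>\<^bsub>res M\<^esub> x = \<zero>\<^bsub>res M\<^esub>"
      by (intro bexI[of _ "\<ominus>\<^bsub>M\<^esub> x"]) (simp_all add: M.M.l_neg)
  qed (auto simp: M.M.a_ac)
  then show ?thesis
    by (intro right_module.intro right_module_axioms.intro R.ring_axioms)
      (auto simp: sc_hom M.ract_add M.add_ract M.ract_mult)
qed

lemma dcc_base: "dcc R (regular R) (carrier R)"
  unfolding dcc_def
proof (intro allI impI)
  fix D assume D: "\<forall>n. rsubmodule R (regular R) (D n) \<and> D (Suc n) \<subseteq> D n"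
  have id: "ideal (D n) R" for n
  proof (rule idealI[OF R.ring_axioms])
    have "rsubmodule R (regular R) (D n)" using D by blast
    note DD = rsubmoduleD[OF this, unfolded regular_simps]
    have neg: "\<ominus>\<^bsub>R\<^esub> a \<in> D n" if "a \<in> D n" for a
      using DD(4)[OF that R.a_inv_closed[OF R.one_closed]] DD(1) that by (auto simp: R.r_minus)
    show "subgroup (D n) (add_monoid R)"
      by (rule group.subgroupI[OF R.a_group]) (use DD neg in \<open>auto simp: a_inv_def[symmetric]\<close>)
    fix a x assume ax: "a \<in> D n" "x \<in> carrier R"
    show "a \<otimes>\<^bsub>R\<^esub> x \<in> D n" by (rule DD(4)[OF ax])
    then show "x \<otimes>\<^bsub>R\<^esub> a \<in> D n" using R.m_comm[of x a] ax DD(1) by auto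
  qed
  have "artinian_ring R" using artin by (simp add: artin_algebra_def)
  then have "(\<forall>n. ideal (D n) R \<and> D (Suc n) \<subseteq> D n) \<longrightarrow> (\<exists>n. \<forall>m\<ge>n. D m = D n)"
    unfolding artinian_ring_def by (elim conjE allE[of _ D])
  then have "\<exists>n. \<forall>m\<ge>n. D m = D n" using D id by blast
  then obtain n where n: "\<forall>m\<ge>n. D m = D n" ..
  show "\<exists>n. \<forall>m\<ge>n. D n \<inter> carrier R \<subseteq> D m"
  proof (intro exI[of _ n] allI impI)
    fix m assume "m \<ge> n"
    then have "D m = D n" using n by (elim allE impE)
    then show "D n \<inter> carrier R \<subseteq> D m" by (simp only: Int_lower1)
  qed
qed

lemma dcc_algebra: "dcc R (res (regular \<Lambda>)) (carrier \<Lambda>)"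
proof -
  let ?L = "res (regular \<Lambda>)"
  note L = res_right_module[OF regular_right_module[OF L.ring_axioms]]
  obtain S where S: "finite S" "S \<subseteq> carrier \<Lambda>"
    and gen: "\<forall>N. submodule N R \<Lambda> \<and> S \<subseteq> N \<longrightarrow> N = carrier \<Lambda>"
    using artin unfolding artin_algebra_def by (elim conjE exE)
  have sub: "submodule N R \<Lambda>" if N: "rsubmodule R ?L N" for N
  proof -
    note ND = rsubmoduleD[OF N, unfolded res_simps regular_simps]
    show ?thesis
    proof (rule RL.submoduleI[OF ND(1,2) _ ND(3)])
      show "r \<odot>\<^bsub>\<Lambda>\<^esub> x \<in> N" if "r \<in> carrier R" "x \<in> N" for r x
        using ND(4)[OF that(2,1)] ND(1) that by (auto simp: sc_mult(2))
      show "\<ominus>\<^bsub>\<Lambda>\<^esub> x \<in> N" if "x \<in> N" for x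
        using ND(4)[OF that R.a_inv_closed[OF R.one_closed]] ND(1) that by (auto simp: sc_hom(3) L.r_minus)
    qed
  qed
  have "fg_rmodule R ?L"
    unfolding fg_rmodule_def
    using L S gen sub by (intro conjI exI[of _ S]) (auto simp: regular_simps)
  then have "dcc R ?L (carrier ?L)"
  proof (rule dcc_generated[OF _ L regular_right_module[OF R.ring_axioms]])
    fix u assume u: "u \<in> carrier ?L"
    show "(\<lambda>a. u \<triangleleft>\<^bsub>?L\<^esub> a) \<in> rhom R (regular R) ?L"
      by (rule rhomI) (use u in \<open>auto simp: regular_simps sc_hom L.r_distr L.m_assoc\<close>)
  qed (auto simp: regular_simps dcc_base)
  then show ?thesis by (simp add: regular_simps)
qed

lemma dcc_res:
  assumes fg: "fg_rmodule \<Lambda> M"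
  shows "dcc R (res M) (carrier M)"
proof (rule dcc_generated[OF fg res_right_module[OF fg_rmodule_right[OF fg]]
      res_right_module[OF regular_right_module[OF L.ring_axioms]]])
  interpret M: right_module \<Lambda> M by (rule fg_rmodule_right[OF fg])
  show "(\<lambda>a. u \<triangleleft>\<^bsub>M\<^esub> a) \<in> rhom R (res (regular \<Lambda>)) (res M)" if "u \<in> carrier M" for u
    by (rule rhomI) (use that in \<open>auto simp: regular_simps M.ract_add M.ract_mult\<close>)
  show "rsubmodule R (res M) W" if W: "rsubmodule \<Lambda> M W" for W
    by (rule rsubmoduleI[OF res_right_module[OF fg_rmodule_right[OF fg]]])
      (use rsubmoduleD[OF W] in auto)
  show "dcc R (res (regular \<Lambda>)) (carrier (res (regular \<Lambda>)))" using dcc_algebra by (simp add: regular_simps)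
qed (simp_all add: regular_simps)

text \<open>A homomorphism is determined by its values on finitely many generators, so that \<open>Hom(M, N)\<close>
  embeds in a finite power of \<open>N\<close>. The chain is made to agree on one generator after the other; for a new
  generator \<open>s\<close> the values at \<open>s\<close> of those members that vanish on the earlier ones form a chain in \<open>N\<close>.
  Homomorphisms are functions that are relevant only on the carrier, hence the conclusion in terms of values.\<close>

lemma dcc_rhom:
  fixes D :: "nat \<Rightarrow> ('b \<Rightarrow> 'c) set"
  assumes M: "fg_rmodule \<Lambda> M" and N: "fg_rmodule \<Lambda> N"
    and D: "\<And>n. D n \<subseteq> rhom \<Lambda> M N" "\<And>n. D n \<noteq> {}"
    and add: "\<And>n f g. f \<in> D n \<Longrightarrow> g \<in> D n \<Longrightarrow> (\<lambda>x. f x \<oplus>\<^bsub>N\<^esub> g x) \<in> D n"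
    and act: "\<And>n f r. f \<in> D n \<Longrightarrow> r \<in> carrier R \<Longrightarrow> (\<lambda>x. f x \<triangleleft>\<^bsub>N\<^esub> sc r) \<in> D n"
    and dec: "\<And>n. D (Suc n) \<subseteq> D n"
  shows "\<exists>n. \<forall>m\<ge>n. \<forall>f\<in>D n. \<exists>g\<in>D m. \<forall>x\<in>carrier M. f x = g x"
proof -
  note rM = fg_rmodule_right[OF M] and rN = fg_rmodule_right[OF N]
  interpret M: right_module \<Lambda> M by (rule rM)
  interpret N: right_module \<Lambda> N by (rule rN)
  have dec': "m \<ge> n \<Longrightarrow> D m \<subseteq> D n" for m n using dec by (rule lift_Suc_antimono_le[where f = D])
  have cl: "f x \<in> carrier N" if "f \<in> D n" "x \<in> carrier M" for f n x
    using rhom_closed[OF subsetD[OF D(1) that(1)] that(2)] .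
  have minus: "\<exists>h\<in>D n. \<forall>x\<in>carrier M. h x = f x \<ominus>\<^bsub>N\<^esub> g x"
    if "f \<in> D n" "g \<in> D n" for f g n
  proof -
    have "(\<lambda>x. f x \<oplus>\<^bsub>N\<^esub> g x \<triangleleft>\<^bsub>N\<^esub> sc (\<ominus>\<^bsub>R\<^esub> \<one>\<^bsub>R\<^esub>)) \<in> D n"
      using add[OF that(1) act[OF that(2)], of "\<ominus>\<^bsub>R\<^esub> \<one>\<^bsub>R\<^esub>"] by simp
    moreover have "\<forall>x\<in>carrier M. f x \<oplus>\<^bsub>N\<^esub> g x \<triangleleft>\<^bsub>N\<^esub> sc (\<ominus>\<^bsub>R\<^esub> \<one>\<^bsub>R\<^esub>) = f x \<ominus>\<^bsub>N\<^esub> g x"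
      using cl[OF that(2)] by (simp add: sc_hom(3) N.ract_neg a_minus_def)
    ultimately show ?thesis by (intro bexI[of _ "\<lambda>x. f x \<oplus>\<^bsub>N\<^esub> g x \<triangleleft>\<^bsub>N\<^esub> sc (\<ominus>\<^bsub>R\<^esub> \<one>\<^bsub>R\<^esub>)"])
  qed
  have step: "\<exists>n. \<forall>m\<ge>n. \<forall>f\<in>D n. \<exists>g\<in>D m. \<forall>x\<in>J. f x = g x"
    if "finite J" "J \<subseteq> carrier M" for J
    using that
  proof (induction J)
    case empty
    then show ?case using D(2) by auto
  next
    case (insert s J)
    then obtain n1 where n1: "\<forall>m\<ge>n1. \<forall>f\<in>D n1. \<exists>g\<in>D m. \<forall>x\<in>J. f x = g x" by auto
    have s: "s \<in> carrier M" and J: "J \<subseteq> carrier M" using insert.prems by auto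
    define V where "V n = {f s | f. f \<in> D n \<and> (\<forall>x\<in>J. f x = \<zero>\<^bsub>N\<^esub>)}" for n
    have "rsubmodule R (res N) (V n)" for n
    proof (rule rsubmoduleI[OF res_right_module[OF rN]])
      show "V n \<subseteq> carrier (res N)" using cl s by (auto simp: V_def)
      obtain f where f: "f \<in> D n" using D(2) by blast
      show "\<zero>\<^bsub>res N\<^esub> \<in> V n"
        unfolding V_def using act[OF f R.zero_closed] cl[OF f] s J
        by (intro CollectI exI[of _ "\<lambda>x. f x \<triangleleft>\<^bsub>N\<^esub> sc \<zero>\<^bsub>R\<^esub>"]) (auto simp: sc_hom(1) subset_iff)
      fix x assume "x \<in> V n"
      then obtain f where f: "f \<in> D n" "\<forall>x\<in>J. f x = \<zero>\<^bsub>N\<^esub>" "x = f s" by (auto simp: V_def)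
      show "x \<triangleleft>\<^bsub>res N\<^esub> r \<in> V n" if r: "r \<in> carrier R" for r
        unfolding V_def using act[OF f(1) r] f(2,3) sc_closed[OF r]
        by (intro CollectI exI[of _ "\<lambda>x. f x \<triangleleft>\<^bsub>N\<^esub> sc r"]) simp
      fix y assume "y \<in> V n"
      then obtain g where g: "g \<in> D n" "\<forall>x\<in>J. g x = \<zero>\<^bsub>N\<^esub>" "y = g s" by (auto simp: V_def)
      show "x \<oplus>\<^bsub>res N\<^esub> y \<in> V n"
        unfolding V_def using add[OF f(1) g(1)] f(2,3) g(2,3)
        by (intro CollectI exI[of _ "\<lambda>x. f x \<oplus>\<^bsub>N\<^esub> g x"]) simp
    qed
    moreover have "V (Suc n) \<subseteq> V n" for n using dec[of n] unfolding V_def by blast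
    ultimately obtain n2 where n2: "\<forall>m\<ge>n2. V n2 \<inter> carrier N \<subseteq> V m"
      using dccD[OF dcc_res[OF N], of V] by blast
    show ?case
    proof (intro exI[of _ "max n1 n2"] allI impI ballI)
      fix m f assume m: "max n1 n2 \<le> m" and "f \<in> D (max n1 n2)"
      then have f: "f \<in> D n1" "f \<in> D n2"
        using dec'[of n1 "max n1 n2"] dec'[of n2 "max n1 n2"] by auto
      \<comment> \<open>\<open>g\<close> agrees with \<open>f\<close> on \<open>J\<close>, and \<open>k\<close> corrects the remaining difference at \<open>s\<close>.\<close>
      have "n1 \<le> m" using m by simp
      from n1[rule_format, OF this f(1)]
      obtain g where g: "g \<in> D m" "\<forall>x\<in>J. f x = g x" ..
      have gn: "g \<in> D n2" using g(1) dec'[of n2 m] m by auto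
      obtain h where h: "h \<in> D n2" "\<forall>x\<in>carrier M. h x = f x \<ominus>\<^bsub>N\<^esub> g x"
        using minus[OF f(2) gn] by (elim bexE)
      have "\<forall>x\<in>J. h x = \<zero>\<^bsub>N\<^esub>"
        using h(2) g(2) J cl[OF g(1)] by (auto simp: subset_iff a_minus_def N.M.r_neg)
      then have "h s \<in> V n2 \<inter> carrier N" using h(1) cl[OF h(1) s] by (auto simp: V_def)
      then have "h s \<in> V m" using n2 m by auto
      then obtain k where k: "k \<in> D m" "\<forall>x\<in>J. k x = \<zero>\<^bsub>N\<^esub>" "h s = k s"
        unfolding V_def by blast
      have "f x = k x \<oplus>\<^bsub>N\<^esub> g x" if x: "x \<in> insert s J" for x
      proof (cases "x = s")
        case True
        have "k s = f s \<ominus>\<^bsub>N\<^esub> g s" using k(3) h(2) s by simp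
        then show ?thesis using True cl[OF f(1) s] cl[OF g(1) s] by simp
      next
        case False
        then have "x \<in> J" "x \<in> carrier M" using x J by auto
        then show ?thesis using k(2) g(2) cl[OF g(1), of x] by simp
      qed
      then show "\<exists>g\<in>D m. \<forall>x\<in>insert s J. f x = g x" using add[OF k(1) g(1)]
        by (intro bexI[of _ "\<lambda>x. k x \<oplus>\<^bsub>N\<^esub> g x"]) simp_all
    qed
  qed
  obtain S where S: "finite S" "S \<subseteq> carrier M" "\<And>K. rsubmodule \<Lambda> M K \<Longrightarrow> S \<subseteq> K \<Longrightarrow> K = carrier M"
    by (rule fg_rmodule_gens[OF M]) blast
  obtain n where n: "\<forall>m\<ge>n. \<forall>f\<in>D n. \<exists>g\<in>D m. \<forall>x\<in>S. f x = g x" using step[OF S(1,2)] ..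
  show ?thesis
  proof (intro exI[of _ n] allI impI ballI)
    fix m f assume m: "n \<le> m" and f: "f \<in> D n"
    obtain g where g: "g \<in> D m" "\<forall>x\<in>S. f x = g x" using n[rule_format, OF m f] by (elim bexE) simp
    have "f x = g x" if "x \<in> carrier M" for x
      by (rule rhom_eq_on_gens[where f = f and g = g and S = S, OF rM rN])
        (use D(1) f g S(2,3) that in auto)
    then show "\<exists>g\<in>D m. \<forall>x\<in>carrier M. f x = g x" using g(1) by (intro bexI[of _ g] ballI)
  qed
qed

end

section \<open>The morphism category\<close>

lemma HhomD:
  assumes "(\<alpha>, \<beta>) \<in> Hhom \<Lambda> (A, f, B) (A', f', B')"
  shows "\<alpha> \<in> rhom \<Lambda> A A'" "\<beta> \<in> rhom \<Lambda> B B'" "\<And>x. x \<in> carrier A \<Longrightarrow> \<beta> (f x) = f' (\<alpha> x)"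
  using assms by simp_all

lemma HhomI:
  assumes "\<alpha> \<in> rhom \<Lambda> A A'" "\<beta> \<in> rhom \<Lambda> B B'" "\<And>x. x \<in> carrier A \<Longrightarrow> \<beta> (f x) = f' (\<alpha> x)"
  shows "(\<alpha>, \<beta>) \<in> Hhom \<Lambda> (A, f, B) (A', f', B')"
  using assms by simp

lemma HisoI:
  assumes "(\<alpha>, \<beta>) \<in> Hhom \<Lambda> (A, f, B) (A', f', B')" "(\<alpha>', \<beta>') \<in> Hhom \<Lambda> (A', f', B') (A, f, B)"
    and "\<And>x. x \<in> carrier A \<Longrightarrow> \<alpha>' (\<alpha> x) = x" "\<And>x. x \<in> carrier B \<Longrightarrow> \<beta>' (\<beta> x) = x"
    and "\<And>x. x \<in> carrier A' \<Longrightarrow> \<alpha> (\<alpha>' x) = x" "\<And>x. x \<in> carrier B' \<Longrightarrow> \<beta> (\<beta>' x) = x"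
  shows "Hiso \<Lambda> (A, f, B) (A', f', B')"
  unfolding Hiso_def
  by (rule bexI[OF bexI[OF _ assms(2)] assms(1)]) (simp add: assms(3-6))

lemma HisoE:
  assumes "Hiso \<Lambda> (A, f, B) (A', f', B')"
  obtains \<alpha> \<beta> \<alpha>' \<beta>' where "(\<alpha>, \<beta>) \<in> Hhom \<Lambda> (A, f, B) (A', f', B')"
    "(\<alpha>', \<beta>') \<in> Hhom \<Lambda> (A', f', B') (A, f, B)"
    "\<forall>x\<in>carrier A. \<alpha>' (\<alpha> x) = x" "\<forall>x\<in>carrier B. \<beta>' (\<beta> x) = x"
    "\<forall>x\<in>carrier A'. \<alpha> (\<alpha>' x) = x" "\<forall>x\<in>carrier B'. \<beta> (\<beta>' x) = x"
proof -
  obtain \<phi> \<psi> where *: "\<phi> \<in> Hhom \<Lambda> (A, f, B) (A', f', B')" "\<psi> \<in> Hhom \<Lambda> (A', f', B') (A, f, B)"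
    "Heq (A, f, B) (Hcomp \<psi> \<phi>) (id, id)" "Heq (A', f', B') (Hcomp \<phi> \<psi>) (id, id)"
    using assms unfolding Hiso_def by (elim bexE conjE)
  obtain \<alpha> \<beta> where \<phi>: "\<phi> = (\<alpha>, \<beta>)" by (rule prod.exhaust)
  obtain \<alpha>' \<beta>' where \<psi>: "\<psi> = (\<alpha>', \<beta>')" by (rule prod.exhaust)
  show ?thesis
    using that[of \<alpha> \<beta> \<alpha>' \<beta>'] * unfolding \<phi> \<psi> by simp
qed

lemma Hiso_sym: "Hiso \<Lambda> U Y \<Longrightarrow> Hiso \<Lambda> Y U"
  unfolding Hiso_def by (elim bexE conjE) (intro bexI conjI)

lemma Hhom_comp:
  assumes "(\<alpha>, \<beta>) \<in> Hhom \<Lambda> (A, f, B) (A', f', B')" "(\<alpha>', \<beta>') \<in> Hhom \<Lambda> (A', f', B') (A'', f'', B'')"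
  shows "(\<lambda>x. \<alpha>' (\<alpha> x), \<lambda>x. \<beta>' (\<beta> x)) \<in> Hhom \<Lambda> (A, f, B) (A'', f'', B'')"
  using rhom_comp[OF HhomD(1)[OF assms(2)] HhomD(1)[OF assms(1)]]
    rhom_comp[OF HhomD(2)[OF assms(2)] HhomD(2)[OF assms(1)]]
    HhomD(3)[OF assms(1)] HhomD(3)[OF assms(2)] rhom_closed[OF HhomD(1)[OF assms(1)]]
  by (intro HhomI) simp_all

lemma Hiso_trans:
  assumes "Hiso \<Lambda> (A, f, B) (A', f', B')" "Hiso \<Lambda> (A', f', B') (A'', f'', B'')"
  shows "Hiso \<Lambda> (A, f, B) (A'', f'', B'')"
proof -
  obtain a b a' b' where 1: "(a, b) \<in> Hhom \<Lambda> (A, f, B) (A', f', B')"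
    "(a', b') \<in> Hhom \<Lambda> (A', f', B') (A, f, B)"
    "\<forall>x\<in>carrier A. a' (a x) = x" "\<forall>x\<in>carrier B. b' (b x) = x"
    "\<forall>x\<in>carrier A'. a (a' x) = x" "\<forall>x\<in>carrier B'. b (b' x) = x" by (rule HisoE[OF assms(1)])
  obtain c d c' d' where 2: "(c, d) \<in> Hhom \<Lambda> (A', f', B') (A'', f'', B'')"
    "(c', d') \<in> Hhom \<Lambda> (A'', f'', B'') (A', f', B')"
    "\<forall>x\<in>carrier A'. c' (c x) = x" "\<forall>x\<in>carrier B'. d' (d x) = x"
    "\<forall>x\<in>carrier A''. c (c' x) = x" "\<forall>x\<in>carrier B''. d (d' x) = x" by (rule HisoE[OF assms(2)])
  show ?thesis
    by (rule HisoI[OF Hhom_comp[OF 1(1) 2(1)] Hhom_comp[OF 2(2) 1(2)]])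
      (simp_all add: 1(3-6) 2(3-6) rhom_closed[OF HhomD(1)[OF 1(1)]] rhom_closed[OF HhomD(2)[OF 1(1)]]
        rhom_closed[OF HhomD(1)[OF 2(2)]] rhom_closed[OF HhomD(2)[OF 2(2)]])
qed

lemma Hiso_bij:
  assumes A: "right_module \<Lambda> A" and B: "right_module \<Lambda> B"
    and h: "(\<alpha>, \<beta>) \<in> Hhom \<Lambda> (A, f, B) (A', f', B')" and f: "f \<in> rhom \<Lambda> A B"
    and bij: "bij_betw \<alpha> (carrier A) (carrier A')" "bij_betw \<beta> (carrier B) (carrier B')"
  shows "Hiso \<Lambda> (A, f, B) (A', f', B')"
proof (rule HisoI[OF h])
  let ?a = "inv_into (carrier A) \<alpha>" and ?b = "inv_into (carrier B) \<beta>"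
  note ia = rhom_inv_into[OF A HhomD(1)[OF h] bij(1)] and ib = rhom_inv_into[OF B HhomD(2)[OF h] bij(2)]
  show "(?a, ?b) \<in> Hhom \<Lambda> (A', f', B') (A, f, B)"
  proof (rule HhomI[OF ia ib])
    fix x assume x: "x \<in> carrier A'"
    then have "f (?a x) \<in> carrier B" using rhom_closed[OF f] rhom_closed[OF ia] by simp
    moreover have "\<beta> (f (?a x)) = f' x"
      using HhomD(3)[OF h rhom_closed[OF ia x]] bij_betw_inv_into_right[OF bij(1) x] by simp
    ultimately show "?b (f' x) = f (?a x)"
      using bij_betw_inv_into_left[OF bij(2)] by metis
  qed
qed (use bij_betw_inv_into_left[OF bij(1)] bij_betw_inv_into_left[OF bij(2)]
    bij_betw_inv_into_right[OF bij(1)] bij_betw_inv_into_right[OF bij(2)] in auto)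

text \<open>The next two lemmas translate membership in \<open>\<S>\<^sub>\<X>\<close> into the existence of an epimorphism with kernel
  \<open>Im f\<close> onto a module of the subcategory, and thereby keep cosets out of the later arguments.\<close>

lemma SmonoD:
  assumes "(A, f, B) \<in> Smono \<Lambda> \<C>"
  shows "A \<in> \<C>" "B \<in> \<C>" "A \<in> fgmod \<Lambda>" "B \<in> fgmod \<Lambda>" "f \<in> rhom \<Lambda> A B" "inj_on f (carrier A)"
    "right_module \<Lambda> A" "right_module \<Lambda> B" "fg_rmodule \<Lambda> B"
  using assms by (simp_all add: Smono_def Hobj_def fgmodD)

lemma Smono_cok:
  assumes C: "resolving \<Lambda> \<C>" and S: "(A, f, B) \<in> Smono \<Lambda> \<C>"
  obtains D r where "D \<in> \<C>" "r \<in> rhom \<Lambda> B D" "r ` carrier B = carrier D"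
    "\<forall>x\<in>carrier B. r x = \<zero>\<^bsub>D\<^esub> \<longleftrightarrow> x \<in> f ` carrier A"
proof -
  note SD = SmonoD[OF S]
  note A = SD(7) and B = SD(9)
  have "in_sub \<Lambda> \<C> (cok f A B)" using S by (simp add: Smono_def)
  then obtain D where D: "D \<in> \<C>" "riso \<Lambda> (cok f A B) D" unfolding in_sub_def by (elim bexE)
  obtain s where s: "s \<in> rhom \<Lambda> (cok f A B) D" "bij_betw s (carrier (cok f A B)) (carrier D)"
    using D(2) unfolding riso_def by (elim bexE)
  obtain q where q: "q = (\<lambda>x. f ` carrier A +>\<^bsub>B\<^esub> x)" "q \<in> rhom \<Lambda> B (cok f A B)"
    "q ` carrier B = carrier (cok f A B)"
    "\<forall>x\<in>carrier B. q x = \<zero>\<^bsub>cok f A B\<^esub> \<longleftrightarrow> x \<in> f ` carrier A"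
    by (rule cok_proj[OF A B SD(5)])
  note Q = fg_rmodule_right[OF cok_fg(1)[OF A B SD(5)]]
  note rD = resolving_right_module[OF C D(1)]
  interpret Q: right_module \<Lambda> "cok f A B" by (rule Q)
  show ?thesis
  proof (rule that[of D "\<lambda>x. s (q x)"])
    show "(\<lambda>x. s (q x)) \<in> rhom \<Lambda> B D" by (rule rhom_comp[OF s(1) q(2)])
    show "(\<lambda>x. s (q x)) ` carrier B = carrier D"
      using s(2) q(3) by (simp add: bij_betw_def image_image[symmetric])
    show "\<forall>x\<in>carrier B. s (q x) = \<zero>\<^bsub>D\<^esub> \<longleftrightarrow> x \<in> f ` carrier A"
    proof
      fix x assume x: "x \<in> carrier B"
      have "s (q x) = \<zero>\<^bsub>D\<^esub> \<longleftrightarrow> s (q x) = s \<zero>\<^bsub>cok f A B\<^esub>" using rhom_zero[OF Q rD s(1)] by simp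
      also have "\<dots> \<longleftrightarrow> q x = \<zero>\<^bsub>cok f A B\<^esub>"
        by (rule inj_on_eq_iff[OF bij_betw_imp_inj_on[OF s(2)] rhom_closed[OF q(2) x] Q.M.zero_closed])
      finally show "s (q x) = \<zero>\<^bsub>D\<^esub> \<longleftrightarrow> x \<in> f ` carrier A" using q(4) x by simp
    qed
  qed (rule D(1))
qed

lemma SmonoI:
  assumes C: "resolving \<Lambda> \<C>" and AB: "A \<in> \<C>" "B \<in> \<C>" and f: "f \<in> rhom \<Lambda> A B" "inj_on f (carrier A)"
    and D: "right_module \<Lambda> D" "in_sub \<Lambda> \<C> D" and r: "r \<in> rhom \<Lambda> B D" "r ` carrier B = carrier D"
    and ker: "\<forall>x\<in>carrier B. r x = \<zero>\<^bsub>D\<^esub> \<longleftrightarrow> x \<in> f ` carrier A"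
  shows "(A, f, B) \<in> Smono \<Lambda> \<C>"
proof -
  note A = resolving_fgmod[OF C AB(1)] and B = resolving_fgmod[OF C AB(2)]
  have "riso \<Lambda> (cok f A B) D"
    by (rule cok_riso[OF fgmodD(2)[OF A] fgmodD(1)[OF B] f(1) D(1) r]) (use ker in auto)
  then have "in_sub \<Lambda> \<C> (cok f A B)" using D(2) by (rule in_sub_riso)
  then show ?thesis using A B AB f by (simp add: Smono_def Hobj_def)
qed

lemma idempotent_first:
  assumes g: "(\<alpha>, g) \<in> Hhom \<Lambda> (A, f, B) (A, f, B)" and f: "f \<in> rhom \<Lambda> A B" "inj_on f (carrier A)"
    and idem: "\<And>x. x \<in> carrier B \<Longrightarrow> g (g x) = g x" and x: "x \<in> carrier A"
  shows "\<alpha> (\<alpha> x) = \<alpha> x"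
proof -
  note gD = HhomD[OF g]
  note ax = rhom_closed[OF gD(1) x]
  have "f (\<alpha> (\<alpha> x)) = f (\<alpha> x)" using gD(3)[OF ax] gD(3)[OF x] idem[OF rhom_closed[OF f(1) x]] by simp
  then show ?thesis by (rule inj_onD[OF f(2) _ rhom_closed[OF gD(1) ax] ax])
qed

text \<open>An idempotent endomorphism of an object induces idempotents on its two terms and on its cokernel.
  The fixed parts of the three again form a short exact sequence, and they belong to the subcategory because
  that is closed under summands.\<close>

lemma fix_mod_Smono:
  assumes C: "resolving \<Lambda> \<C>" and S: "(A, f, B) \<in> Smono \<Lambda> \<C>"
    and g: "(\<alpha>, g) \<in> Hhom \<Lambda> (A, f, B) (A, f, B)" and idem: "\<And>x. x \<in> carrier B \<Longrightarrow> g (g x) = g x"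
  shows "(fix_mod \<alpha> A, f, fix_mod g B) \<in> Smono \<Lambda> \<C>"
proof -
  note SD = SmonoD[OF S] and gD = HhomD[OF g]
  note A = SD(7) and B = SD(8)
  note idemA = idempotent_first[where \<alpha> = \<alpha> and g = g, OF g SD(5,6) idem]
  obtain D r where D: "D \<in> \<C>" "r \<in> rhom \<Lambda> B D" "r ` carrier B = carrier D"
    "\<forall>x\<in>carrier B. r x = \<zero>\<^bsub>D\<^esub> \<longleftrightarrow> x \<in> f ` carrier A" by (rule Smono_cok[OF C S])
  note rD = resolving_right_module[OF C D(1)]
  have "\<exists>s\<in>rhom \<Lambda> D D. \<forall>x\<in>carrier B. s (r x) = r (g x)"
  proof (rule rhom_factor[OF B rD rD D(2,3) rhom_comp[OF D(2) gD(2)]])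
    fix x assume x: "x \<in> carrier B" "r x = \<zero>\<^bsub>D\<^esub>"
    then obtain z where z: "z \<in> carrier A" "x = f z" using D(4) by auto
    then have "g x \<in> f ` carrier A" using gD(3)[OF z(1)] rhom_closed[OF gD(1) z(1)] by simp
    then show "r (g x) = \<zero>\<^bsub>D\<^esub>" using D(4) rhom_closed[OF gD(2) x(1)] by simp
  qed
  then obtain s where s: "s \<in> rhom \<Lambda> D D" "\<forall>x\<in>carrier B. s (r x) = r (g x)" ..
  have idemD: "s (s y) = s y" if "y \<in> carrier D" for y
  proof -
    obtain x where x: "x \<in> carrier B" "y = r x" using \<open>y \<in> carrier D\<close> D(3) by auto
    show ?thesis using x s(2) rhom_closed[OF gD(2) x(1)] idem[OF x(1)] by simp
  qed
  show ?thesis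
  proof (rule SmonoI[OF C])
    show "fix_mod \<alpha> A \<in> \<C>" by (rule fix_mod_resolving[where g = \<alpha>, OF C SD(1) gD(1) idemA])
    show "fix_mod g B \<in> \<C>" by (rule fix_mod_resolving[where g = g, OF C SD(2) gD(2) idem])
    have "fix_mod s D \<in> \<C>" by (rule fix_mod_resolving[where g = s, OF C D(1) s(1) idemD])
    then show "in_sub \<Lambda> \<C> (fix_mod s D)" by (rule in_subI)
    show "right_module \<Lambda> (fix_mod s D)" by (rule fix_mod_right_module[OF rD s(1)])
    show "f \<in> rhom \<Lambda> (fix_mod \<alpha> A) (fix_mod g B)"
    proof (rule rhomI)
      fix x assume x: "x \<in> carrier (fix_mod \<alpha> A)"
      then show "f x \<in> carrier (fix_mod g B)" using gD(3) rhom_closed[OF SD(5)] by simp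
    qed (simp_all add: rhom_add[OF SD(5)] rhom_act[OF SD(5)])
    show "inj_on f (carrier (fix_mod \<alpha> A))" using SD(6) by (rule inj_on_subset) auto
    show rr: "r \<in> rhom \<Lambda> (fix_mod g B) (fix_mod s D)"
    proof (rule rhomI)
      fix x assume x: "x \<in> carrier (fix_mod g B)"
      then show "r x \<in> carrier (fix_mod s D)" using s(2) rhom_closed[OF D(2)] by simp
    qed (simp_all add: rhom_add[OF D(2)] rhom_act[OF D(2)])
    show "r ` carrier (fix_mod g B) = carrier (fix_mod s D)"
    proof (intro equalityI subsetI)
      fix y assume y: "y \<in> carrier (fix_mod s D)"
      then have "y \<in> carrier D" by simp
      then obtain x where x: "x \<in> carrier B" "y = r x" using D(3) by auto
      have "g x \<in> carrier (fix_mod g B)" using rhom_closed[OF gD(2) x(1)] idem[OF x(1)] by simp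
      moreover have "y = r (g x)" using y x s(2) by simp
      ultimately show "y \<in> r ` carrier (fix_mod g B)" by (rule image_eqI[rotated])
    qed (use rhom_closed[OF rr] in auto)
    show "\<forall>x\<in>carrier (fix_mod g B). r x = \<zero>\<^bsub>fix_mod s D\<^esub> \<longleftrightarrow> x \<in> f ` carrier (fix_mod \<alpha> A)"
    proof
      fix x assume "x \<in> carrier (fix_mod g B)"
      then have x: "x \<in> carrier B" "g x = x" by simp_all
      have "x \<in> f ` carrier (fix_mod \<alpha> A)" if xA: "x \<in> f ` carrier A"
      proof -
        obtain z where z: "z \<in> carrier A" "x = f z" using xA by auto
        then have "f (\<alpha> z) = f z" using gD(3)[OF z(1)] x(2) by simp
        then have "\<alpha> z = z" using SD(6) z(1) rhom_closed[OF gD(1) z(1)] by (simp add: inj_on_eq_iff)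
        then show ?thesis using z by simp
      qed
      moreover have "x \<in> f ` carrier A" if "x \<in> f ` carrier (fix_mod \<alpha> A)" using that by auto
      ultimately show "r x = \<zero>\<^bsub>fix_mod s D\<^esub> \<longleftrightarrow> x \<in> f ` carrier (fix_mod \<alpha> A)"
        using D(4) x(1) by auto
    qed
  qed
qed


section \<open>Fitting's lemma\<close>

text \<open>Up to isomorphism an object of \<open>\<S>\<^sub>\<X>\<close> is a module with a submodule \<open>I\<close>, and its endomorphisms
  are those of the module that preserve \<open>I\<close>.\<close>

definition stab_end :: "('a, 's) ring_scheme \<Rightarrow> ('a, 'b) rmodule \<Rightarrow> 'b set \<Rightarrow> ('b \<Rightarrow> 'b) set" where
  "stab_end \<Lambda> M I = {e \<in> rhom \<Lambda> M M. e ` I \<subseteq> I}"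

lemma stab_endD: "e \<in> stab_end \<Lambda> M I \<Longrightarrow> e \<in> rhom \<Lambda> M M" "e \<in> stab_end \<Lambda> M I \<Longrightarrow> x \<in> I \<Longrightarrow> e x \<in> I"
  by (auto simp: stab_end_def)

lemma stab_endI: "e \<in> rhom \<Lambda> M M \<Longrightarrow> (\<And>x. x \<in> I \<Longrightarrow> e x \<in> I) \<Longrightarrow> e \<in> stab_end \<Lambda> M I"
  by (auto simp: stab_end_def)

lemma stab_end_comp: "e \<in> stab_end \<Lambda> M I \<Longrightarrow> e' \<in> stab_end \<Lambda> M I \<Longrightarrow> (\<lambda>x. e (e' x)) \<in> stab_end \<Lambda> M I"
  by (rule stab_endI[OF rhom_comp[OF stab_endD(1) stab_endD(1)]]) (simp_all add: stab_endD)

lemma stab_end_id: "(\<lambda>x. x) \<in> stab_end \<Lambda> M I"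
  by (rule stab_endI[OF rhom_id(2)])

lemma stab_end_funpow: "e \<in> stab_end \<Lambda> M I \<Longrightarrow> e ^^ n \<in> stab_end \<Lambda> M I"
proof (induction n)
  case 0 then show ?case using stab_end_id by (simp add: id_def)
next
  case (Suc n) then show ?case using stab_end_comp[of e \<Lambda> M I "e ^^ n"] by (simp add: comp_def)
qed

lemma stab_end_add:
  assumes "right_module \<Lambda> M" "rsubmodule \<Lambda> M I" "e \<in> stab_end \<Lambda> M I" "e' \<in> stab_end \<Lambda> M I"
  shows "(\<lambda>x. e x \<oplus>\<^bsub>M\<^esub> e' x) \<in> stab_end \<Lambda> M I"
  by (rule stab_endI[OF right_module.rhom_add_map[OF assms(1) stab_endD(1)[OF assms(3)] stab_endD(1)[OF assms(4)]]])
    (intro rsubmoduleD(3)[OF assms(2)] stab_endD(2)[OF assms(3)] stab_endD(2)[OF assms(4)])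

lemma stab_end_Hhom:
  assumes A: "right_module \<Lambda> A" and B: "right_module \<Lambda> B" and f: "f \<in> rhom \<Lambda> A B" "inj_on f (carrier A)"
    and e: "e \<in> stab_end \<Lambda> B (f ` carrier A)"
  shows "\<exists>\<alpha>. (\<alpha>, e) \<in> Hhom \<Lambda> (A, f, B) (A, f, B)"
proof -
  have "\<exists>\<alpha>\<in>rhom \<Lambda> A A. \<forall>x\<in>carrier A. f (\<alpha> x) = e (f x)"
    by (rule mono_lift[OF A f rhom_comp[OF stab_endD(1)[OF e] f(1)]]) (simp add: stab_endD(2)[OF e])
  then obtain \<alpha> where \<alpha>: "\<alpha> \<in> rhom \<Lambda> A A" "\<forall>x\<in>carrier A. f (\<alpha> x) = e (f x)" ..
  have "(\<alpha>, e) \<in> Hhom \<Lambda> (A, f, B) (A, f, B)" by (rule HhomI[OF \<alpha>(1) stab_endD(1)[OF e]]) (simp add: \<alpha>(2))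
  then show ?thesis by (rule exI[of _ \<alpha>])
qed

context artin
begin

text \<open>For \<open>E = stab_end \<Lambda> M I\<close> the sets \<open>\<Phi> n E\<close> are a descending chain of \<open>R\<close>-submodules of \<open>Hom(M, M)\<close>.
  The map \<open>\<Phi> n\<close> stands for both \<open>x \<mapsto> e\<^sup>n x\<close> and \<open>x \<mapsto> x e\<^sup>n\<close>.\<close>

lemma stab_chain:
  fixes \<Phi> :: "nat \<Rightarrow> ('b \<Rightarrow> 'b) \<Rightarrow> 'b \<Rightarrow> 'b"
  assumes M: "fg_rmodule \<Lambda> M" and I: "rsubmodule \<Lambda> M I"
    and \<Phi>: "\<And>n x. x \<in> stab_end \<Lambda> M I \<Longrightarrow> \<Phi> n x \<in> stab_end \<Lambda> M I"
    and add: "\<And>n x y b. x \<in> stab_end \<Lambda> M I \<Longrightarrow> y \<in> stab_end \<Lambda> M I \<Longrightarrow> b \<in> carrier M \<Longrightarrow>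
      \<Phi> n (\<lambda>b. x b \<oplus>\<^bsub>M\<^esub> y b) b = \<Phi> n x b \<oplus>\<^bsub>M\<^esub> \<Phi> n y b"
    and act: "\<And>n x r b. x \<in> stab_end \<Lambda> M I \<Longrightarrow> r \<in> carrier R \<Longrightarrow> b \<in> carrier M \<Longrightarrow>
      \<Phi> n (\<lambda>b. x b \<triangleleft>\<^bsub>M\<^esub> sc r) b = \<Phi> n x b \<triangleleft>\<^bsub>M\<^esub> sc r"
    and dec: "\<And>n x. x \<in> stab_end \<Lambda> M I \<Longrightarrow> \<exists>x'\<in>stab_end \<Lambda> M I. \<forall>b\<in>carrier M. \<Phi> (Suc n) x b = \<Phi> n x' b"
  shows "\<exists>n. \<forall>m\<ge>n. \<forall>x\<in>stab_end \<Lambda> M I. \<exists>y\<in>stab_end \<Lambda> M I. \<forall>b\<in>carrier M. \<Phi> n x b = \<Phi> m y b"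
proof -
  let ?E = "stab_end \<Lambda> M I"
  note rM = fg_rmodule_right[OF M]
  interpret M: right_module \<Lambda> M by (rule rM)
  have sc_rhom: "(\<lambda>b. f b \<triangleleft>\<^bsub>M\<^esub> sc r) \<in> rhom \<Lambda> M M" if "f \<in> rhom \<Lambda> M M" "r \<in> carrier R" for f r
  proof (rule rhomI)
    fix b c assume bc: "b \<in> carrier M" "c \<in> carrier M"
    show "f (b \<oplus>\<^bsub>M\<^esub> c) \<triangleleft>\<^bsub>M\<^esub> sc r = f b \<triangleleft>\<^bsub>M\<^esub> sc r \<oplus>\<^bsub>M\<^esub> f c \<triangleleft>\<^bsub>M\<^esub> sc r"
      using bc that(2) rhom_closed[OF that(1)] by (simp add: rhom_add[OF that(1)] M.add_ract)
  next
    fix b a assume b: "b \<in> carrier M" "a \<in> carrier \<Lambda>"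
    have "f b \<triangleleft>\<^bsub>M\<^esub> (a \<otimes>\<^bsub>\<Lambda>\<^esub> sc r) = f b \<triangleleft>\<^bsub>M\<^esub> (sc r \<otimes>\<^bsub>\<Lambda>\<^esub> a)" using b that(2) by (simp add: sc_mult)
    then show "f (b \<triangleleft>\<^bsub>M\<^esub> a) \<triangleleft>\<^bsub>M\<^esub> sc r = f b \<triangleleft>\<^bsub>M\<^esub> sc r \<triangleleft>\<^bsub>M\<^esub> a"
      using b that(2) rhom_closed[OF that(1)] by (simp add: rhom_act[OF that(1)] M.ract_mult)
  qed (simp add: that(2) rhom_closed[OF that(1)])
  have Eact: "(\<lambda>b. f b \<triangleleft>\<^bsub>M\<^esub> sc r) \<in> ?E" if "f \<in> ?E" "r \<in> carrier R" for f r
    by (rule stab_endI[OF sc_rhom[OF stab_endD(1)[OF that(1)] that(2)]])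
      (intro rsubmoduleD(4)[OF I] stab_endD(2)[OF that(1)] sc_closed that(2))
  define S where "S n = {f \<in> rhom \<Lambda> M M. \<exists>x\<in>?E. \<forall>b\<in>carrier M. f b = \<Phi> n x b}" for n
  have SI: "f \<in> S n" if "f \<in> rhom \<Lambda> M M" "x \<in> ?E" "\<And>b. b \<in> carrier M \<Longrightarrow> f b = \<Phi> n x b" for f x n
    using that unfolding S_def by (intro CollectI conjI bexI[of _ x]) simp_all
  have SE: "\<Phi> n x \<in> S n" if "x \<in> ?E" for n x by (rule SI[OF stab_endD(1)[OF \<Phi>[OF that]] that refl])
  have "\<exists>n. \<forall>m\<ge>n. \<forall>f\<in>S n. \<exists>g\<in>S m. \<forall>b\<in>carrier M. f b = g b"
  proof (rule dcc_rhom[OF M M])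
    show "S n \<subseteq> rhom \<Lambda> M M" for n by (auto simp: S_def)
    show "S n \<noteq> {}" for n using SE[OF stab_end_id] by blast
    fix n f assume "f \<in> S n"
    then obtain x where f: "f \<in> rhom \<Lambda> M M" "x \<in> ?E" "\<forall>b\<in>carrier M. f b = \<Phi> n x b" unfolding S_def by blast
    show "(\<lambda>b. f b \<triangleleft>\<^bsub>M\<^esub> sc r) \<in> S n" if r: "r \<in> carrier R" for r
      by (rule SI[OF sc_rhom[OF f(1) r] Eact[OF f(2) r]]) (simp add: f(3) act[OF f(2) r])
    fix g assume "g \<in> S n"
    then obtain y where g: "g \<in> rhom \<Lambda> M M" "y \<in> ?E" "\<forall>b\<in>carrier M. g b = \<Phi> n y b" unfolding S_def by blast
    show "(\<lambda>b. f b \<oplus>\<^bsub>M\<^esub> g b) \<in> S n"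
      by (rule SI[OF M.rhom_add_map[OF f(1) g(1)] stab_end_add[OF rM I f(2) g(2)]]) (simp add: f(3) g(3) add[OF f(2) g(2)])
  next
    show "S (Suc n) \<subseteq> S n" for n
    proof
      fix f assume "f \<in> S (Suc n)"
      then obtain x where f: "f \<in> rhom \<Lambda> M M" "x \<in> ?E" "\<forall>b\<in>carrier M. f b = \<Phi> (Suc n) x b" unfolding S_def by blast
      obtain x' where x': "x' \<in> ?E" "\<forall>b\<in>carrier M. \<Phi> (Suc n) x b = \<Phi> n x' b" using dec[OF f(2)] ..
      show "f \<in> S n" by (rule SI[OF f(1) x'(1)]) (simp add: f(3) x'(2))
    qed
  qed
  then obtain n where n: "\<forall>m\<ge>n. \<forall>f\<in>S n. \<exists>g\<in>S m. \<forall>b\<in>carrier M. f b = g b" ..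
  show ?thesis
  proof (intro exI[of _ n] allI impI ballI)
    fix m x assume m: "n \<le> m" and x: "x \<in> ?E"
    from n[rule_format, OF m SE[OF x]] obtain g where g: "g \<in> S m" "\<forall>b\<in>carrier M. \<Phi> n x b = g b" ..
    from g(1) obtain y where "y \<in> ?E" "\<forall>b\<in>carrier M. g b = \<Phi> m y b" unfolding S_def by blast
    then show "\<exists>y\<in>?E. \<forall>b\<in>carrier M. \<Phi> n x b = \<Phi> m y b" using g(2) by (intro bexI[of _ y]) simp_all
  qed
qed

text \<open>The usual proof of Fitting's lemma stabilises the images and the kernels of the powers of \<open>e\<close>, and so
  needs the ascending chain condition as well. Descending chains are enough if they are taken in \<open>E\<close>: both
  \<open>e\<^sup>n E\<close> and \<open>E e\<^sup>n\<close> stabilise, and \<open>a = e\<^sup>n\<close> satisfies \<open>a = a\<^sup>2 x = y a\<^sup>2\<close>.\<close>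

lemma fitting_idempotent:
  assumes M: "fg_rmodule \<Lambda> M" and I: "rsubmodule \<Lambda> M I" and e: "e \<in> stab_end \<Lambda> M I"
  obtains n x y where "n > 0" "x \<in> stab_end \<Lambda> M I" "y \<in> stab_end \<Lambda> M I"
    "\<forall>b\<in>carrier M. (e ^^ n) ((e ^^ n) (x b)) = (e ^^ n) b"
    "\<forall>b\<in>carrier M. y ((e ^^ n) ((e ^^ n) b)) = (e ^^ n) b"
proof -
  note rM = fg_rmodule_right[OF M]
  interpret M: right_module \<Lambda> M by (rule rM)
  let ?E = "stab_end \<Lambda> M I"
  have Ec: "f b \<in> carrier M" if "f \<in> ?E" "b \<in> carrier M" for f b
    using rhom_closed[OF stab_endD(1)[OF that(1)] that(2)] .
  note en = stab_end_funpow[OF e]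
  have "\<exists>n. \<forall>m\<ge>n. \<forall>x\<in>?E. \<exists>y\<in>?E. \<forall>b\<in>carrier M. (e ^^ n) (x b) = (e ^^ m) (y b)"
  proof (rule stab_chain[where \<Phi> = "\<lambda>n x b. (e ^^ n) (x b)", OF M I])
    fix n x assume x: "x \<in> ?E"
    show "(\<lambda>b. (e ^^ n) (x b)) \<in> ?E" by (rule stab_end_comp[OF en x])
    show "\<exists>x'\<in>?E. \<forall>b\<in>carrier M. (e ^^ Suc n) (x b) = (e ^^ n) (x' b)"
      by (rule bexI[OF _ stab_end_comp[OF e x]]) (simp add: funpow_swap1)
  qed (simp_all add: rhom_add[OF stab_endD(1)[OF en]] rhom_act[OF stab_endD(1)[OF en]] Ec)
  then obtain n1 where n1: "\<forall>m\<ge>n1. \<forall>x\<in>?E. \<exists>y\<in>?E. \<forall>b\<in>carrier M. (e ^^ n1) (x b) = (e ^^ m) (y b)" ..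
  have "\<exists>n. \<forall>m\<ge>n. \<forall>x\<in>?E. \<exists>y\<in>?E. \<forall>b\<in>carrier M. x ((e ^^ n) b) = y ((e ^^ m) b)"
  proof (rule stab_chain[where \<Phi> = "\<lambda>n x b. x ((e ^^ n) b)", OF M I])
    fix n x assume x: "x \<in> ?E"
    show "(\<lambda>b. x ((e ^^ n) b)) \<in> ?E" by (rule stab_end_comp[OF x en])
    show "\<exists>x'\<in>?E. \<forall>b\<in>carrier M. x ((e ^^ Suc n) b) = x' ((e ^^ n) b)"
      by (rule bexI[OF _ stab_end_comp[OF x e]]) simp
  qed simp_all
  then obtain n2 where n2: "\<forall>m\<ge>n2. \<forall>x\<in>?E. \<exists>y\<in>?E. \<forall>b\<in>carrier M. x ((e ^^ n2) b) = y ((e ^^ m) b)" ..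
  \<comment> \<open>Positive and beyond both thresholds; the chains are then compared at level \<open>2 n\<close>.\<close>
  define n where "n = Suc (n1 + n2)"
  from n1[rule_format, OF le_add1 stab_end_id, of n]
  obtain x where x: "x \<in> ?E" "\<forall>b\<in>carrier M. (e ^^ n1) b = (e ^^ (n1 + n)) (x b)" ..
  from n2[rule_format, OF le_add1 stab_end_id, of n]
  obtain y where y: "y \<in> ?E" "\<forall>b\<in>carrier M. (e ^^ n2) b = y ((e ^^ (n2 + n)) b)" ..
  show ?thesis
  proof (rule that[of n x y])
    show "n > 0" by (simp add: n_def)
    have "(e ^^ n) ((e ^^ n) (x b)) = (e ^^ n) b" if b: "b \<in> carrier M" for b
    proof -
      have eq: "n + n = Suc n2 + (n1 + n)" by (simp add: n_def)
      have "(e ^^ n) ((e ^^ n) (x b)) = (e ^^ (n + n)) (x b)" by (simp only: funpow_add comp_apply)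
      also have "\<dots> = (e ^^ (Suc n2 + (n1 + n))) (x b)" by (simp only: eq)
      also have "\<dots> = (e ^^ Suc n2) ((e ^^ (n1 + n)) (x b))" by (simp only: funpow_add comp_apply)
      also have "\<dots> = (e ^^ Suc n2) ((e ^^ n1) b)" using x(2) b by simp
      also have "\<dots> = (e ^^ (Suc n2 + n1)) b" by (simp only: funpow_add comp_apply)
      also have "Suc n2 + n1 = n" by (simp add: n_def)
      finally show ?thesis .
    qed
    then show "\<forall>b\<in>carrier M. (e ^^ n) ((e ^^ n) (x b)) = (e ^^ n) b" by blast
    have "y ((e ^^ n) ((e ^^ n) b)) = (e ^^ n) b" if b: "b \<in> carrier M" for b
    proof -
      have eq: "n + n = (n2 + n) + Suc n1" "n = n2 + Suc n1" by (simp_all add: n_def)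
      have "(e ^^ n) ((e ^^ n) b) = (e ^^ (n + n)) b" by (simp only: funpow_add comp_apply)
      also have "\<dots> = (e ^^ (n2 + n)) ((e ^^ Suc n1) b)" by (simp only: eq(1) funpow_add comp_apply)
      finally have "y ((e ^^ n) ((e ^^ n) b)) = (e ^^ n2) ((e ^^ Suc n1) b)"
        using y(2) Ec[OF en b, of "Suc n1"] by simp
      also have "\<dots> = (e ^^ n) b" by (simp only: eq(2) funpow_add comp_apply)
      finally show ?thesis .
    qed
    then show "\<forall>b\<in>carrier M. y ((e ^^ n) ((e ^^ n) b)) = (e ^^ n) b" by blast
  qed (rule x(1) y(1))+
qed

text \<open>With \<open>a = e\<^sup>n = a\<^sup>2 x = y a\<^sup>2\<close> the element \<open>g = a x = y a\<close> is an idempotent that satisfies \<open>a g = a\<close>. It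
  splits the object, so indecomposability leaves \<open>g = 0\<close>, whence \<open>a = 0\<close>, or \<open>g = 1\<close>, whence \<open>a\<close> and with it
  \<open>e\<close> has a left and a right inverse.\<close>

lemma fitting:
  assumes C: "resolving \<Lambda> \<C>" and ind: "Hindecomposable \<Lambda> (Smono \<Lambda> \<C>) (A, f, B)"
    and e: "e \<in> stab_end \<Lambda> B (f ` carrier A)"
  shows "(\<exists>n. \<forall>b\<in>carrier B. (e ^^ n) b = \<zero>\<^bsub>B\<^esub>) \<or>
    (\<exists>v\<in>stab_end \<Lambda> B (f ` carrier A). \<forall>b\<in>carrier B. e (v b) = b \<and> v (e b) = b)"
proof -
  have S: "(A, f, B) \<in> Smono \<Lambda> \<C>" using ind by (simp add: Hindecomposable_def)
  note SD = SmonoD[OF S]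
  note A = SD(7) and B = SD(8)
  interpret A: right_module \<Lambda> A by (rule A)
  interpret B: right_module \<Lambda> B by (rule B)
  let ?E = "stab_end \<Lambda> B (f ` carrier A)"
  note I = rsubmodule_image[OF A B SD(5)]
  have Ec: "h b \<in> carrier B" if "h \<in> ?E" "b \<in> carrier B" for h b
    using rhom_closed[OF stab_endD(1)[OF that(1)] that(2)] .
  obtain n x y where n: "n > 0" and xy: "x \<in> ?E" "y \<in> ?E"
    and ax: "\<forall>b\<in>carrier B. (e ^^ n) ((e ^^ n) (x b)) = (e ^^ n) b"
    and ya: "\<forall>b\<in>carrier B. y ((e ^^ n) ((e ^^ n) b)) = (e ^^ n) b"
    by (rule fitting_idempotent[OF SD(9) I e])
  note en = stab_end_funpow[OF e]
  define g where "g b = (e ^^ n) (x b)" for b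
  have gE: "g \<in> ?E" unfolding g_def by (rule stab_end_comp[OF en xy(1)])
  have yg: "y ((e ^^ n) b) = g b" if b: "b \<in> carrier B" for b
    using ya Ec[OF xy(1) b] ax b by (simp add: g_def) metis
  have idem: "g (g b) = g b" if b: "b \<in> carrier B" for b
    using yg[OF Ec[OF gE b]] yg[OF b] ax b by (simp add: g_def)
  have ag: "(e ^^ n) (g b) = (e ^^ n) b" if "b \<in> carrier B" for b using ax that by (simp add: g_def)
  obtain \<alpha> where \<alpha>: "(\<alpha>, g) \<in> Hhom \<Lambda> (A, f, B) (A, f, B)" using stab_end_Hhom[OF A B SD(5,6) gE] ..
  note \<alpha>D = HhomD[OF \<alpha>]
  let ?\<alpha>' = "\<lambda>x. x \<ominus>\<^bsub>A\<^esub> \<alpha> x" and ?g' = "\<lambda>x. x \<ominus>\<^bsub>B\<^esub> g x"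
  have \<alpha>': "(?\<alpha>', ?g') \<in> Hhom \<Lambda> (A, f, B) (A, f, B)"
    by (rule HhomI[OF A.rhom_minus_map[OF rhom_id(2) \<alpha>D(1)] B.rhom_minus_map[OF rhom_id(2) \<alpha>D(2)]])
      (simp add: rhom_minus[OF A B SD(5)] rhom_closed[OF \<alpha>D(1)] \<alpha>D(3))
  note idemA = idempotent_first[where \<alpha> = \<alpha> and g = g, OF \<alpha> SD(5,6) idem]
  let ?U = "(fix_mod \<alpha> A, f, fix_mod g B)" and ?V = "(fix_mod ?\<alpha>' A, f, fix_mod ?g' B)"
  have U: "?U \<in> Smono \<Lambda> \<C>" by (rule fix_mod_Smono[where \<alpha> = \<alpha> and g = g, OF C S \<alpha> idem])
  have V: "?V \<in> Smono \<Lambda> \<C>"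
    by (rule fix_mod_Smono[where \<alpha> = "?\<alpha>'" and g = "?g'", OF C S \<alpha>'])
      (rule complement_idempotent(2)[where g = g, OF B \<alpha>D(2) idem])
  note sA = fix_mod_dsum[where g = \<alpha>, OF A \<alpha>D(1) idemA] and sB = fix_mod_dsum[where g = g, OF B \<alpha>D(2) idem]
  note UD = SmonoD[OF U] and VD = SmonoD[OF V]
  have "Hiso \<Lambda> (Hdsum ?U ?V) (A, f, B)"
    unfolding Hdsum.simps
  proof (rule Hiso_bij[OF _ _ _ _ sA(2) sB(2)])
    show "right_module \<Lambda> (dsum (fix_mod \<alpha> A) (fix_mod ?\<alpha>' A))" "right_module \<Lambda> (dsum (fix_mod g B) (fix_mod ?g' B))"
      by (intro dsum_right_module UD(7,8) VD(7,8))+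
    show "map_prod f f \<in> rhom \<Lambda> (dsum (fix_mod \<alpha> A) (fix_mod ?\<alpha>' A)) (dsum (fix_mod g B) (fix_mod ?g' B))"
      by (intro rhom_map_prod UD VD)
    show "(\<lambda>z. fst z \<oplus>\<^bsub>A\<^esub> snd z, \<lambda>z. fst z \<oplus>\<^bsub>B\<^esub> snd z) \<in> Hhom \<Lambda>
      (dsum (fix_mod \<alpha> A) (fix_mod ?\<alpha>' A), map_prod f f, dsum (fix_mod g B) (fix_mod ?g' B)) (A, f, B)"
      by (rule HhomI[OF sA(1) sB(1)]) (auto simp: rhom_add[OF SD(5)])
  qed
  then have "Hiso \<Lambda> (A, f, B) (Hdsum ?U ?V)" by (rule Hiso_sym)
  then have "Hzero ?U \<or> Hzero ?V" using ind U V unfolding Hindecomposable_def by blast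
  then show ?thesis
  proof
    assume "Hzero ?U"
    then have z: "carrier (fix_mod g B) = {\<zero>\<^bsub>B\<^esub>}" by (simp add: zero_rmodule_def)
    have "(e ^^ n) b = \<zero>\<^bsub>B\<^esub>" if b: "b \<in> carrier B" for b
    proof -
      have "g b \<in> carrier (fix_mod g B)" using idem[OF b] Ec[OF gE b] by simp
      then have "g b = \<zero>\<^bsub>B\<^esub>" unfolding z by simp
      then show ?thesis using ag[OF b] rhom_zero[OF B B stab_endD(1)[OF en]] by simp
    qed
    then show ?thesis by blast
  next
    assume "Hzero ?V"
    then have z: "carrier (fix_mod ?g' B) = {\<zero>\<^bsub>B\<^esub>}" by (simp add: zero_rmodule_def)
    have gb: "g b = b" if b: "b \<in> carrier B" for b
    proof -
      have "?g' b \<in> carrier (fix_mod ?g' B)"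
        using complement_idempotent(2)[where g = g, OF B \<alpha>D(2) idem b] b Ec[OF gE b] by simp
      then have "?g' b = \<zero>\<^bsub>B\<^esub>" unfolding z by simp
      then show ?thesis using b Ec[OF gE b] by (simp add: B.eq_iff_minus)
    qed
    obtain k where k: "n = Suc k" using n by (cases n) auto
    let ?v = "\<lambda>b. (e ^^ k) (x b)" and ?w = "\<lambda>b. y ((e ^^ k) b)"
    have v: "?v \<in> ?E" by (rule stab_end_comp[OF en xy(1)])
    have ev: "e (?v b) = b" if b: "b \<in> carrier B" for b using gb[OF b] by (simp add: g_def k)
    have we: "?w (e b) = b" if b: "b \<in> carrier B" for b
      using yg[OF b] gb[OF b] by (simp add: k funpow_swap1)
    have wv: "?v b = ?w b" if b: "b \<in> carrier B" for b using we[OF Ec[OF v b]] ev[OF b] by simp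
    have "?v (e b) = b" if b: "b \<in> carrier B" for b using wv[OF Ec[OF e b]] we[OF b] by simp
    then show ?thesis using ev v by (intro disjI2 bexI[of _ ?v]) auto
  qed
qed

end

section \<open>Deflations and projective objects\<close>

text \<open>Projectivity involves an exact sequence only through its second map.\<close>

definition scw_deflation :: "('a, 's) ring_scheme \<Rightarrow> 'a umod set \<Rightarrow> 'a hobj \<Rightarrow> 'a hmor \<Rightarrow> 'a hobj \<Rightarrow> bool" where
  "scw_deflation \<Lambda> \<C> Z p Y \<longleftrightarrow> (\<exists>U i. (U, i, Z, p, Y) \<in> Escw \<Lambda> \<C>)"

lemma scw_deflation_cases:
  assumes "scw_deflation \<Lambda> \<C> Z p Y"
  obtains Z1 h Z2 p1 p2 Y1 g Y2 s1 s2 s3 where "Z = (Z1, h, Z2)" "p = (p1, p2)" "Y = (Y1, g, Y2)"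
    "(Z1, h, Z2) \<in> Smono \<Lambda> \<C>" "(Y1, g, Y2) \<in> Smono \<Lambda> \<C>" "(p1, p2) \<in> Hhom \<Lambda> (Z1, h, Z2) (Y1, g, Y2)"
    "s1 \<in> rhom \<Lambda> Y1 Z1" "\<forall>y\<in>carrier Y1. p1 (s1 y) = y"
    "s2 \<in> rhom \<Lambda> Y2 Z2" "\<forall>y\<in>carrier Y2. p2 (s2 y) = y"
    "s3 \<in> rhom \<Lambda> (cok g Y1 Y2) (cok h Z1 Z2)"
    "\<forall>c\<in>carrier (cok g Y1 Y2). cok_map p2 g Y1 Y2 (s3 c) = c"
proof -
  obtain U i where "(U, i, Z, p, Y) \<in> Escw \<Lambda> \<C>" using assms unfolding scw_deflation_def by (elim exE)
  then show ?thesis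
    unfolding Escw_def mem_Collect_eq prod.inject
  proof (elim exE conjE)
    fix X1 f X2 i1 i2 Z1 h Z2 p1 p2 Y1 g Y2
    assume *: "Z = (Z1, h, Z2)" "p = (p1, p2)" "Y = (Y1, g, Y2)"
      "(Z1, h, Z2) \<in> Smono \<Lambda> \<C>" "(Y1, g, Y2) \<in> Smono \<Lambda> \<C>" "(p1, p2) \<in> Hhom \<Lambda> (Z1, h, Z2) (Y1, g, Y2)"
      and sp: "split_exact \<Lambda> X1 i1 Z1 p1 Y1" "split_exact \<Lambda> X2 i2 Z2 p2 Y2"
      "split_exact \<Lambda> (cok f X1 X2) (cok_map i2 h Z1 Z2) (cok h Z1 Z2) (cok_map p2 g Y1 Y2) (cok g Y1 Y2)"
    obtain s1 where s1: "s1 \<in> rhom \<Lambda> Y1 Z1" "\<forall>y\<in>carrier Y1. p1 (s1 y) = y"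
      using sp(1) unfolding split_exact_def by (elim bexE conjE)
    obtain s2 where s2: "s2 \<in> rhom \<Lambda> Y2 Z2" "\<forall>y\<in>carrier Y2. p2 (s2 y) = y"
      using sp(2) unfolding split_exact_def by (elim bexE conjE)
    obtain s3 where s3: "s3 \<in> rhom \<Lambda> (cok g Y1 Y2) (cok h Z1 Z2)"
      "\<forall>c\<in>carrier (cok g Y1 Y2). cok_map p2 g Y1 Y2 (s3 c) = c"
      using sp(3) unfolding split_exact_def by (elim bexE conjE)
    show ?thesis by (rule that[OF * s1 s2 s3])
  qed
qed

text \<open>This is how the splitting of the sequence of cokernels is used. Send \<open>F\<close> to \<open>Cok g\<close> by \<open>\<phi>\<close>, on to \<open>Cok h\<close>
  by the section, and lift the result through the projection \<open>Z2 \<rightarrow> Cok h\<close>.\<close>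

lemma cokernel_lift:
  assumes Z: "(Z1, h, Z2) \<in> Smono \<Lambda> \<C>" and Y: "(Y1, g, Y2) \<in> Smono \<Lambda> \<C>"
    and p: "(p1, p2) \<in> Hhom \<Lambda> (Z1, h, Z2) (Y1, g, Y2)"
    and s3: "s3 \<in> rhom \<Lambda> (cok g Y1 Y2) (cok h Z1 Z2)"
      "\<forall>c\<in>carrier (cok g Y1 Y2). cok_map p2 g Y1 Y2 (s3 c) = c"
    and F: "F \<in> prj \<Lambda>" and \<phi>: "\<phi> \<in> rhom \<Lambda> F Y2"
  obtains \<psi> where "\<psi> \<in> rhom \<Lambda> F Z2" "\<forall>t\<in>carrier F. p2 (\<psi> t) \<ominus>\<^bsub>Y2\<^esub> \<phi> t \<in> g ` carrier Y1"
    "\<forall>t\<in>carrier F. \<phi> t \<in> g ` carrier Y1 \<longrightarrow> \<psi> t \<in> h ` carrier Z1"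
proof -
  note ZD = SmonoD[OF Z] and YD = SmonoD[OF Y] and pD = HhomD[OF p]
  note Z1 = ZD(7) and Z2 = ZD(9) and Y1 = YD(7) and Y2 = YD(9)
  note rY2 = YD(8)
  interpret Y2: right_module \<Lambda> Y2 by (rule rY2)
  obtain q where q: "q = (\<lambda>x. h ` carrier Z1 +>\<^bsub>Z2\<^esub> x)" "q \<in> rhom \<Lambda> Z2 (cok h Z1 Z2)"
    "q ` carrier Z2 = carrier (cok h Z1 Z2)"
    "\<forall>x\<in>carrier Z2. q x = \<zero>\<^bsub>cok h Z1 Z2\<^esub> \<longleftrightarrow> x \<in> h ` carrier Z1" by (rule cok_proj[OF Z1 Z2 ZD(5)])
  obtain r where r: "r = (\<lambda>x. g ` carrier Y1 +>\<^bsub>Y2\<^esub> x)" "r \<in> rhom \<Lambda> Y2 (cok g Y1 Y2)"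
    "r ` carrier Y2 = carrier (cok g Y1 Y2)"
    "\<forall>x\<in>carrier Y2. r x = \<zero>\<^bsub>cok g Y1 Y2\<^esub> \<longleftrightarrow> x \<in> g ` carrier Y1" by (rule cok_proj[OF Y1 Y2 YD(5)])
  note fcZ = cok_fg(1)[OF Z1 Z2 ZD(5)] and fcY = cok_fg(1)[OF Y1 Y2 YD(5)]
  note cZ = fg_rmodule_right[OF fcZ] and cY = fg_rmodule_right[OF fcY]
  interpret cY: right_module \<Lambda> "cok g Y1 Y2" by (rule cY)
  have cm: "cok_map p2 g Y1 Y2 (q z) = r (p2 z)" if z: "z \<in> carrier Z2" for z
    unfolding q(1) r(1)
    by (rule cok_map_proj[OF Z1 Z2 ZD(5) Y1 Y2 YD(5) pD(2) _ z])
      (simp add: pD(3) rhom_closed[OF pD(1)])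
  have "\<exists>\<psi>\<in>rhom \<Lambda> F Z2. \<forall>t\<in>carrier F. q (\<psi> t) = s3 (r (\<phi> t))"
    by (rule prj_lift[OF F Z2 fcZ q(2,3) rhom_comp[OF s3(1) rhom_comp[OF r(2) \<phi>]]])
  then obtain \<psi> where \<psi>: "\<psi> \<in> rhom \<Lambda> F Z2" "\<forall>t\<in>carrier F. q (\<psi> t) = s3 (r (\<phi> t))" ..
  show ?thesis
  proof (rule that[OF \<psi>(1)])
    show "\<forall>t\<in>carrier F. p2 (\<psi> t) \<ominus>\<^bsub>Y2\<^esub> \<phi> t \<in> g ` carrier Y1"
    proof
      fix t assume t: "t \<in> carrier F"
      note ft = rhom_closed[OF \<phi> t] and pt = rhom_closed[OF \<psi>(1) t]
      note ppt = rhom_closed[OF pD(2) pt] and rft = rhom_closed[OF r(2) ft]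
      have "r (p2 (\<psi> t)) = r (\<phi> t)" using cm[OF pt] \<psi>(2) t s3(2) rft by simp
      then have "r (p2 (\<psi> t) \<ominus>\<^bsub>Y2\<^esub> \<phi> t) = \<zero>\<^bsub>cok g Y1 Y2\<^esub>"
        using rhom_minus[OF rY2 cY r(2) ppt ft] rft cY.eq_iff_minus by simp
      then show "p2 (\<psi> t) \<ominus>\<^bsub>Y2\<^esub> \<phi> t \<in> g ` carrier Y1" using r(4) ppt ft by simp
    qed
    show "\<forall>t\<in>carrier F. \<phi> t \<in> g ` carrier Y1 \<longrightarrow> \<psi> t \<in> h ` carrier Z1"
    proof (intro ballI impI)
      fix t assume t: "t \<in> carrier F" and "\<phi> t \<in> g ` carrier Y1"
      then have "r (\<phi> t) = \<zero>\<^bsub>cok g Y1 Y2\<^esub>" using r(4) rhom_closed[OF \<phi> t] by simp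
      then have "q (\<psi> t) = \<zero>\<^bsub>cok h Z1 Z2\<^esub>" using \<psi>(2) t rhom_zero[OF cY cZ s3(1)] by simp
      then show "\<psi> t \<in> h ` carrier Z1" using q(4) rhom_closed[OF \<psi>(1) t] by simp
    qed
  qed
qed


subsection \<open>The lifting property\<close>

text \<open>Projectivity, but for morphisms between modules of arbitrary types, so that it makes sense for a direct
  sum before that is replaced by an isomorphic copy.\<close>

definition scw_lifts :: "('a, 's) ring_scheme \<Rightarrow> 'a umod set \<Rightarrow> ('a, 'b, 'c) harrow \<Rightarrow> bool" where
  "scw_lifts \<Lambda> \<C> P \<longleftrightarrow> (\<forall>Z p Y. scw_deflation \<Lambda> \<C> Z p Y \<longrightarrow>
     (\<forall>\<phi>\<in>Hhom \<Lambda> P Y. \<exists>\<psi>\<in>Hhom \<Lambda> P Z. Heq P (Hcomp p \<psi>) \<phi>))"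

lemma ex_projective_iff:
  "ex_projective \<Lambda> (Smono \<Lambda> \<C>) (Escw \<Lambda> \<C>) P \<longleftrightarrow> P \<in> Smono \<Lambda> \<C> \<and> scw_lifts \<Lambda> \<C> P"
  unfolding ex_projective_def scw_lifts_def scw_deflation_def by (intro conj_cong refl) (iprover)

lemma scw_liftsI:
  assumes "\<And>Z1 h Z2 p1 p2 Y1 g Y2 \<phi>1 \<phi>2. scw_deflation \<Lambda> \<C> (Z1, h, Z2) (p1, p2) (Y1, g, Y2) \<Longrightarrow>
     (\<phi>1, \<phi>2) \<in> Hhom \<Lambda> (A, f, B) (Y1, g, Y2) \<Longrightarrow>
     \<exists>\<psi>1 \<psi>2. (\<psi>1, \<psi>2) \<in> Hhom \<Lambda> (A, f, B) (Z1, h, Z2) \<and>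
       (\<forall>x\<in>carrier A. p1 (\<psi>1 x) = \<phi>1 x) \<and> (\<forall>x\<in>carrier B. p2 (\<psi>2 x) = \<phi>2 x)"
  shows "scw_lifts \<Lambda> \<C> (A, f, B)"
  unfolding scw_lifts_def
proof (intro allI impI ballI)
  fix Z p Y \<phi> assume *: "scw_deflation \<Lambda> \<C> Z p Y" "\<phi> \<in> Hhom \<Lambda> (A, f, B) Y"
  obtain Z1 h Z2 where Z: "Z = (Z1, h, Z2)" by (rule prod_cases3)
  obtain Y1 g Y2 where Y: "Y = (Y1, g, Y2)" by (rule prod_cases3)
  obtain p1 p2 where p: "p = (p1, p2)" by (rule prod.exhaust)
  obtain \<phi>1 \<phi>2 where \<phi>: "\<phi> = (\<phi>1, \<phi>2)" by (rule prod.exhaust)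
  obtain \<psi>1 \<psi>2 where "(\<psi>1, \<psi>2) \<in> Hhom \<Lambda> (A, f, B) (Z1, h, Z2)"
    "\<forall>x\<in>carrier A. p1 (\<psi>1 x) = \<phi>1 x" "\<forall>x\<in>carrier B. p2 (\<psi>2 x) = \<phi>2 x"
    using assms[OF *[unfolded Z p Y \<phi>]] by (elim exE conjE)
  then show "\<exists>\<psi>\<in>Hhom \<Lambda> (A, f, B) Z. Heq (A, f, B) (Hcomp p \<psi>) \<phi>"
    unfolding Z p Y \<phi> by (intro bexI[of _ "(\<psi>1, \<psi>2)"]) (simp_all del: Hhom.simps)
qed

lemma scw_liftsE:
  assumes "scw_lifts \<Lambda> \<C> (A, f, B)" "scw_deflation \<Lambda> \<C> (Z1, h, Z2) (p1, p2) (Y1, g, Y2)"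
    "(\<phi>1, \<phi>2) \<in> Hhom \<Lambda> (A, f, B) (Y1, g, Y2)"
  obtains \<psi>1 \<psi>2 where "(\<psi>1, \<psi>2) \<in> Hhom \<Lambda> (A, f, B) (Z1, h, Z2)"
    "\<forall>x\<in>carrier A. p1 (\<psi>1 x) = \<phi>1 x" "\<forall>x\<in>carrier B. p2 (\<psi>2 x) = \<phi>2 x"
proof -
  obtain \<psi> where \<psi>: "\<psi> \<in> Hhom \<Lambda> (A, f, B) (Z1, h, Z2)" "Heq (A, f, B) (Hcomp (p1, p2) \<psi>) (\<phi>1, \<phi>2)"
    using assms(1)[unfolded scw_lifts_def, rule_format, OF assms(2,3)] by (elim bexE)
  obtain \<psi>1 \<psi>2 where e: "\<psi> = (\<psi>1, \<psi>2)" by (rule prod.exhaust)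
  show ?thesis using that[of \<psi>1 \<psi>2] \<psi> unfolding e by (simp del: Hhom.simps)
qed

text \<open>A morphism from \<open>(M = M)\<close> is determined by its first component, which lifts by the section there.\<close>

lemma scw_lifts_identity: "scw_lifts \<Lambda> \<C> (M, id, M)"
proof (rule scw_liftsI)
  fix Z1 h Z2 p1 p2 Y1 g Y2 \<phi>1 \<phi>2
  assume d: "scw_deflation \<Lambda> \<C> (Z1, h, Z2) (p1, p2) (Y1, g, Y2)" and \<phi>: "(\<phi>1, \<phi>2) \<in> Hhom \<Lambda> (M, id, M) (Y1, g, Y2)"
  obtain s1 where Z: "(Z1, h, Z2) \<in> Smono \<Lambda> \<C>" and p: "(p1, p2) \<in> Hhom \<Lambda> (Z1, h, Z2) (Y1, g, Y2)"
    and s1: "s1 \<in> rhom \<Lambda> Y1 Z1" "\<forall>y\<in>carrier Y1. p1 (s1 y) = y"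
    by (rule scw_deflation_cases[OF d]) simp
  note \<phi>D = HhomD[OF \<phi>] and pD = HhomD[OF p]
  have s: "(\<lambda>x. s1 (\<phi>1 x)) \<in> rhom \<Lambda> M Z1" by (rule rhom_comp[OF s1(1) \<phi>D(1)])
  have "(\<lambda>x. s1 (\<phi>1 x), \<lambda>x. h (s1 (\<phi>1 x))) \<in> Hhom \<Lambda> (M, id, M) (Z1, h, Z2)"
    by (rule HhomI[OF s rhom_comp[OF SmonoD(5)[OF Z] s]]) simp
  moreover have "p1 (s1 (\<phi>1 x)) = \<phi>1 x" if "x \<in> carrier M" for x using s1(2) rhom_closed[OF \<phi>D(1) that] by simp
  moreover have "p2 (h (s1 (\<phi>1 x))) = \<phi>2 x" if "x \<in> carrier M" for x
    using pD(3)[OF rhom_closed[OF s that]] calculation(2)[OF that] \<phi>D(3)[OF that] by simp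
  ultimately show "\<exists>\<psi>1 \<psi>2. (\<psi>1, \<psi>2) \<in> Hhom \<Lambda> (M, id, M) (Z1, h, Z2) \<and>
       (\<forall>x\<in>carrier M. p1 (\<psi>1 x) = \<phi>1 x) \<and> (\<forall>x\<in>carrier M. p2 (\<psi>2 x) = \<phi>2 x)"
    by (intro exI[of _ "\<lambda>x. s1 (\<phi>1 x)"] exI[of _ "\<lambda>x. h (s1 (\<phi>1 x))"] conjI ballI)
qed

lemma zero_sub_simps [simp]: "carrier (zero_sub M) = {\<zero>\<^bsub>M\<^esub>}" "\<zero>\<^bsub>zero_sub M\<^esub> = \<zero>\<^bsub>M\<^esub>"
  "x \<oplus>\<^bsub>zero_sub M\<^esub> y = x \<oplus>\<^bsub>M\<^esub> y" "x \<triangleleft>\<^bsub>zero_sub M\<^esub> a = x \<triangleleft>\<^bsub>M\<^esub> a"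
  by (simp_all add: zero_sub_def)

lemma zero_sub_right_module:
  assumes M: "right_module \<Lambda> M"
  shows "right_module \<Lambda> (zero_sub M)"
proof -
  interpret M: right_module \<Lambda> M by (rule M)
  have "rsubmodule \<Lambda> M {\<zero>\<^bsub>M\<^esub>}" by (rule rsubmoduleI[OF M]) auto
  then show ?thesis unfolding zero_sub_def by (rule rsubmodule_right_module[OF M])
qed

lemma scw_lifts_zero:
  assumes M: "right_module \<Lambda> M"
  shows "scw_lifts \<Lambda> \<C> (zero_sub M, id, M)"
proof (rule scw_liftsI)
  fix Z1 h Z2 p1 p2 Y1 g Y2 \<phi>1 \<phi>2
  assume d: "scw_deflation \<Lambda> \<C> (Z1, h, Z2) (p1, p2) (Y1, g, Y2)"
    and \<phi>: "(\<phi>1, \<phi>2) \<in> Hhom \<Lambda> (zero_sub M, id, M) (Y1, g, Y2)"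
  obtain s2 where Z: "(Z1, h, Z2) \<in> Smono \<Lambda> \<C>" and Y: "(Y1, g, Y2) \<in> Smono \<Lambda> \<C>"
    and p: "(p1, p2) \<in> Hhom \<Lambda> (Z1, h, Z2) (Y1, g, Y2)"
    and s2: "s2 \<in> rhom \<Lambda> Y2 Z2" "\<forall>y\<in>carrier Y2. p2 (s2 y) = y"
    by (rule scw_deflation_cases[OF d]) simp
  note \<phi>D = HhomD[OF \<phi>] and pD = HhomD[OF p] and ZD = SmonoD[OF Z] and YD = SmonoD[OF Y]
  note rZ1 = ZD(7) and rZ2 = ZD(8) and rY1 = YD(7)
  have s: "(\<lambda>x. s2 (\<phi>2 x)) \<in> rhom \<Lambda> M Z2" by (rule rhom_comp[OF s2(1) \<phi>D(2)])
  have s0: "s2 (\<phi>2 \<zero>\<^bsub>M\<^esub>) = \<zero>\<^bsub>Z2\<^esub>" using rhom_zero[OF M rZ2 s] .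
  have "(\<lambda>x. \<zero>\<^bsub>Z1\<^esub>, \<lambda>x. s2 (\<phi>2 x)) \<in> Hhom \<Lambda> (zero_sub M, id, M) (Z1, h, Z2)"
    by (rule HhomI[OF right_module.rhom_zero_map[OF rZ1] s]) (simp add: s0 rhom_zero[OF rZ1 rZ2 ZD(5)])
  moreover have "p1 \<zero>\<^bsub>Z1\<^esub> = \<phi>1 x" if "x \<in> carrier (zero_sub M)" for x
    using that rhom_zero[OF rZ1 rY1 pD(1)] rhom_zero[OF zero_sub_right_module[OF M] rY1 \<phi>D(1)] by simp
  moreover have "p2 (s2 (\<phi>2 x)) = \<phi>2 x" if "x \<in> carrier M" for x
    using s2(2) rhom_closed[OF \<phi>D(2) that] by simp
  ultimately show "\<exists>\<psi>1 \<psi>2. (\<psi>1, \<psi>2) \<in> Hhom \<Lambda> (zero_sub M, id, M) (Z1, h, Z2) \<and>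
       (\<forall>x\<in>carrier (zero_sub M). p1 (\<psi>1 x) = \<phi>1 x) \<and> (\<forall>x\<in>carrier M. p2 (\<psi>2 x) = \<phi>2 x)"
    by (intro exI[of _ "\<lambda>x. \<zero>\<^bsub>Z1\<^esub>"] exI[of _ "\<lambda>x. s2 (\<phi>2 x)"] conjI ballI)
qed

text \<open>A lift modulo the images is available from the splitting on cokernels. Its error \<open>\<delta>\<close> takes values in
  \<open>Y1\<close> and is removed by means of the section of the first components.\<close>

lemma scw_lifts_kernel:
  assumes F: "F \<in> prj \<Lambda>" and K: "rsubmodule \<Lambda> F K"
  shows "scw_lifts \<Lambda> \<C> (F\<lparr>carrier := K\<rparr>, id, F)"
proof (rule scw_liftsI)
  fix Z1 h Z2 p1 p2 Y1 g Y2 \<phi>1 \<phi>2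
  assume d: "scw_deflation \<Lambda> \<C> (Z1, h, Z2) (p1, p2) (Y1, g, Y2)"
    and \<phi>: "(\<phi>1, \<phi>2) \<in> Hhom \<Lambda> (F\<lparr>carrier := K\<rparr>, id, F) (Y1, g, Y2)"
  obtain s1 s3 where Z: "(Z1, h, Z2) \<in> Smono \<Lambda> \<C>" and Y: "(Y1, g, Y2) \<in> Smono \<Lambda> \<C>"
    and p: "(p1, p2) \<in> Hhom \<Lambda> (Z1, h, Z2) (Y1, g, Y2)"
    and s1: "s1 \<in> rhom \<Lambda> Y1 Z1" "\<forall>y\<in>carrier Y1. p1 (s1 y) = y"
    and s3: "s3 \<in> rhom \<Lambda> (cok g Y1 Y2) (cok h Z1 Z2)"
      "\<forall>c\<in>carrier (cok g Y1 Y2). cok_map p2 g Y1 Y2 (s3 c) = c"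
    by (rule scw_deflation_cases[OF d]) simp
  note \<phi>D = HhomD[OF \<phi>] and pD = HhomD[OF p] and ZD = SmonoD[OF Z] and YD = SmonoD[OF Y]
  note rZ1 = ZD(7) and rZ2 = ZD(8) and rY1 = YD(7) and rY2 = YD(8)
  interpret Z1: right_module \<Lambda> Z1 by (rule rZ1)
  interpret Z2: right_module \<Lambda> Z2 by (rule rZ2)
  interpret Y2: right_module \<Lambda> Y2 by (rule rY2)
  obtain \<psi> where \<psi>: "\<psi> \<in> rhom \<Lambda> F Z2" "\<forall>t\<in>carrier F. p2 (\<psi> t) \<ominus>\<^bsub>Y2\<^esub> \<phi>2 t \<in> g ` carrier Y1"
    "\<forall>t\<in>carrier F. \<phi>2 t \<in> g ` carrier Y1 \<longrightarrow> \<psi> t \<in> h ` carrier Z1"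
    by (rule cokernel_lift[OF Z Y p s3 F \<phi>D(2)])
  have "\<exists>\<delta>\<in>rhom \<Lambda> F Y1. \<forall>t\<in>carrier F. g (\<delta> t) = p2 (\<psi> t) \<ominus>\<^bsub>Y2\<^esub> \<phi>2 t"
    by (rule mono_lift[OF rY1 YD(5,6) Y2.rhom_minus_map[OF rhom_comp[OF pD(2) \<psi>(1)] \<phi>D(2)]]) (use \<psi>(2) in simp)
  then obtain \<delta> where \<delta>: "\<delta> \<in> rhom \<Lambda> F Y1" "\<forall>t\<in>carrier F. g (\<delta> t) = p2 (\<psi> t) \<ominus>\<^bsub>Y2\<^esub> \<phi>2 t" ..
  let ?\<psi>2 = "\<lambda>t. \<psi> t \<ominus>\<^bsub>Z2\<^esub> h (s1 (\<delta> t))"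
  have \<psi>2: "?\<psi>2 \<in> rhom \<Lambda> F Z2"
    by (rule Z2.rhom_minus_map[OF \<psi>(1) rhom_comp[OF ZD(5) rhom_comp[OF s1(1) \<delta>(1)]]])
  have p\<psi>2: "p2 (?\<psi>2 t) = \<phi>2 t" if t: "t \<in> carrier F" for t
  proof -
    note dt = rhom_closed[OF \<delta>(1) t] and pt = rhom_closed[OF \<psi>(1) t] and ft = rhom_closed[OF \<phi>D(2) t]
    note sdt = rhom_closed[OF s1(1) dt]
    note ppt = rhom_closed[OF pD(2) pt]
    have "p2 (?\<psi>2 t) = p2 (\<psi> t) \<ominus>\<^bsub>Y2\<^esub> (p2 (\<psi> t) \<ominus>\<^bsub>Y2\<^esub> \<phi>2 t)"
      using rhom_minus[OF rZ2 rY2 pD(2) pt rhom_closed[OF ZD(5) sdt]] pD(3)[OF sdt] s1(2) dt \<delta>(2) t by simp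
    also have "\<dots> = \<phi>2 t" using ppt ft by (simp add: a_minus_def Y2.M.minus_add Y2.M.r_neg1 Y2.M.r_neg2)
    finally show ?thesis .
  qed
  \<comment> \<open>On \<open>K\<close> the lift has values in \<open>Im h\<close>, which yields the first component.\<close>
  have KF: "k \<in> carrier F" if "k \<in> K" for k using rsubmoduleD(1)[OF K] that by auto
  have "\<exists>\<psi>1\<in>rhom \<Lambda> (F\<lparr>carrier := K\<rparr>) Z1. \<forall>t\<in>carrier (F\<lparr>carrier := K\<rparr>). h (\<psi>1 t) = ?\<psi>2 t"
  proof (rule mono_lift[OF rZ1 ZD(5,6) rhom_restrict[OF \<psi>2 rsubmoduleD(1)[OF K]]])
    fix t assume "t \<in> carrier (F\<lparr>carrier := K\<rparr>)"
    then have t: "t \<in> K" "t \<in> carrier F" using KF by auto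
    have "\<phi>2 t \<in> g ` carrier Y1" using \<phi>D(3)[of t] t(1) rhom_closed[OF \<phi>D(1), of t] by simp
    then have "\<psi> t \<in> h ` carrier Z1" using \<psi>(3) t(2) by simp
    moreover have "h (s1 (\<delta> t)) \<in> h ` carrier Z1"
      using rhom_closed[OF s1(1) rhom_closed[OF \<delta>(1) t(2)]] by simp
    ultimately show "?\<psi>2 t \<in> h ` carrier Z1"
      unfolding a_minus_def using rsubmoduleD(3,5)[OF rsubmodule_image[OF rZ1 rZ2 ZD(5)]] by simp
  qed
  then obtain \<psi>1 where \<psi>1: "\<psi>1 \<in> rhom \<Lambda> (F\<lparr>carrier := K\<rparr>) Z1"
    "\<forall>t\<in>carrier (F\<lparr>carrier := K\<rparr>). h (\<psi>1 t) = ?\<psi>2 t" ..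
  have "(\<psi>1, ?\<psi>2) \<in> Hhom \<Lambda> (F\<lparr>carrier := K\<rparr>, id, F) (Z1, h, Z2)"
    by (rule HhomI[OF \<psi>1(1) \<psi>2]) (use \<psi>1(2) in simp)
  moreover have "p1 (\<psi>1 t) = \<phi>1 t" if t: "t \<in> carrier (F\<lparr>carrier := K\<rparr>)" for t
  proof -
    note t1 = rhom_closed[OF \<psi>1(1) t]
    have "g (p1 (\<psi>1 t)) = p2 (?\<psi>2 t)" using pD(3)[OF t1] \<psi>1(2) t by simp
    also have "\<dots> = \<phi>2 t" using p\<psi>2 KF t by simp
    also have "\<dots> = g (\<phi>1 t)" using \<phi>D(3)[OF t] by simp
    finally show ?thesis using YD(6) rhom_closed[OF pD(1) t1] rhom_closed[OF \<phi>D(1) t] by (simp add: inj_on_eq_iff)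
  qed
  ultimately show "\<exists>\<psi>1 \<psi>2. (\<psi>1, \<psi>2) \<in> Hhom \<Lambda> (F\<lparr>carrier := K\<rparr>, id, F) (Z1, h, Z2) \<and>
       (\<forall>x\<in>carrier (F\<lparr>carrier := K\<rparr>). p1 (\<psi>1 x) = \<phi>1 x) \<and> (\<forall>x\<in>carrier F. p2 (\<psi>2 x) = \<phi>2 x)"
    using p\<psi>2 by (intro exI[of _ \<psi>1] exI[of _ ?\<psi>2] conjI ballI)
qed

lemma copair_unique:
  assumes M: "right_module \<Lambda> M" and N: "right_module \<Lambda> N" and L: "right_module \<Lambda> L"
    and k: "k \<in> rhom \<Lambda> (dsum M N) L" and z: "x \<in> carrier M" "y \<in> carrier N"
  shows "k (x, \<zero>\<^bsub>N\<^esub>) \<oplus>\<^bsub>L\<^esub> k (\<zero>\<^bsub>M\<^esub>, y) = k (x, y)"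
proof -
  interpret M: right_module \<Lambda> M by (rule M)
  interpret N: right_module \<Lambda> N by (rule N)
  show ?thesis using rhom_add[OF k, of "(x, \<zero>\<^bsub>N\<^esub>)" "(\<zero>\<^bsub>M\<^esub>, y)"] z by simp
qed

lemma scw_lifts_Hdsum:
  assumes A: "right_module \<Lambda> A" and B: "right_module \<Lambda> B" and A': "right_module \<Lambda> A'" and B': "right_module \<Lambda> B'"
    and f: "f \<in> rhom \<Lambda> A B" and f': "f' \<in> rhom \<Lambda> A' B'"
    and P: "scw_lifts \<Lambda> \<C> (A, f, B)" and P': "scw_lifts \<Lambda> \<C> (A', f', B')"
  shows "scw_lifts \<Lambda> \<C> (Hdsum (A, f, B) (A', f', B'))"
  unfolding Hdsum.simps
proof (rule scw_liftsI)
  fix Z1 h Z2 p1 p2 Y1 g Y2 \<phi>1 \<phi>2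
  assume d: "scw_deflation \<Lambda> \<C> (Z1, h, Z2) (p1, p2) (Y1, g, Y2)"
    and \<phi>: "(\<phi>1, \<phi>2) \<in> Hhom \<Lambda> (dsum A A', map_prod f f', dsum B B') (Y1, g, Y2)"
  obtain Z: "(Z1, h, Z2) \<in> Smono \<Lambda> \<C>" and Y: "(Y1, g, Y2) \<in> Smono \<Lambda> \<C>"
    and p: "(p1, p2) \<in> Hhom \<Lambda> (Z1, h, Z2) (Y1, g, Y2)"
    by (rule scw_deflation_cases[OF d]) simp
  note \<phi>D = HhomD[OF \<phi>] and pD = HhomD[OF p] and ZD = SmonoD[OF Z] and YD = SmonoD[OF Y]
  note rZ1 = ZD(7) and rZ2 = ZD(8) and rY1 = YD(7) and rY2 = YD(8)
  interpret A: right_module \<Lambda> A by (rule A)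
  interpret A': right_module \<Lambda> A' by (rule A')
  have inl: "(\<lambda>x. (x, \<zero>\<^bsub>A'\<^esub>), \<lambda>x. (x, \<zero>\<^bsub>B'\<^esub>)) \<in> Hhom \<Lambda> (A, f, B) (dsum A A', map_prod f f', dsum B B')"
    by (rule HhomI[OF rhom_inl[OF A'] rhom_inl[OF B']]) (simp add: rhom_zero[OF A' B' f'])
  have inr: "(\<lambda>x. (\<zero>\<^bsub>A\<^esub>, x), \<lambda>x. (\<zero>\<^bsub>B\<^esub>, x)) \<in> Hhom \<Lambda> (A', f', B') (dsum A A', map_prod f f', dsum B B')"
    by (rule HhomI[OF rhom_inr[OF A] rhom_inr[OF B]]) (simp add: rhom_zero[OF A B f])
  obtain \<psi>1 \<psi>2 where \<psi>: "(\<psi>1, \<psi>2) \<in> Hhom \<Lambda> (A, f, B) (Z1, h, Z2)"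
    "\<forall>x\<in>carrier A. p1 (\<psi>1 x) = \<phi>1 (x, \<zero>\<^bsub>A'\<^esub>)" "\<forall>x\<in>carrier B. p2 (\<psi>2 x) = \<phi>2 (x, \<zero>\<^bsub>B'\<^esub>)"
    by (rule scw_liftsE[OF P d Hhom_comp[OF inl \<phi>]])
  obtain \<chi>1 \<chi>2 where \<chi>: "(\<chi>1, \<chi>2) \<in> Hhom \<Lambda> (A', f', B') (Z1, h, Z2)"
    "\<forall>x\<in>carrier A'. p1 (\<chi>1 x) = \<phi>1 (\<zero>\<^bsub>A\<^esub>, x)" "\<forall>x\<in>carrier B'. p2 (\<chi>2 x) = \<phi>2 (\<zero>\<^bsub>B\<^esub>, x)"
    by (rule scw_liftsE[OF P' d Hhom_comp[OF inr \<phi>]])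
  note \<psi>D = HhomD[OF \<psi>(1)] and \<chi>D = HhomD[OF \<chi>(1)]
  let ?k1 = "\<lambda>z. \<psi>1 (fst z) \<oplus>\<^bsub>Z1\<^esub> \<chi>1 (snd z)" and ?k2 = "\<lambda>z. \<psi>2 (fst z) \<oplus>\<^bsub>Z2\<^esub> \<chi>2 (snd z)"
  have k: "(?k1, ?k2) \<in> Hhom \<Lambda> (dsum A A', map_prod f f', dsum B B') (Z1, h, Z2)"
    by (rule HhomI[OF rhom_copair[OF rZ1 \<psi>D(1) \<chi>D(1)] rhom_copair[OF rZ2 \<psi>D(2) \<chi>D(2)]])
      (auto simp: \<psi>D(3) \<chi>D(3) rhom_add[OF ZD(5)] rhom_closed[OF \<psi>D(1)] rhom_closed[OF \<chi>D(1)])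
  have 1: "p1 (?k1 z) = \<phi>1 z" if zz: "z \<in> carrier (dsum A A')" for z
  proof -
    obtain x y where z: "z = (x, y)" "x \<in> carrier A" "y \<in> carrier A'" using zz by auto
    show ?thesis
      using z \<psi>(2) \<chi>(2) copair_unique[OF A A' rY1 \<phi>D(1) z(2,3)]
      by (simp add: rhom_add[OF pD(1)] rhom_closed[OF \<psi>D(1)] rhom_closed[OF \<chi>D(1)])
  qed
  have 2: "p2 (?k2 z) = \<phi>2 z" if zz: "z \<in> carrier (dsum B B')" for z
  proof -
    obtain x y where z: "z = (x, y)" "x \<in> carrier B" "y \<in> carrier B'" using zz by auto
    show ?thesis
      using z \<psi>(3) \<chi>(3) copair_unique[OF B B' rY2 \<phi>D(2) z(2,3)]
      by (simp add: rhom_add[OF pD(2)] rhom_closed[OF \<psi>D(2)] rhom_closed[OF \<chi>D(2)])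
  qed
  show "\<exists>\<psi>1 \<psi>2. (\<psi>1, \<psi>2) \<in> Hhom \<Lambda> (dsum A A', map_prod f f', dsum B B') (Z1, h, Z2) \<and>
       (\<forall>x\<in>carrier (dsum A A'). p1 (\<psi>1 x) = \<phi>1 x) \<and> (\<forall>x\<in>carrier (dsum B B'). p2 (\<psi>2 x) = \<phi>2 x)"
    using k 1 2 by (intro exI[of _ ?k1] exI[of _ ?k2] conjI ballI)
qed

lemma scw_lifts_Hiso:
  assumes "Hiso \<Lambda> (A, f, B) (A', f', B')" and P: "scw_lifts \<Lambda> \<C> (A', f', B')"
  shows "scw_lifts \<Lambda> \<C> (A, f, B)"
proof (rule scw_liftsI)
  fix Z1 h Z2 p1 p2 Y1 g Y2 \<phi>1 \<phi>2
  assume d: "scw_deflation \<Lambda> \<C> (Z1, h, Z2) (p1, p2) (Y1, g, Y2)"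
    and \<phi>: "(\<phi>1, \<phi>2) \<in> Hhom \<Lambda> (A, f, B) (Y1, g, Y2)"
  obtain a b a' b' where 1: "(a, b) \<in> Hhom \<Lambda> (A, f, B) (A', f', B')"
    "(a', b') \<in> Hhom \<Lambda> (A', f', B') (A, f, B)"
    "\<forall>x\<in>carrier A. a' (a x) = x" "\<forall>x\<in>carrier B. b' (b x) = x"
    "\<forall>x\<in>carrier A'. a (a' x) = x" "\<forall>x\<in>carrier B'. b (b' x) = x" by (rule HisoE[OF assms(1)])
  obtain \<psi>1 \<psi>2 where \<psi>: "(\<psi>1, \<psi>2) \<in> Hhom \<Lambda> (A', f', B') (Z1, h, Z2)"
    "\<forall>x\<in>carrier A'. p1 (\<psi>1 x) = \<phi>1 (a' x)" "\<forall>x\<in>carrier B'. p2 (\<psi>2 x) = \<phi>2 (b' x)"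
    by (rule scw_liftsE[OF P d Hhom_comp[OF 1(2) \<phi>]])
  show "\<exists>\<psi>1 \<psi>2. (\<psi>1, \<psi>2) \<in> Hhom \<Lambda> (A, f, B) (Z1, h, Z2) \<and>
       (\<forall>x\<in>carrier A. p1 (\<psi>1 x) = \<phi>1 x) \<and> (\<forall>x\<in>carrier B. p2 (\<psi>2 x) = \<phi>2 x)"
    using Hhom_comp[OF 1(1) \<psi>(1)] \<psi>(2,3) 1(3,4) rhom_closed[OF HhomD(1)[OF 1(1)]] rhom_closed[OF HhomD(2)[OF 1(1)]]
    by (intro exI[of _ "\<lambda>x. \<psi>1 (a x)"] exI[of _ "\<lambda>x. \<psi>2 (b x)"] conjI ballI) simp_all
qed

section \<open>Enough projectives\<close>

text \<open>Direct sums live over product types, whereas the objects of \<open>\<S>\<^sub>\<X>\<close> live over the universal type; this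
  provides the isomorphic copy.\<close>

lemma Smono_represented:
  assumes C: "resolving \<Lambda> \<C>" and A: "fg_rmodule \<Lambda> A" "in_sub \<Lambda> \<C> A" and B: "fg_rmodule \<Lambda> B" "in_sub \<Lambda> \<C> B"
    and f: "f \<in> rhom \<Lambda> A B" "inj_on f (carrier A)"
    and D: "right_module \<Lambda> D" "in_sub \<Lambda> \<C> D" and r: "r \<in> rhom \<Lambda> B D" "r ` carrier B = carrier D"
    and ker: "\<forall>x\<in>carrier B. r x = \<zero>\<^bsub>D\<^esub> \<longleftrightarrow> x \<in> f ` carrier A"
  obtains A' f' B' where "(A', f', B') \<in> Smono \<Lambda> \<C>" "Hiso \<Lambda> (A, f, B) (A', f', B')"
proof -
  note rA = fg_rmodule_right[OF A(1)] and rB = fg_rmodule_right[OF B(1)]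
  obtain A' where A': "A' \<in> \<C>" "riso \<Lambda> A A'" using A(2) unfolding in_sub_def by (elim bexE)
  obtain B' where B': "B' \<in> \<C>" "riso \<Lambda> B B'" using B(2) unfolding in_sub_def by (elim bexE)
  obtain a where a: "a \<in> rhom \<Lambda> A A'" "bij_betw a (carrier A) (carrier A')" using A'(2) unfolding riso_def by (elim bexE)
  obtain b where b: "b \<in> rhom \<Lambda> B B'" "bij_betw b (carrier B) (carrier B')" using B'(2) unfolding riso_def by (elim bexE)
  let ?a = "inv_into (carrier A) a" and ?b = "inv_into (carrier B) b"
  note ia = rhom_inv_into[OF rA a] and ib = rhom_inv_into[OF rB b]
  have aa: "?a (a x) = x" if "x \<in> carrier A" for x by (rule bij_betw_inv_into_left[OF a(2) that])
  have bb: "?b (b x) = x" if "x \<in> carrier B" for x by (rule bij_betw_inv_into_left[OF b(2) that])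
  have bb': "b (?b y) = y" if "y \<in> carrier B'" for y by (rule bij_betw_inv_into_right[OF b(2) that])
  have ina: "?a ` carrier A' = carrier A" using bij_betw_inv_into[OF a(2)] by (simp add: bij_betw_def)
  have inb: "?b ` carrier B' = carrier B" using bij_betw_inv_into[OF b(2)] by (simp add: bij_betw_def)
  let ?f = "\<lambda>x. b (f (?a x))"
  have f': "?f \<in> rhom \<Lambda> A' B'" by (rule rhom_comp[OF b(1) rhom_comp[OF f(1) ia]])
  have f'img: "?f ` carrier A' = b ` f ` carrier A"
  proof -
    have "?f ` carrier A' = b ` f ` ?a ` carrier A'" by (simp only: image_image)
    then show ?thesis by (simp only: ina)
  qed
  have "(A', ?f, B') \<in> Smono \<Lambda> \<C>"
  proof (rule SmonoI[where r = "\<lambda>y. r (?b y)" and f = ?f, OF C A'(1) B'(1) f' _ D])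
    show "(\<lambda>y. r (?b y)) \<in> rhom \<Lambda> B' D" by (rule rhom_comp[OF r(1) ib])
    show "inj_on ?f (carrier A')"
    proof (rule inj_onI)
      fix x y assume xy: "x \<in> carrier A'" "y \<in> carrier A'" "?f x = ?f y"
      note x = rhom_closed[OF ia xy(1)] and y = rhom_closed[OF ia xy(2)]
      have "f (?a x) = f (?a y)"
        using inj_onD[OF bij_betw_imp_inj_on[OF b(2)] xy(3) rhom_closed[OF f(1) x] rhom_closed[OF f(1) y]] .
      then have "?a x = ?a y" by (rule inj_onD[OF f(2) _ x y])
      then have "a (?a x) = a (?a y)" by (rule arg_cong)
      then show "x = y" by (simp only: bij_betw_inv_into_right[OF a(2)] xy(1,2))
    qed
    show "(\<lambda>x. r (?b x)) ` carrier B' = carrier D"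
    proof -
      have "(\<lambda>x. r (?b x)) ` carrier B' = r ` ?b ` carrier B'" by (simp only: image_image)
      then show ?thesis by (simp only: inb r(2))
    qed
    show "\<forall>y\<in>carrier B'. r (?b y) = \<zero>\<^bsub>D\<^esub> \<longleftrightarrow> y \<in> ?f ` carrier A'"
    proof
      fix y assume y: "y \<in> carrier B'"
      have "r (?b y) = \<zero>\<^bsub>D\<^esub> \<longleftrightarrow> ?b y \<in> f ` carrier A" using ker rhom_closed[OF ib y] by simp
      also have "\<dots> \<longleftrightarrow> y \<in> b ` f ` carrier A"
      proof
        assume "?b y \<in> f ` carrier A"
        then have "b (?b y) \<in> b ` f ` carrier A" by (rule imageI)
        then show "y \<in> b ` f ` carrier A" using bb'[OF y] by simp
      next
        assume "y \<in> b ` f ` carrier A"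
        then obtain z where z: "z \<in> carrier A" "y = b (f z)" by auto
        then show "?b y \<in> f ` carrier A" using bb[OF rhom_closed[OF f(1) z(1)]] by simp
      qed
      finally show "r (?b y) = \<zero>\<^bsub>D\<^esub> \<longleftrightarrow> y \<in> ?f ` carrier A'" unfolding f'img .
    qed
  qed
  moreover have "Hiso \<Lambda> (A, f, B) (A', ?f, B')"
    by (rule Hiso_bij[OF rA rB HhomI[OF a(1) b(1)] f(1) a(2) b(2)]) (simp add: aa)
  ultimately show ?thesis by (rule that)
qed

lemma cok_map_rhom:
  assumes A: "right_module \<Lambda> A" and B: "fg_rmodule \<Lambda> B" and f: "f \<in> rhom \<Lambda> A B"
    and A': "right_module \<Lambda> A'" and B': "fg_rmodule \<Lambda> B'" and f': "f' \<in> rhom \<Lambda> A' B'"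
    and \<beta>: "\<beta> \<in> rhom \<Lambda> B B'" and \<beta>f: "\<And>x. x \<in> carrier A \<Longrightarrow> \<beta> (f x) \<in> f' ` carrier A'"
  shows "cok_map \<beta> f' A' B' \<in> rhom \<Lambda> (cok f A B) (cok f' A' B')"
proof -
  obtain q where q: "q = (\<lambda>x. f ` carrier A +>\<^bsub>B\<^esub> x)" "q \<in> rhom \<Lambda> B (cok f A B)"
    "q ` carrier B = carrier (cok f A B)"
    "\<forall>x\<in>carrier B. q x = \<zero>\<^bsub>cok f A B\<^esub> \<longleftrightarrow> x \<in> f ` carrier A" by (rule cok_proj[OF A B f])
  obtain q' where q': "q' = (\<lambda>x. f' ` carrier A' +>\<^bsub>B'\<^esub> x)" "q' \<in> rhom \<Lambda> B' (cok f' A' B')"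
    "q' ` carrier B' = carrier (cok f' A' B')"
    "\<forall>x\<in>carrier B'. q' x = \<zero>\<^bsub>cok f' A' B'\<^esub> \<longleftrightarrow> x \<in> f' ` carrier A'" by (rule cok_proj[OF A' B' f'])
  note cA = fg_rmodule_right[OF cok_fg(1)[OF A B f]] and cA' = fg_rmodule_right[OF cok_fg(1)[OF A' B' f']]
  have cm: "cok_map \<beta> f' A' B' (q x) = q' (\<beta> x)" if "x \<in> carrier B" for x
    unfolding q(1) q'(1) by (rule cok_map_proj[OF A B f A' B' f' \<beta> \<beta>f that])
  have "\<exists>s\<in>rhom \<Lambda> (cok f A B) (cok f' A' B'). \<forall>x\<in>carrier B. s (q x) = q' (\<beta> x)"
  proof (rule rhom_factor[OF fg_rmodule_right[OF B] cA cA' q(2,3) rhom_comp[OF q'(2) \<beta>]])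
    fix x assume x: "x \<in> carrier B" "q x = \<zero>\<^bsub>cok f A B\<^esub>"
    then obtain z where z: "z \<in> carrier A" "x = f z" using q(4) by auto
    then have "\<beta> x \<in> f' ` carrier A'" using \<beta>f by simp
    then show "q' (\<beta> x) = \<zero>\<^bsub>cok f' A' B'\<^esub>" using q'(4) rhom_closed[OF \<beta> x(1)] by simp
  qed
  then obtain s where s: "s \<in> rhom \<Lambda> (cok f A B) (cok f' A' B')" "\<forall>x\<in>carrier B. s (q x) = q' (\<beta> x)" ..
  show ?thesis
  proof (rule rhom_cong[OF s(1) cA])
    fix c assume "c \<in> carrier (cok f A B)"
    then obtain x where x: "x \<in> carrier B" "c = q x" using q(3) by auto
    then show "s c = cok_map \<beta> f' A' B' c" using cm s(2) by simp
  qed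
qed

text \<open>By the snake lemma the componentwise kernel has as its cokernel the kernel of the induced epimorphism
  of cokernels. All three modules are kernels of epimorphisms in the resolving subcategory and therefore
  belong to it.\<close>

lemma scw_deflationI:
  assumes C: "resolving \<Lambda> \<C>" and Z: "(Z1, h, Z2) \<in> Smono \<Lambda> \<C>" and Y: "(Y1, g, Y2) \<in> Smono \<Lambda> \<C>"
    and p: "(p1, p2) \<in> Hhom \<Lambda> (Z1, h, Z2) (Y1, g, Y2)"
    and s1: "s1 \<in> rhom \<Lambda> Y1 Z1" "\<forall>y\<in>carrier Y1. p1 (s1 y) = y"
    and s2: "s2 \<in> rhom \<Lambda> Y2 Z2" "\<forall>y\<in>carrier Y2. p2 (s2 y) = y"
    and s3: "s3 \<in> rhom \<Lambda> (cok g Y1 Y2) (cok h Z1 Z2)"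
      "\<forall>c\<in>carrier (cok g Y1 Y2). cok_map p2 g Y1 Y2 (s3 c) = c"
  shows "scw_deflation \<Lambda> \<C> (Z1, h, Z2) (p1, p2) (Y1, g, Y2)"
proof -
  note pD = HhomD[OF p] and ZD = SmonoD[OF Z] and YD = SmonoD[OF Y]
  note rZ1 = ZD(7) and rZ2 = ZD(8) and rY1 = YD(7) and rY2 = YD(8)
  interpret Z1: right_module \<Lambda> Z1 by (rule rZ1)
  interpret Z2: right_module \<Lambda> Z2 by (rule rZ2)
  interpret Y1: right_module \<Lambda> Y1 by (rule rY1)
  interpret Y2: right_module \<Lambda> Y2 by (rule rY2)
  have surj1: "p1 ` carrier Z1 = carrier Y1"
  proof (intro equalityI subsetI)
    fix y assume y: "y \<in> carrier Y1"
    then have "p1 (s1 y) \<in> p1 ` carrier Z1" using rhom_closed[OF s1(1)] by simp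
    then show "y \<in> p1 ` carrier Z1" using s1(2) y by simp
  qed (use rhom_closed[OF pD(1)] in auto)
  have surj2: "p2 ` carrier Z2 = carrier Y2"
  proof (intro equalityI subsetI)
    fix y assume y: "y \<in> carrier Y2"
    then have "p2 (s2 y) \<in> p2 ` carrier Z2" using rhom_closed[OF s2(1)] by simp
    then show "y \<in> p2 ` carrier Z2" using s2(2) y by simp
  qed (use rhom_closed[OF pD(2)] in auto)
  define U1 where "U1 = ker_rmodule p1 Z1 Y1"
  define U2 where "U2 = ker_rmodule p2 Z2 Y2"
  have cU1: "carrier U1 = {x \<in> carrier Z1. p1 x = \<zero>\<^bsub>Y1\<^esub>}" by (simp add: U1_def)
  have cU2: "carrier U2 = {x \<in> carrier Z2. p2 x = \<zero>\<^bsub>Y2\<^esub>}" by (simp add: U2_def)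
  have U: "U1 \<in> \<C>" "U2 \<in> \<C>" unfolding U1_def U2_def
    by (rule resolving_kernel[OF C ZD(1) YD(1) pD(1) surj1], rule resolving_kernel[OF C ZD(2) YD(2) pD(2) surj2])
  note fU1 = resolving_fgmod[OF C U(1)] and fU2 = resolving_fgmod[OF C U(2)]
  have i1: "id \<in> rhom \<Lambda> U1 Z1" by (rule rhomI) (simp_all add: U1_def)
  have i2: "id \<in> rhom \<Lambda> U2 Z2" by (rule rhomI) (simp_all add: U2_def)
  have hU: "h u \<in> carrier U2" if "u \<in> carrier U1" for u
    using that pD(3)[of u] rhom_closed[OF ZD(5), of u] rhom_zero[OF rY1 rY2 YD(5)] by (simp add: cU1 cU2)
  have h: "h \<in> rhom \<Lambda> U1 U2"
    by (rule rhomI[OF hU]) (simp_all add: U1_def U2_def rhom_add[OF ZD(5)] rhom_act[OF ZD(5)])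
  have injh: "inj_on h (carrier U1)" using ZD(6) by (rule inj_on_subset) (auto simp: cU1)
  have snake_inj: "u \<in> h ` carrier U1" if u: "u \<in> carrier U2" and im: "u \<in> h ` carrier Z1" for u
  proof -
    obtain z where z: "z \<in> carrier Z1" "u = h z" using im by auto
    then have "g (p1 z) = g \<zero>\<^bsub>Y1\<^esub>" using pD(3)[OF z(1)] u rhom_zero[OF rY1 rY2 YD(5)] by (simp add: cU2)
    then have "p1 z = \<zero>\<^bsub>Y1\<^esub>" using inj_on_eq_iff[OF YD(6) rhom_closed[OF pD(1) z(1)] Y1.M.zero_closed] by simp
    then show ?thesis using z by (simp add: cU1)
  qed
  have snake_ex: "\<exists>u\<in>carrier U2. \<exists>w\<in>carrier Z1. z = u \<oplus>\<^bsub>Z2\<^esub> h w"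
    if z: "z \<in> carrier Z2" and im: "p2 z \<in> g ` carrier Y1" for z
  proof -
    obtain y where y: "y \<in> carrier Y1" "p2 z = g y" using im by auto
    obtain w where w: "w \<in> carrier Z1" "y = p1 w" using y(1) surj1 by auto
    note hw = rhom_closed[OF ZD(5) w(1)]
    have "p2 (z \<ominus>\<^bsub>Z2\<^esub> h w) = \<zero>\<^bsub>Y2\<^esub>"
      using rhom_minus[OF rZ2 rY2 pD(2) z hw] pD(3)[OF w(1)] w y rhom_closed[OF YD(5) y(1)] by (simp add: Y2.eq_iff_minus)
    then have "z \<ominus>\<^bsub>Z2\<^esub> h w \<in> carrier U2" using z hw by (simp add: cU2)
    moreover have "z = (z \<ominus>\<^bsub>Z2\<^esub> h w) \<oplus>\<^bsub>Z2\<^esub> h w" using z hw by simp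
    ultimately show ?thesis using w(1) by blast
  qed
  have US: "(U1, h, U2) \<in> Smono \<Lambda> \<C>"
  proof -
    obtain D r where D: "D \<in> \<C>" "r \<in> rhom \<Lambda> Z2 D" "r ` carrier Z2 = carrier D"
      "\<forall>x\<in>carrier Z2. r x = \<zero>\<^bsub>D\<^esub> \<longleftrightarrow> x \<in> h ` carrier Z1" by (rule Smono_cok[OF C Z])
    obtain D' r' where D': "D' \<in> \<C>" "r' \<in> rhom \<Lambda> Y2 D'" "r' ` carrier Y2 = carrier D'"
      "\<forall>x\<in>carrier Y2. r' x = \<zero>\<^bsub>D'\<^esub> \<longleftrightarrow> x \<in> g ` carrier Y1" by (rule Smono_cok[OF C Y])
    note rD = resolving_right_module[OF C D(1)] and rD' = resolving_right_module[OF C D'(1)]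
    interpret D: right_module \<Lambda> D by (rule rD)
    have "\<exists>m\<in>rhom \<Lambda> D D'. \<forall>x\<in>carrier Z2. m (r x) = r' (p2 x)"
    proof (rule rhom_factor[OF rZ2 rD rD' D(2,3) rhom_comp[OF D'(2) pD(2)]])
      fix x assume x: "x \<in> carrier Z2" "r x = \<zero>\<^bsub>D\<^esub>"
      then obtain z where z: "z \<in> carrier Z1" "x = h z" using D(4) by auto
      then have "p2 x \<in> g ` carrier Y1" using pD(3)[OF z(1)] rhom_closed[OF pD(1) z(1)] by simp
      then show "r' (p2 x) = \<zero>\<^bsub>D'\<^esub>" using D'(4) rhom_closed[OF pD(2) x(1)] by simp
    qed
    then obtain m where m: "m \<in> rhom \<Lambda> D D'" "\<forall>x\<in>carrier Z2. m (r x) = r' (p2 x)" ..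
    have msurj: "m ` carrier D = carrier D'"
    proof -
      have "m ` r ` carrier Z2 = r' ` p2 ` carrier Z2" using m(2) by (simp add: image_image)
      then show ?thesis using D(3) D'(3) surj2 by simp
    qed
    let ?K = "ker_rmodule m D D'"
    have K: "?K \<in> \<C>" by (rule resolving_kernel[OF C D(1) D'(1) m(1) msurj])
    have rU: "r u \<in> carrier ?K" if "u \<in> carrier U2" for u
      using that m(2) rhom_closed[OF D(2), of u] rhom_zero[OF rY2 rD' D'(2)] by (simp add: cU2)
    show ?thesis
    proof (rule SmonoI[OF C U h injh resolving_right_module[OF C K] in_subI[OF K]])
      show "r \<in> rhom \<Lambda> U2 ?K"
        by (rule rhomI[OF rU]) (simp_all add: U2_def rhom_add[OF D(2)] rhom_act[OF D(2)])
      show "r ` carrier U2 = carrier ?K"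
      proof (intro equalityI subsetI)
        fix d assume "d \<in> carrier ?K"
        then have d: "d \<in> carrier D" "m d = \<zero>\<^bsub>D'\<^esub>" by simp_all
        obtain z where z: "z \<in> carrier Z2" "d = r z" using d(1) D(3) by auto
        have "p2 z \<in> g ` carrier Y1" using d(2) z m(2) D'(4) rhom_closed[OF pD(2) z(1)] by simp
        then obtain u w where uw: "u \<in> carrier U2" "w \<in> carrier Z1" "z = u \<oplus>\<^bsub>Z2\<^esub> h w"
          using snake_ex[OF z(1)] by blast
        note hw = rhom_closed[OF ZD(5) uw(2)]
        have u: "u \<in> carrier Z2" using uw(1) by (simp add: cU2)
        have "r (h w) = \<zero>\<^bsub>D\<^esub>" using D(4) hw uw(2) by simp
        then have "d = r u" using rhom_add[OF D(2) u hw] uw(3) z(2) rhom_closed[OF D(2) u] by simp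
        then show "d \<in> r ` carrier U2" using uw(1) by simp
      qed (use rU in auto)
      show "\<forall>x\<in>carrier U2. r x = \<zero>\<^bsub>?K\<^esub> \<longleftrightarrow> x \<in> h ` carrier U1"
      proof
        fix x assume x: "x \<in> carrier U2"
        have "r x = \<zero>\<^bsub>?K\<^esub> \<longleftrightarrow> x \<in> h ` carrier Z1" using D(4) x by (simp add: cU2)
        also have "\<dots> \<longleftrightarrow> x \<in> h ` carrier U1" using snake_inj[OF x] by (auto simp: cU1)
        finally show "r x = \<zero>\<^bsub>?K\<^esub> \<longleftrightarrow> x \<in> h ` carrier U1" .
      qed
    qed
  qed
  have iH: "(id, id) \<in> Hhom \<Lambda> (U1, h, U2) (Z1, h, Z2)" by (rule HhomI[OF i1 i2]) simp
  have sp1: "split_exact \<Lambda> U1 id Z1 p1 Y1"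
    unfolding split_exact_def short_exact_def
    using i1 pD(1) surj1 s1 by (intro conjI bexI[of _ s1]) (auto simp: cU1 a_kernel_iff)
  have sp2: "split_exact \<Lambda> U2 id Z2 p2 Y2"
    unfolding split_exact_def short_exact_def
    using i2 pD(2) surj2 s2 by (intro conjI bexI[of _ s2]) (auto simp: cU2 a_kernel_iff)
  note mU1 = fgmodD(2)[OF fU1] and mU2 = fgmodD(1)[OF fU2]
  note gZ2 = ZD(9) and gY2 = YD(9)
  obtain qU where qU: "qU = (\<lambda>x. h ` carrier U1 +>\<^bsub>U2\<^esub> x)" "qU \<in> rhom \<Lambda> U2 (cok h U1 U2)"
    "qU ` carrier U2 = carrier (cok h U1 U2)"
    "\<forall>x\<in>carrier U2. qU x = \<zero>\<^bsub>cok h U1 U2\<^esub> \<longleftrightarrow> x \<in> h ` carrier U1" by (rule cok_proj[OF mU1 mU2 h])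
  obtain qZ where qZ: "qZ = (\<lambda>x. h ` carrier Z1 +>\<^bsub>Z2\<^esub> x)" "qZ \<in> rhom \<Lambda> Z2 (cok h Z1 Z2)"
    "qZ ` carrier Z2 = carrier (cok h Z1 Z2)"
    "\<forall>x\<in>carrier Z2. qZ x = \<zero>\<^bsub>cok h Z1 Z2\<^esub> \<longleftrightarrow> x \<in> h ` carrier Z1" by (rule cok_proj[OF rZ1 gZ2 ZD(5)])
  obtain qY where qY: "qY = (\<lambda>x. g ` carrier Y1 +>\<^bsub>Y2\<^esub> x)" "qY \<in> rhom \<Lambda> Y2 (cok g Y1 Y2)"
    "qY ` carrier Y2 = carrier (cok g Y1 Y2)"
    "\<forall>x\<in>carrier Y2. qY x = \<zero>\<^bsub>cok g Y1 Y2\<^esub> \<longleftrightarrow> x \<in> g ` carrier Y1" by (rule cok_proj[OF rY1 gY2 YD(5)])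
  note cU = fg_rmodule_right[OF cok_fg(1)[OF mU1 mU2 h]] and cZ = fg_rmodule_right[OF cok_fg(1)[OF rZ1 gZ2 ZD(5)]]
    and cY = fg_rmodule_right[OF cok_fg(1)[OF rY1 gY2 YD(5)]]
  interpret cZ: right_module \<Lambda> "cok h Z1 Z2" by (rule cZ)
  let ?i = "cok_map id h Z1 Z2" and ?p = "cok_map p2 g Y1 Y2"
  have ih: "id (h x) \<in> h ` carrier Z1" if "x \<in> carrier U1" for x using that by (simp add: cU1)
  have ph: "p2 (h x) \<in> g ` carrier Y1" if "x \<in> carrier Z1" for x
    using pD(3)[OF that] rhom_closed[OF pD(1) that] by simp
  have iq: "?i (qU x) = qZ x" if "x \<in> carrier U2" for x
    unfolding qU(1) qZ(1) using cok_map_proj[where \<beta> = id and f = h, OF mU1 mU2 h rZ1 gZ2 ZD(5) i2 ih that] by (simp only: id_apply)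
  have pq: "?p (qZ x) = qY (p2 x)" if "x \<in> carrier Z2" for x
    unfolding qZ(1) qY(1) by (rule cok_map_proj[OF rZ1 gZ2 ZD(5) rY1 gY2 YD(5) pD(2) ph that])
  have ci: "?i \<in> rhom \<Lambda> (cok h U1 U2) (cok h Z1 Z2)"
    by (rule cok_map_rhom[where \<beta> = id and f = h, OF mU1 mU2 h rZ1 gZ2 ZD(5) i2 ih])
  have cp: "?p \<in> rhom \<Lambda> (cok h Z1 Z2) (cok g Y1 Y2)"
    by (rule cok_map_rhom[OF rZ1 gZ2 ZD(5) rY1 gY2 YD(5) pD(2) ph])
  have U2Z: "u \<in> carrier Z2" if "u \<in> carrier U2" for u using that by (simp add: cU2)
  have inj3: "inj_on ?i (carrier (cok h U1 U2))"
    unfolding rhom_inj_iff[OF cU cZ ci]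
  proof (intro ballI impI)
    fix c assume c: "c \<in> carrier (cok h U1 U2)" "?i c = \<zero>\<^bsub>cok h Z1 Z2\<^esub>"
    obtain u where u: "u \<in> carrier U2" "c = qU u" using c(1) qU(3) by auto
    then have "u \<in> h ` carrier Z1" using c(2) iq[OF u(1)] qZ(4) U2Z[OF u(1)] by simp
    then show "c = \<zero>\<^bsub>cok h U1 U2\<^esub>" using snake_inj[OF u(1)] u qU(4) by simp
  qed
  have ex3: "?i ` carrier (cok h U1 U2) = a_kernel (cok h Z1 Z2) (cok g Y1 Y2) ?p"
  proof (intro equalityI subsetI)
    fix c assume "c \<in> ?i ` carrier (cok h U1 U2)"
    then obtain u where u: "u \<in> carrier U2" "c = qZ u" using iq unfolding qU(3)[symmetric] by auto
    then have "?p c = qY \<zero>\<^bsub>Y2\<^esub>" using pq[OF U2Z[OF u(1)]] by (simp add: cU2)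
    then show "c \<in> a_kernel (cok h Z1 Z2) (cok g Y1 Y2) ?p"
      using u rhom_zero[OF rY2 cY qY(2)] rhom_closed[OF qZ(2) U2Z[OF u(1)]] by (simp add: a_kernel_iff)
  next
    fix c assume "c \<in> a_kernel (cok h Z1 Z2) (cok g Y1 Y2) ?p"
    then have c: "c \<in> carrier (cok h Z1 Z2)" "?p c = \<zero>\<^bsub>cok g Y1 Y2\<^esub>" by (simp_all add: a_kernel_iff)
    obtain z where z: "z \<in> carrier Z2" "c = qZ z" using c(1) qZ(3) by auto
    then have "p2 z \<in> g ` carrier Y1" using c(2) pq[OF z(1)] qY(4) rhom_closed[OF pD(2) z(1)] by simp
    then obtain u w where uw: "u \<in> carrier U2" "w \<in> carrier Z1" "z = u \<oplus>\<^bsub>Z2\<^esub> h w"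
      using snake_ex[OF z(1)] by blast
    note hw = rhom_closed[OF ZD(5) uw(2)]
    have "qZ (h w) = \<zero>\<^bsub>cok h Z1 Z2\<^esub>" using qZ(4) hw uw(2) by simp
    then have "c = qZ u"
      using rhom_add[OF qZ(2) U2Z[OF uw(1)] hw] uw(3) z(2) rhom_closed[OF qZ(2) U2Z[OF uw(1)]] by simp
    then have "c = ?i (qU u)" using iq[OF uw(1)] by simp
    then show "c \<in> ?i ` carrier (cok h U1 U2)" using rhom_closed[OF qU(2) uw(1)] by simp
  qed
  have surj3: "?p ` carrier (cok h Z1 Z2) = carrier (cok g Y1 Y2)"
  proof (intro equalityI subsetI)
    fix c assume c: "c \<in> carrier (cok g Y1 Y2)"
    then have "?p (s3 c) \<in> ?p ` carrier (cok h Z1 Z2)" using rhom_closed[OF s3(1)] by simp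
    then show "c \<in> ?p ` carrier (cok h Z1 Z2)" using s3(2) c by simp
  qed (use rhom_closed[OF cp] in auto)
  have sp3: "split_exact \<Lambda> (cok h U1 U2) ?i (cok h Z1 Z2) ?p (cok g Y1 Y2)"
    unfolding split_exact_def short_exact_def
    using ci cp inj3 ex3 surj3 s3 by (intro conjI bexI[of _ s3])
  have "((U1, h, U2), (id, id), (Z1, h, Z2), (p1, p2), (Y1, g, Y2)) \<in> Escw \<Lambda> \<C>"
    unfolding Escw_def mem_Collect_eq
    using US Z Y iH p sp1 sp2 sp3
    by - (rule exI[of _ U1], rule exI[of _ h], rule exI[of _ U2], rule exI[of _ id], rule exI[of _ id],
        rule exI[of _ Z1], rule exI[of _ h], rule exI[of _ Z2], rule exI[of _ p1], rule exI[of _ p2],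
        rule exI[of _ Y1], rule exI[of _ g], rule exI[of _ Y2], intro conjI refl)
  then show ?thesis unfolding scw_deflation_def by (intro exI)
qed


text \<open>The object \<open>(Y\<^sub>1 = Y\<^sub>1) \<oplus> (0 \<rightarrow> Y\<^sub>2) \<oplus> (K \<rightarrow> F)\<close>, where \<open>\<rho> : F \<rightarrow> Y\<^sub>2\<close> and \<open>K\<close> is the kernel of the
  composite of \<open>\<rho>\<close> with the projection \<open>Y\<^sub>2 \<rightarrow> Cok g\<close>.\<close>

definition cover_object where
  "cover_object Y1 g Y2 F \<rho> = Hdsum (Hdsum (Y1, id, Y1) (zero_sub Y2, id, Y2))
     (F\<lparr>carrier := {t \<in> carrier F. \<rho> t \<in> g ` carrier Y1}\<rparr>, id, F)"

text \<open>The second component of the map from this object to \<open>(Y\<^sub>1 \<rightarrow> Y\<^sub>2)\<close>; it determines the first.\<close>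

definition cover_map where
  "cover_map g Y2 \<rho> = (\<lambda>z. (g (fst (fst z)) \<oplus>\<^bsub>Y2\<^esub> snd (fst z)) \<oplus>\<^bsub>Y2\<^esub> \<rho> (snd z))"

text \<open>Each of the three summands supplies one of the three required sections: \<open>(Y\<^sub>1 = Y\<^sub>1)\<close> splits the
  first components, \<open>(0 \<rightarrow> Y\<^sub>2)\<close> the second ones, and \<open>(K \<rightarrow> F)\<close> the cokernels, because \<open>\<rho>\<close> identifies \<open>F/K\<close>
  with \<open>Cok g\<close>. The object \<open>(Z1, h, Z2)\<close> is an isomorphic copy of the sum.\<close>

lemma cover_deflation:
  assumes C: "resolving \<Lambda> \<C>" and Y: "(Y1, g, Y2) \<in> Smono \<Lambda> \<C>"
  obtains F \<rho> p1 Z1 h Z2 \<alpha> \<beta> where "F \<in> prj \<Lambda>" "\<rho> \<in> rhom \<Lambda> F Y2"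
    "(p1, cover_map g Y2 \<rho>) \<in> Hhom \<Lambda> (cover_object Y1 g Y2 F \<rho>) (Y1, g, Y2)"
    "scw_lifts \<Lambda> \<C> (Z1, h, Z2)"
    "(\<alpha>, \<beta>) \<in> Hhom \<Lambda> (Z1, h, Z2) (cover_object Y1 g Y2 F \<rho>)"
    "scw_deflation \<Lambda> \<C> (Z1, h, Z2) (\<lambda>x. p1 (\<alpha> x), \<lambda>x. cover_map g Y2 \<rho> (\<beta> x)) (Y1, g, Y2)"
proof -
  note YD = SmonoD[OF Y]
  note rY1 = YD(7) and rY2 = YD(8) and gY2 = YD(9)
  interpret Y1: right_module \<Lambda> Y1 by (rule rY1)
  interpret Y2: right_module \<Lambda> Y2 by (rule rY2)
  obtain F \<rho> where F: "F \<in> prj \<Lambda>" and \<rho>: "\<rho> \<in> rhom \<Lambda> F Y2" "\<rho> ` carrier F = carrier Y2"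
    by (rule prj_cover[OF YD(4)])
  note rF = fgmodD(2)[OF prj_fgmod[OF F]]
  interpret F: right_module \<Lambda> F by (rule rF)
  obtain D r where D: "D \<in> \<C>" "r \<in> rhom \<Lambda> Y2 D" "r ` carrier Y2 = carrier D"
    "\<forall>x\<in>carrier Y2. r x = \<zero>\<^bsub>D\<^esub> \<longleftrightarrow> x \<in> g ` carrier Y1" by (rule Smono_cok[OF C Y])
  note rD = resolving_right_module[OF C D(1)]
  have r\<rho>: "(\<lambda>t. r (\<rho> t)) \<in> rhom \<Lambda> F D" by (rule rhom_comp[OF D(2) \<rho>(1)])
  have r\<rho>s: "(\<lambda>t. r (\<rho> t)) ` carrier F = carrier D"
  proof -
    have "(\<lambda>t. r (\<rho> t)) ` carrier F = r ` \<rho> ` carrier F" by (simp only: image_image)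
    then show ?thesis by (simp only: \<rho>(2) D(3))
  qed
  let ?K = "{t \<in> carrier F. \<rho> t \<in> g ` carrier Y1}"
  let ?KM = "F\<lparr>carrier := ?K\<rparr>"
  have Kker: "?K = a_kernel F D (\<lambda>t. r (\<rho> t))"
    by (rule Set.set_eqI) (simp add: a_kernel_iff D(4) rhom_closed[OF \<rho>(1)] cong: conj_cong)
  have K: "?KM \<in> \<C>"
    using resolving_kernel[OF C resolving_prj[OF C F] D(1) r\<rho> r\<rho>s] unfolding ker_rmodule_def Kker .
  have Ks: "rsubmodule \<Lambda> F ?K" unfolding Kker by (rule rsubmodule_a_kernel[OF rF rD r\<rho>])
  note rK = resolving_right_module[OF C K]
  have z0: "zero_sub Y2 \<in> \<C>"
  proof -
    have "a_kernel Y2 Y2 id = {\<zero>\<^bsub>Y2\<^esub>}" by (rule Set.set_eqI) (auto simp: a_kernel_iff)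
    then have "ker_rmodule id Y2 Y2 = zero_sub Y2" by (simp add: ker_rmodule_def zero_sub_def)
    then show ?thesis using resolving_kernel[OF C YD(2) YD(2) rhom_id(1)] by simp
  qed
  let ?A = "dsum (dsum Y1 (zero_sub Y2)) ?KM" and ?B = "dsum (dsum Y1 Y2) F"
  let ?Q = "cover_object Y1 g Y2 F \<rho>" and ?p = "cover_map g Y2 \<rho>"
  have Q: "?Q = (?A, map_prod (map_prod id id) id, ?B)" by (simp add: cover_object_def)
  have fg0: "fg_rmodule \<Lambda> (zero_sub Y2)" and fgK: "fg_rmodule \<Lambda> ?KM" and fgF: "fg_rmodule \<Lambda> F" and fgY1: "fg_rmodule \<Lambda> Y1"
    using fgmodD(1)[OF resolving_fgmod[OF C z0]] fgmodD(1)[OF resolving_fgmod[OF C K]]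
      fgmodD(1)[OF prj_fgmod[OF F]] fgmodD(1)[OF YD(3)] by simp_all
  note r0 = fg_rmodule_right[OF fg0]
  have fgA: "fg_rmodule \<Lambda> ?A" and fgB: "fg_rmodule \<Lambda> ?B"
    by (intro dsum_fg fgY1 fg0 fgK gY2 fgF)+
  have inA: "in_sub \<Lambda> \<C> ?A" and inB: "in_sub \<Lambda> \<C> ?B"
    by (intro resolving_dsum[OF C] in_subI YD(1,2) z0 K resolving_prj[OF C F])+
  have id0: "id \<in> rhom \<Lambda> (zero_sub Y2) Y2" by (rule rhomI) auto
  have idK: "id \<in> rhom \<Lambda> ?KM F" by (rule rhomI) auto
  have f: "map_prod (map_prod id id) id \<in> rhom \<Lambda> ?A ?B"
    by (intro rhom_map_prod rhom_id(1) id0 idK)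
  have injf: "inj_on (map_prod (map_prod id id) id) (carrier ?A)"
    by (simp add: prod.map_id0)
  have p: "?p \<in> rhom \<Lambda> ?B Y2"
    unfolding cover_map_def
    by (rule Y2.rhom_add_map[OF Y2.rhom_add_map[OF rhom_comp[OF YD(5) rhom_comp[OF rhom_fst rhom_fst]]
        rhom_comp[OF rhom_snd rhom_fst]] rhom_comp[OF \<rho>(1) rhom_snd]])
  have pval: "?p ((y, w), t) = (g y \<oplus>\<^bsub>Y2\<^esub> w) \<oplus>\<^bsub>Y2\<^esub> \<rho> t" for y w t by (simp add: cover_map_def)
  have g0: "g \<zero>\<^bsub>Y1\<^esub> = \<zero>\<^bsub>Y2\<^esub>" and \<rho>0: "\<rho> \<zero>\<^bsub>F\<^esub> = \<zero>\<^bsub>Y2\<^esub>"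
    using rhom_zero[OF rY1 rY2 YD(5)] rhom_zero[OF rF rY2 \<rho>(1)] by simp_all
  \<comment> \<open>The first component of the map is forced, since \<open>g\<close> is a monomorphism.\<close>
  have "\<exists>p1\<in>rhom \<Lambda> ?A Y1. \<forall>z\<in>carrier ?A. g (p1 z) = ?p (map_prod (map_prod id id) id z)"
  proof (rule mono_lift[OF rY1 YD(5,6) rhom_comp[OF p f]])
    fix z assume "z \<in> carrier ?A"
    then obtain y t where z: "z = ((y, \<zero>\<^bsub>Y2\<^esub>), t)" "y \<in> carrier Y1" "t \<in> carrier F" "\<rho> t \<in> g ` carrier Y1" by auto
    have "g y \<oplus>\<^bsub>Y2\<^esub> \<rho> t \<in> g ` carrier Y1"
      using z rsubmoduleD(3)[OF rsubmodule_image[OF rY1 rY2 YD(5)]] by simp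
    then show "?p (map_prod (map_prod id id) id z) \<in> g ` carrier Y1"
      using z rhom_closed[OF YD(5) z(2)] by (simp add: pval)
  qed
  then obtain p1 where p1: "p1 \<in> rhom \<Lambda> ?A Y1"
    "\<forall>z\<in>carrier ?A. g (p1 z) = ?p (map_prod (map_prod id id) id z)" ..
  have pH: "(p1, ?p) \<in> Hhom \<Lambda> ?Q (Y1, g, Y2)" unfolding Q by (rule HhomI[OF p1(1) p]) (rule bspec[OF p1(2), THEN sym])
  have Qlifts: "scw_lifts \<Lambda> \<C> ?Q"
  proof -
    have "scw_lifts \<Lambda> \<C> (Hdsum (Y1, id, Y1) (zero_sub Y2, id, Y2))"
      by (rule scw_lifts_Hdsum[OF rY1 rY1 r0 rY2 rhom_id(1) id0 scw_lifts_identity scw_lifts_zero[OF rY2]])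
    then show ?thesis
      unfolding cover_object_def Hdsum.simps(1)[of Y1]
      by (rule scw_lifts_Hdsum[OF dsum_right_module[OF rY1 r0] dsum_right_module[OF rY1 rY2] rK rF
          rhom_map_prod[OF rhom_id(1) id0] idK _ scw_lifts_kernel[OF F Ks]])
  qed
  \<comment> \<open>The cokernel of the sum is \<open>Y2 \<oplus> Cok g\<close>.\<close>
  let ?r = "\<lambda>z. (snd (fst z), r (\<rho> (snd z)))"
  have rQ: "?r \<in> rhom \<Lambda> ?B (dsum Y2 D)"
    by (rule rhom_Pair[OF rhom_comp[OF rhom_snd rhom_fst] rhom_comp[OF r\<rho> rhom_snd]])
  have rQs: "?r ` carrier ?B = carrier (dsum Y2 D)"
  proof (intro equalityI subsetI)
    fix x assume "x \<in> carrier (dsum Y2 D)"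
    then obtain w d where x: "x = (w, d)" "w \<in> carrier Y2" "d \<in> carrier D" by auto
    then obtain t where t: "t \<in> carrier F" "d = r (\<rho> t)" using r\<rho>s by auto
    then have "x = ?r ((\<zero>\<^bsub>Y1\<^esub>, w), t)" using x by simp
    moreover have "((\<zero>\<^bsub>Y1\<^esub>, w), t) \<in> carrier ?B" using x t by simp
    ultimately show "x \<in> ?r ` carrier ?B" by (rule image_eqI)
  qed (use rhom_closed[OF rQ] in blast)
  have rQk: "\<forall>z\<in>carrier ?B. ?r z = \<zero>\<^bsub>dsum Y2 D\<^esub> \<longleftrightarrow> z \<in> map_prod (map_prod id id) id ` carrier ?A"
  proof
    fix z assume "z \<in> carrier ?B"
    then obtain y w t where z: "z = ((y, w), t)" "y \<in> carrier Y1" "w \<in> carrier Y2" "t \<in> carrier F" by auto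
    have "?r z = \<zero>\<^bsub>dsum Y2 D\<^esub> \<longleftrightarrow> w = \<zero>\<^bsub>Y2\<^esub> \<and> \<rho> t \<in> g ` carrier Y1"
      using z D(4) rhom_closed[OF \<rho>(1) z(4)] by simp
    also have "\<dots> \<longleftrightarrow> z \<in> carrier ?A" using z by auto
    finally show "?r z = \<zero>\<^bsub>dsum Y2 D\<^esub> \<longleftrightarrow> z \<in> map_prod (map_prod id id) id ` carrier ?A"
      by (simp add: prod.map_id0)
  qed
  obtain Z1 h Z2 where Z: "(Z1, h, Z2) \<in> Smono \<Lambda> \<C>" and iso: "Hiso \<Lambda> (?A, map_prod (map_prod id id) id, ?B) (Z1, h, Z2)"
    by (rule Smono_represented[OF C fgA inA fgB inB f injf dsum_right_module[OF rY2 rD]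
          resolving_dsum[OF C in_subI[OF YD(2)] in_subI[OF D(1)]] rQ rQs rQk])
  obtain \<alpha>' \<beta>' \<alpha> \<beta> where i': "(\<alpha>', \<beta>') \<in> Hhom \<Lambda> (?A, map_prod (map_prod id id) id, ?B) (Z1, h, Z2)"
    and i: "(\<alpha>, \<beta>) \<in> Hhom \<Lambda> (Z1, h, Z2) (?A, map_prod (map_prod id id) id, ?B)"
    and ii: "\<forall>x\<in>carrier ?A. \<alpha> (\<alpha>' x) = x" "\<forall>x\<in>carrier ?B. \<beta> (\<beta>' x) = x"
    by (rule HisoE[OF iso])
  note i'D = HhomD[OF i'] and iD = HhomD[OF i] and ZD = SmonoD[OF Z]
  note rZ1 = ZD(7) and rZ2 = ZD(8) and gZ2 = ZD(9)
  have Zlifts: "scw_lifts \<Lambda> \<C> (Z1, h, Z2)"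
    by (rule scw_lifts_Hiso[OF Hiso_sym[OF iso] Qlifts[unfolded Q]])
  let ?p1 = "\<lambda>x. p1 (\<alpha> x)" and ?p2 = "\<lambda>x. ?p (\<beta> x)"
  have PH: "(?p1, ?p2) \<in> Hhom \<Lambda> (Z1, h, Z2) (Y1, g, Y2)"
    by (rule Hhom_comp[OF i pH[unfolded Q]])
  note PD = HhomD[OF PH]
  have inl: "(\<lambda>y. ((y, \<zero>\<^bsub>Y2\<^esub>), \<zero>\<^bsub>F\<^esub>)) \<in> rhom \<Lambda> Y1 ?A"
    using rhom_comp[OF rhom_inl[OF rK] rhom_inl[OF r0]] by simp
  have s1: "(\<lambda>y. \<alpha>' ((y, \<zero>\<^bsub>Y2\<^esub>), \<zero>\<^bsub>F\<^esub>)) \<in> rhom \<Lambda> Y1 Z1" by (rule rhom_comp[OF i'D(1) inl])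
  have s1': "\<forall>y\<in>carrier Y1. ?p1 (\<alpha>' ((y, \<zero>\<^bsub>Y2\<^esub>), \<zero>\<^bsub>F\<^esub>)) = y"
  proof
    fix y assume y: "y \<in> carrier Y1"
    note c = rhom_closed[OF inl y]
    have "g (p1 ((y, \<zero>\<^bsub>Y2\<^esub>), \<zero>\<^bsub>F\<^esub>)) = g y"
      using bspec[OF p1(2) c] rhom_closed[OF YD(5) y] by (simp add: pval \<rho>0)
    then have "p1 ((y, \<zero>\<^bsub>Y2\<^esub>), \<zero>\<^bsub>F\<^esub>) = y" using inj_onD[OF YD(6) _ rhom_closed[OF p1(1) c] y] by simp
    then show "?p1 (\<alpha>' ((y, \<zero>\<^bsub>Y2\<^esub>), \<zero>\<^bsub>F\<^esub>)) = y" using bspec[OF ii(1) c] by simp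
  qed
  have inm: "(\<lambda>w. ((\<zero>\<^bsub>Y1\<^esub>, w), \<zero>\<^bsub>F\<^esub>)) \<in> rhom \<Lambda> Y2 ?B"
    by (rule rhom_comp[OF rhom_inl[OF rF] rhom_inr[OF rY1]])
  have s2: "(\<lambda>w. \<beta>' ((\<zero>\<^bsub>Y1\<^esub>, w), \<zero>\<^bsub>F\<^esub>)) \<in> rhom \<Lambda> Y2 Z2" by (rule rhom_comp[OF i'D(2) inm])
  have s2': "\<forall>w\<in>carrier Y2. ?p2 (\<beta>' ((\<zero>\<^bsub>Y1\<^esub>, w), \<zero>\<^bsub>F\<^esub>)) = w"
    using ii(2) rhom_closed[OF inm] by (simp add: pval g0 \<rho>0)
  obtain qZ where qZ: "qZ = (\<lambda>x. h ` carrier Z1 +>\<^bsub>Z2\<^esub> x)" "qZ \<in> rhom \<Lambda> Z2 (cok h Z1 Z2)"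
    "qZ ` carrier Z2 = carrier (cok h Z1 Z2)"
    "\<forall>x\<in>carrier Z2. qZ x = \<zero>\<^bsub>cok h Z1 Z2\<^esub> \<longleftrightarrow> x \<in> h ` carrier Z1" by (rule cok_proj[OF rZ1 gZ2 ZD(5)])
  obtain qY where qY: "qY = (\<lambda>x. g ` carrier Y1 +>\<^bsub>Y2\<^esub> x)" "qY \<in> rhom \<Lambda> Y2 (cok g Y1 Y2)"
    "qY ` carrier Y2 = carrier (cok g Y1 Y2)"
    "\<forall>x\<in>carrier Y2. qY x = \<zero>\<^bsub>cok g Y1 Y2\<^esub> \<longleftrightarrow> x \<in> g ` carrier Y1" by (rule cok_proj[OF rY1 gY2 YD(5)])
  note cZ = fg_rmodule_right[OF cok_fg(1)[OF rZ1 gZ2 ZD(5)]] and cY = fg_rmodule_right[OF cok_fg(1)[OF rY1 gY2 YD(5)]]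
  have pq: "cok_map ?p2 g Y1 Y2 (qZ x) = qY (?p2 x)" if "x \<in> carrier Z2" for x
    unfolding qZ(1) qY(1)
    by (rule cok_map_proj[OF rZ1 gZ2 ZD(5) rY1 gY2 YD(5) PD(2) _ that])
      (simp only: PD(3) imageI rhom_closed[OF PD(1)])
  have inr: "(\<lambda>t. ((\<zero>\<^bsub>Y1\<^esub>, \<zero>\<^bsub>Y2\<^esub>), t)) \<in> rhom \<Lambda> F ?B"
    using rhom_inr[OF dsum_right_module[OF rY1 rY2]] by simp
  \<comment> \<open>The section \<open>F/K = Cok g \<rightarrow> Cok h\<close> is induced by the inclusion of the summand \<open>F\<close>.\<close>
  let ?k = "\<lambda>t. qZ (\<beta>' ((\<zero>\<^bsub>Y1\<^esub>, \<zero>\<^bsub>Y2\<^esub>), t))"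
  have qr: "(\<lambda>t. qY (\<rho> t)) ` carrier F = carrier (cok g Y1 Y2)"
  proof -
    have "(\<lambda>t. qY (\<rho> t)) ` carrier F = qY ` \<rho> ` carrier F" by (simp only: image_image)
    then show ?thesis by (simp only: \<rho>(2) qY(3))
  qed
  have "\<exists>s\<in>rhom \<Lambda> (cok g Y1 Y2) (cok h Z1 Z2). \<forall>t\<in>carrier F. s (qY (\<rho> t)) = ?k t"
  proof (rule rhom_factor[OF rF cY cZ rhom_comp[OF qY(2) \<rho>(1)] qr rhom_comp[OF qZ(2) rhom_comp[OF i'D(2) inr]]])
    fix t assume t: "t \<in> carrier F" "qY (\<rho> t) = \<zero>\<^bsub>cok g Y1 Y2\<^esub>"
    then have "\<rho> t \<in> g ` carrier Y1" using qY(4) rhom_closed[OF \<rho>(1)] by simp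
    then have tA: "((\<zero>\<^bsub>Y1\<^esub>, \<zero>\<^bsub>Y2\<^esub>), t) \<in> carrier ?A" using t by simp
    have "\<beta>' ((\<zero>\<^bsub>Y1\<^esub>, \<zero>\<^bsub>Y2\<^esub>), t) = h (\<alpha>' ((\<zero>\<^bsub>Y1\<^esub>, \<zero>\<^bsub>Y2\<^esub>), t))" using i'D(3)[OF tA] by simp
    then show "?k t = \<zero>\<^bsub>cok h Z1 Z2\<^esub>"
      using qZ(4) rhom_closed[OF i'D(1) tA] rhom_closed[OF ZD(5)] by simp
  qed
  then obtain s3 where s3: "s3 \<in> rhom \<Lambda> (cok g Y1 Y2) (cok h Z1 Z2)" "\<forall>t\<in>carrier F. s3 (qY (\<rho> t)) = ?k t" ..
  have s3': "\<forall>c\<in>carrier (cok g Y1 Y2). cok_map ?p2 g Y1 Y2 (s3 c) = c"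
  proof
    fix c assume "c \<in> carrier (cok g Y1 Y2)"
    then obtain t where t: "t \<in> carrier F" "c = qY (\<rho> t)" using qr by auto
    note c = rhom_closed[OF inr t(1)]
    have "cok_map ?p2 g Y1 Y2 (s3 c) = qY (?p2 (\<beta>' ((\<zero>\<^bsub>Y1\<^esub>, \<zero>\<^bsub>Y2\<^esub>), t)))"
      using s3(2) t pq[OF rhom_closed[OF i'D(2) c]] by simp
    also have "\<dots> = c" using bspec[OF ii(2) c] t rhom_closed[OF \<rho>(1) t(1)] by (simp add: pval g0)
    finally show "cok_map ?p2 g Y1 Y2 (s3 c) = c" .
  qed
  have defl: "scw_deflation \<Lambda> \<C> (Z1, h, Z2) (?p1, ?p2) (Y1, g, Y2)"
    by (rule scw_deflationI[OF C Z Y PH s1 s1' s2 s2' s3(1) s3'])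
  show ?thesis
    by (rule that[OF F \<rho>(1) pH Zlifts _ defl]) (use i in \<open>simp only: Q\<close>)
qed

lemma enough_projectives:
  assumes C: "resolving \<Lambda> \<C>"
  shows "ex_enough_projectives \<Lambda> (Smono \<Lambda> \<C>) (Escw \<Lambda> \<C>)"
  unfolding ex_enough_projectives_def
proof
  fix Y assume Y: "Y \<in> Smono \<Lambda> \<C>"
  obtain Y1 g Y2 where e: "Y = (Y1, g, Y2)" by (rule prod_cases3)
  obtain F \<rho> p1 Z1 h Z2 \<alpha> \<beta> where "F \<in> prj \<Lambda>" "\<rho> \<in> rhom \<Lambda> F Y2"
    "(p1, cover_map g Y2 \<rho>) \<in> Hhom \<Lambda> (cover_object Y1 g Y2 F \<rho>) (Y1, g, Y2)"
    and lifts: "scw_lifts \<Lambda> \<C> (Z1, h, Z2)"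
    and "(\<alpha>, \<beta>) \<in> Hhom \<Lambda> (Z1, h, Z2) (cover_object Y1 g Y2 F \<rho>)"
    and d: "scw_deflation \<Lambda> \<C> (Z1, h, Z2) (\<lambda>x. p1 (\<alpha> x), \<lambda>x. cover_map g Y2 \<rho> (\<beta> x)) (Y1, g, Y2)"
    by (rule cover_deflation[OF C Y[unfolded e]])
  have "(Z1, h, Z2) \<in> Smono \<Lambda> \<C>" by (rule scw_deflation_cases[OF d]) simp
  then have "ex_projective \<Lambda> (Smono \<Lambda> \<C>) (Escw \<Lambda> \<C>) (Z1, h, Z2)" using lifts by (simp only: ex_projective_iff)
  then show "\<exists>U i P p. (U, i, P, p, Y) \<in> Escw \<Lambda> \<C> \<and> ex_projective \<Lambda> (Smono \<Lambda> \<C>) (Escw \<Lambda> \<C>) P"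
    using d unfolding e scw_deflation_def by (elim exE) (intro exI conjI)
qed

text \<open>The deflation onto a projective object splits. Written out on the second components, the splitting
  expresses the identity as a sum of three endomorphisms which factor through \<open>(A = A)\<close>, \<open>(0 \<rightarrow> B)\<close> and
  \<open>(K \<rightarrow> F)\<close>; the conditions on \<open>b f\<close> and \<open>\<rho> d f\<close> say that they preserve \<open>Im f\<close>.\<close>

lemma projective_identity_decomposition:
  assumes C: "resolving \<Lambda> \<C>" and P: "ex_projective \<Lambda> (Smono \<Lambda> \<C>) (Escw \<Lambda> \<C>) (A, f, B)"
  obtains F \<rho> a b d where "F \<in> prj \<Lambda>" "\<rho> \<in> rhom \<Lambda> F B" "a \<in> rhom \<Lambda> B A" "b \<in> rhom \<Lambda> B B" "d \<in> rhom \<Lambda> B F"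
    "\<forall>x\<in>carrier A. b (f x) = \<zero>\<^bsub>B\<^esub>" "\<forall>x\<in>carrier A. \<rho> (d (f x)) \<in> f ` carrier A"
    "\<forall>y\<in>carrier B. (f (a y) \<oplus>\<^bsub>B\<^esub> b y) \<oplus>\<^bsub>B\<^esub> \<rho> (d y) = y"
proof -
  have Y: "(A, f, B) \<in> Smono \<Lambda> \<C>" and lifts: "scw_lifts \<Lambda> \<C> (A, f, B)" using P by (simp_all only: ex_projective_iff)
  obtain F \<rho> p1 Z1 h Z2 \<alpha> \<beta> where F: "F \<in> prj \<Lambda>" and \<rho>: "\<rho> \<in> rhom \<Lambda> F B"
    and pH: "(p1, cover_map f B \<rho>) \<in> Hhom \<Lambda> (cover_object A f B F \<rho>) (A, f, B)"
    and "scw_lifts \<Lambda> \<C> (Z1, h, Z2)"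
    and i: "(\<alpha>, \<beta>) \<in> Hhom \<Lambda> (Z1, h, Z2) (cover_object A f B F \<rho>)"
    and df: "scw_deflation \<Lambda> \<C> (Z1, h, Z2) (\<lambda>x. p1 (\<alpha> x), \<lambda>x. cover_map f B \<rho> (\<beta> x)) (A, f, B)"
    by (rule cover_deflation[OF C Y])
  have idH: "(\<lambda>x. x, \<lambda>x. x) \<in> Hhom \<Lambda> (A, f, B) (A, f, B)" by (rule HhomI[OF rhom_id(2) rhom_id(2)]) simp
  obtain \<sigma>1 \<sigma>2 where \<sigma>: "(\<sigma>1, \<sigma>2) \<in> Hhom \<Lambda> (A, f, B) (Z1, h, Z2)"
    "\<forall>x\<in>carrier B. cover_map f B \<rho> (\<beta> (\<sigma>2 x)) = x"
    by (rule scw_liftsE[OF lifts df idH])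
  let ?K = "F\<lparr>carrier := {t \<in> carrier F. \<rho> t \<in> f ` carrier A}\<rparr>"
  let ?s = "\<lambda>x. \<beta> (\<sigma>2 x)"
  have sH: "(\<lambda>x. \<alpha> (\<sigma>1 x), ?s) \<in> Hhom \<Lambda> (A, f, B)
      (dsum (dsum A (zero_sub B)) ?K, map_prod (map_prod id id) id, dsum (dsum A B) F)"
    using Hhom_comp[OF \<sigma>(1) i[unfolded cover_object_def Hdsum.simps]] .
  note sD = HhomD[OF sH]
  have sf: "?s (f x) \<in> carrier (dsum (dsum A (zero_sub B)) ?K)" if x: "x \<in> carrier A" for x
    using sD(3)[OF x] rhom_closed[OF sD(1) x] by (simp only: prod.map_id0 id_apply)
  show ?thesis
  proof (rule that[OF F \<rho>])
    show "(\<lambda>y. fst (fst (?s y))) \<in> rhom \<Lambda> B A" by (rule rhom_comp[OF rhom_fst rhom_comp[OF rhom_fst sD(2)]])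
    show "(\<lambda>y. snd (fst (?s y))) \<in> rhom \<Lambda> B B" by (rule rhom_comp[OF rhom_snd rhom_comp[OF rhom_fst sD(2)]])
    show "(\<lambda>y. snd (?s y)) \<in> rhom \<Lambda> B F" by (rule rhom_comp[OF rhom_snd sD(2)])
    show "\<forall>x\<in>carrier A. snd (fst (?s (f x))) = \<zero>\<^bsub>B\<^esub>" using sf by (auto simp: mem_Times_iff)
    show "\<forall>x\<in>carrier A. \<rho> (snd (?s (f x))) \<in> f ` carrier A" using sf by (auto simp: mem_Times_iff)
    show "\<forall>y\<in>carrier B. (f (fst (fst (?s y))) \<oplus>\<^bsub>B\<^esub> snd (fst (?s y))) \<oplus>\<^bsub>B\<^esub> \<rho> (snd (?s y)) = y"
      using \<sigma>(2) by (simp only: cover_map_def)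
  qed
qed

section \<open>Indecomposable projective objects\<close>

text \<open>A decomposition yields the idempotent that projects onto its first summand.\<close>

lemma indecomposableI:
  assumes M: "M \<in> fgmod \<Lambda>" "\<not> zero_rmodule M"
    and idem: "\<And>e. e \<in> rhom \<Lambda> M M \<Longrightarrow> \<forall>x\<in>carrier M. e (e x) = e x \<Longrightarrow>
      (\<forall>x\<in>carrier M. e x = \<zero>\<^bsub>M\<^esub>) \<or> (\<forall>x\<in>carrier M. e x = x)"
  shows "indecomposable \<Lambda> M"
  unfolding indecomposable_def
proof (intro conjI ballI impI M)
  fix A B assume AB: "A \<in> fgmod \<Lambda>" "B \<in> fgmod \<Lambda>" and "riso \<Lambda> M (dsum A B)"
  then obtain \<phi> where \<phi>: "\<phi> \<in> rhom \<Lambda> M (dsum A B)" "bij_betw \<phi> (carrier M) (carrier (dsum A B))"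
    unfolding riso_def by (elim bexE)
  note rM = fgmodD(2)[OF M(1)] and rA = fgmodD(2)[OF AB(1)] and rB = fgmodD(2)[OF AB(2)]
  interpret M: right_module \<Lambda> M by (rule rM)
  interpret A: right_module \<Lambda> A by (rule rA)
  interpret B: right_module \<Lambda> B by (rule rB)
  let ?\<psi> = "inv_into (carrier M) \<phi>"
  note \<psi> = rhom_inv_into[OF rM \<phi>]
  have \<psi>\<phi>: "?\<psi> (\<phi> x) = x" if "x \<in> carrier M" for x by (rule bij_betw_inv_into_left[OF \<phi>(2) that])
  have \<phi>\<psi>: "\<phi> (?\<psi> z) = z" if "z \<in> carrier (dsum A B)" for z by (rule bij_betw_inv_into_right[OF \<phi>(2) that])
  have pr: "(\<lambda>z. (fst z, \<zero>\<^bsub>B\<^esub>)) \<in> rhom \<Lambda> (dsum A B) (dsum A B)" by (rule rhom_comp[OF rhom_inl[OF rB] rhom_fst])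
  define e where "e x = ?\<psi> (fst (\<phi> x), \<zero>\<^bsub>B\<^esub>)" for x
  have e: "e \<in> rhom \<Lambda> M M" unfolding e_def by (rule rhom_comp[OF \<psi> rhom_comp[OF pr \<phi>(1)]])
  have \<phi>e: "\<phi> (e x) = (fst (\<phi> x), \<zero>\<^bsub>B\<^esub>)" if "x \<in> carrier M" for x
    unfolding e_def by (rule \<phi>\<psi>[OF rhom_closed[OF pr rhom_closed[OF \<phi>(1) that]]])
  have ee: "e (e x) = e x" if x: "x \<in> carrier M" for x
  proof -
    have "e (e x) = ?\<psi> (fst (\<phi> (e x)), \<zero>\<^bsub>B\<^esub>)" by (simp only: e_def[of "e x"])
    also have "\<dots> = ?\<psi> (fst (\<phi> x), \<zero>\<^bsub>B\<^esub>)" by (simp only: \<phi>e[OF x] fst_conv)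
    also have "\<dots> = e x" by (simp only: e_def)
    finally show ?thesis .
  qed
  from idem[OF e] ee have "(\<forall>x\<in>carrier M. e x = \<zero>\<^bsub>M\<^esub>) \<or> (\<forall>x\<in>carrier M. e x = x)" by blast
  then show "zero_rmodule A \<or> zero_rmodule B"
  proof
    assume 0: "\<forall>x\<in>carrier M. e x = \<zero>\<^bsub>M\<^esub>"
    have "a = \<zero>\<^bsub>A\<^esub>" if a: "a \<in> carrier A" for a
    proof -
      have c: "(a, \<zero>\<^bsub>B\<^esub>) \<in> carrier (dsum A B)" using a by simp
      have "\<phi> (e (?\<psi> (a, \<zero>\<^bsub>B\<^esub>))) = (a, \<zero>\<^bsub>B\<^esub>)"
        using \<phi>e[OF rhom_closed[OF \<psi> c]] \<phi>\<psi>[OF c] by simp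
      moreover have "e (?\<psi> (a, \<zero>\<^bsub>B\<^esub>)) = \<zero>\<^bsub>M\<^esub>" using 0 rhom_closed[OF \<psi> c] by simp
      ultimately show ?thesis using rhom_zero[OF rM dsum_right_module[OF rA rB] \<phi>(1)] by simp
    qed
    then have "carrier A = {\<zero>\<^bsub>A\<^esub>}" using A.M.zero_closed by blast
    then show ?thesis by (simp add: zero_rmodule_def)
  next
    assume 1: "\<forall>x\<in>carrier M. e x = x"
    have "b = \<zero>\<^bsub>B\<^esub>" if b: "b \<in> carrier B" for b
    proof -
      have c: "(\<zero>\<^bsub>A\<^esub>, b) \<in> carrier (dsum A B)" using b by simp
      have "\<phi> (e (?\<psi> (\<zero>\<^bsub>A\<^esub>, b))) = (\<zero>\<^bsub>A\<^esub>, \<zero>\<^bsub>B\<^esub>)"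
        using \<phi>e[OF rhom_closed[OF \<psi> c]] \<phi>\<psi>[OF c] by simp
      moreover have "e (?\<psi> (\<zero>\<^bsub>A\<^esub>, b)) = ?\<psi> (\<zero>\<^bsub>A\<^esub>, b)" using 1 rhom_closed[OF \<psi> c] by simp
      ultimately show ?thesis using \<phi>\<psi>[OF c] by simp
    qed
    then have "carrier B = {\<zero>\<^bsub>B\<^esub>}" using B.M.zero_closed by blast
    then show ?thesis by (simp add: zero_rmodule_def)
  qed
qed

lemma Smono_zero:
  assumes "(A, f, B) \<in> Smono \<Lambda> \<C>" "zero_rmodule B"
  shows "zero_rmodule A"
proof -
  note SD = SmonoD[OF assms(1)]
  interpret A: right_module \<Lambda> A by (rule SD(7))
  have "x = \<zero>\<^bsub>A\<^esub>" if x: "x \<in> carrier A" for x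
  proof (rule inj_onD[OF SD(6) _ x A.M.zero_closed])
    show "f x = f \<zero>\<^bsub>A\<^esub>"
      using rhom_closed[OF SD(5) x] rhom_closed[OF SD(5) A.M.zero_closed] assms(2) by (simp add: zero_rmodule_def)
  qed
  then show ?thesis using A.M.zero_closed unfolding zero_rmodule_def by blast
qed

lemma Hiso_riso:
  assumes "Hiso \<Lambda> (A, f, B) (A', f', B')"
  shows "riso \<Lambda> B B'"
proof -
  obtain a b a' b' where 1: "(a, b) \<in> Hhom \<Lambda> (A, f, B) (A', f', B')"
    "(a', b') \<in> Hhom \<Lambda> (A', f', B') (A, f, B)"
    "\<forall>x\<in>carrier A. a' (a x) = x" "\<forall>x\<in>carrier B. b' (b x) = x"
    "\<forall>x\<in>carrier A'. a (a' x) = x" "\<forall>x\<in>carrier B'. b (b' x) = x" by (rule HisoE[OF assms])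
  have "bij_betw b (carrier B) (carrier B')"
    using 1(4,6) rhom_closed[OF HhomD(2)[OF 1(1)]] rhom_closed[OF HhomD(2)[OF 1(2)]]
    by (intro bij_betw_byWitness[where f' = b']) auto
  then show ?thesis unfolding riso_def using HhomD(2)[OF 1(1)] by (rule bexI)
qed

text \<open>The three cases of the classification differ only in what the submodule \<open>f ` carrier A\<close> is: all of \<open>B\<close>,
  zero, or the kernel of a projective cover.\<close>

lemma Hiso_inclusion:
  assumes A: "right_module \<Lambda> A" and B: "right_module \<Lambda> B" and f: "f \<in> rhom \<Lambda> A B" "inj_on f (carrier A)"
  shows "Hiso \<Lambda> (A, f, B) (B\<lparr>carrier := f ` carrier A\<rparr>, id, B)"
  by (rule Hiso_bij[OF A B HhomI[OF rhom_into[OF f(1)] rhom_id(1)] f(1)]) (use f(2) in \<open>auto simp: bij_betw_def\<close>)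


subsection \<open>The listed objects are indecomposable\<close>

text \<open>A decomposition of \<open>(A \<rightarrow> B)\<close> decomposes \<open>B\<close>, and a monomorphism into a zero module starts at a zero
  module.\<close>

lemma Hindecomposable_second:
  assumes S: "(A, f, B) \<in> Smono \<Lambda> \<C>" and iso: "riso \<Lambda> B M" and M: "indecomposable \<Lambda> M"
  shows "Hindecomposable \<Lambda> (Smono \<Lambda> \<C>) (A, f, B)"
  unfolding Hindecomposable_def
proof (intro conjI ballI impI S)
  note rB = fgmodD(2)[OF SmonoD(4)[OF S]]
  have Mf: "M \<in> fgmod \<Lambda>" and Mn: "\<not> zero_rmodule M" using M unfolding indecomposable_def by - (elim conjE, assumption)+
  show "\<not> Hzero (A, f, B)" using Mn riso_zero[OF rB fgmodD(2)[OF Mf] iso] by simp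
  fix U W assume UW: "U \<in> Smono \<Lambda> \<C>" "W \<in> Smono \<Lambda> \<C>" and H: "Hiso \<Lambda> (A, f, B) (Hdsum U W)"
  obtain U1 u U2 where U: "U = (U1, u, U2)" by (rule prod_cases3)
  obtain W1 w W2 where W: "W = (W1, w, W2)" by (rule prod_cases3)
  note US = UW(1)[unfolded U] and WS = UW(2)[unfolded W]
  have "riso \<Lambda> B (dsum U2 W2)" by (rule Hiso_riso[OF H[unfolded U W Hdsum.simps]])
  then have "riso \<Lambda> M (dsum U2 W2)" by (rule riso_trans[OF riso_sym[OF rB iso]])
  then have "zero_rmodule U2 \<or> zero_rmodule W2"
    using M SmonoD(4)[OF US] SmonoD(4)[OF WS] unfolding indecomposable_def by blast
  then show "Hzero U \<or> Hzero W" unfolding U W using Smono_zero[OF US] Smono_zero[OF WS] by auto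
qed

text \<open>A summand inside the kernel of a projective cover is zero: its complement \<open>W\<close> together with the kernel
  is everything, and so \<open>W\<close> is everything by minimality.\<close>

lemma cover_summand_zero:
  assumes cov: "projective_cover \<Lambda> P \<pi> M" and U: "right_module \<Lambda> U" and W: "right_module \<Lambda> W"
    and i: "i \<in> rhom \<Lambda> U P" "\<forall>a\<in>carrier U. \<pi> (i a) = \<zero>\<^bsub>M\<^esub>" and j: "j \<in> rhom \<Lambda> W P"
    and sum: "\<forall>x\<in>carrier P. \<exists>a\<in>carrier U. \<exists>b\<in>carrier W. x = j b \<oplus>\<^bsub>P\<^esub> i a"
    and dis: "\<forall>a\<in>carrier U. \<forall>b\<in>carrier W. i a = j b \<longrightarrow> a = \<zero>\<^bsub>U\<^esub>"
  shows "zero_rmodule U"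
proof -
  have P: "P \<in> prj \<Lambda>" and min: "\<forall>N. rsubmodule \<Lambda> P N \<and> N <+>\<^bsub>P\<^esub> a_kernel P M \<pi> = carrier P \<longrightarrow> N = carrier P"
    using cov unfolding projective_cover_def by - (elim conjE, assumption)+
  note rP = fgmodD(2)[OF prj_fgmod[OF P]]
  interpret P: right_module \<Lambda> P by (rule rP)
  interpret U: right_module \<Lambda> U by (rule U)
  have N: "rsubmodule \<Lambda> P (j ` carrier W)" by (rule rsubmodule_image[OF W rP j])
  have "j ` carrier W <+>\<^bsub>P\<^esub> a_kernel P M \<pi> = carrier P"
  proof (intro equalityI subsetI)
    fix x assume "x \<in> carrier P"
    then obtain a b where ab: "a \<in> carrier U" "b \<in> carrier W" "x = j b \<oplus>\<^bsub>P\<^esub> i a" using sum by blast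
    have "i a \<in> a_kernel P M \<pi>" using i rhom_closed[OF i(1) ab(1)] ab(1) by (simp add: a_kernel_iff)
    then show "x \<in> j ` carrier W <+>\<^bsub>P\<^esub> a_kernel P M \<pi>" using ab unfolding set_add_def' by blast
  next
    fix x assume "x \<in> j ` carrier W <+>\<^bsub>P\<^esub> a_kernel P M \<pi>"
    then obtain y k where "y \<in> j ` carrier W" "k \<in> a_kernel P M \<pi>" "x = y \<oplus>\<^bsub>P\<^esub> k" unfolding set_add_def' by blast
    then show "x \<in> carrier P" using rhom_closed[OF j] by (auto simp: a_kernel_iff)
  qed
  with min N have eq: "j ` carrier W = carrier P" by blast
  have "a = \<zero>\<^bsub>U\<^esub>" if a: "a \<in> carrier U" for a
  proof -
    have "i a \<in> j ` carrier W" unfolding eq by (rule rhom_closed[OF i(1) a])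
    then show ?thesis using dis a by auto
  qed
  then show ?thesis using U.M.zero_closed unfolding zero_rmodule_def by blast
qed

text \<open>A decomposition of \<open>(Ker \<pi> \<rightarrow> P)\<close> into \<open>U\<close> and \<open>W\<close> decomposes \<open>M = P / Ker \<pi>\<close> into the cokernels of \<open>U\<close>
  and \<open>W\<close>. One of them vanishes, and then the corresponding summand of \<open>P\<close> lies in \<open>Ker \<pi>\<close>.\<close>

lemma Hindecomposable_cover:
  assumes C: "resolving \<Lambda> \<C>" and S: "(A, f, B) \<in> Smono \<Lambda> \<C>" and M: "indecomposable \<Lambda> M"
    and cov: "projective_cover \<Lambda> P \<pi> M" and iso: "Hiso \<Lambda> (A, f, B) (ker_rmodule \<pi> P M, id, P)"
  shows "Hindecomposable \<Lambda> (Smono \<Lambda> \<C>) (A, f, B)"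
  unfolding Hindecomposable_def
proof (intro conjI ballI impI S)
  note rB = fgmodD(2)[OF SmonoD(4)[OF S]]
  have Mf: "M \<in> fgmod \<Lambda>" and Mn: "\<not> zero_rmodule M" using M unfolding indecomposable_def by - (elim conjE, assumption)+
  have P: "P \<in> prj \<Lambda>" and \<pi>: "\<pi> \<in> rhom \<Lambda> P M" "\<pi> ` carrier P = carrier M"
    using cov unfolding projective_cover_def by - (elim conjE, assumption)+
  note rP = fgmodD(2)[OF prj_fgmod[OF P]] and rM = fgmodD(2)[OF Mf]
  interpret P: right_module \<Lambda> P by (rule rP)
  show "\<not> Hzero (A, f, B)"
  proof
    assume "Hzero (A, f, B)"
    then have "zero_rmodule P" using riso_zero[OF rB rP Hiso_riso[OF iso]] by simp
    then have "carrier M = {\<pi> \<zero>\<^bsub>P\<^esub>}" using \<pi>(2) by (simp add: zero_rmodule_def)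
    then show False using Mn rhom_zero[OF rP rM \<pi>(1)] by (simp add: zero_rmodule_def)
  qed
  fix U W assume UW: "U \<in> Smono \<Lambda> \<C>" "W \<in> Smono \<Lambda> \<C>" and H: "Hiso \<Lambda> (A, f, B) (Hdsum U W)"
  obtain U1 u U2 where U: "U = (U1, u, U2)" by (rule prod_cases3)
  obtain W1 w W2 where W: "W = (W1, w, W2)" by (rule prod_cases3)
  note US = UW(1)[unfolded U] and WS = UW(2)[unfolded W]
  note UD = SmonoD[OF US] and WD = SmonoD[OF WS]
  note rU1 = UD(7) and rU2 = UD(8) and rW1 = WD(7) and rW2 = WD(8)
  interpret U1: right_module \<Lambda> U1 by (rule rU1)
  interpret W1: right_module \<Lambda> W1 by (rule rW1)
  interpret U2: right_module \<Lambda> U2 by (rule rU2)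
  interpret W2: right_module \<Lambda> W2 by (rule rW2)
  let ?K = "ker_rmodule \<pi> P M"
  have cK: "x \<in> carrier ?K \<longleftrightarrow> x \<in> carrier P \<and> \<pi> x = \<zero>\<^bsub>M\<^esub>" for x by (simp add: ker_rmodule_def a_kernel_iff)
  have "Hiso \<Lambda> (?K, id, P) (dsum U1 W1, map_prod u w, dsum U2 W2)"
    by (rule Hiso_trans[OF Hiso_sym[OF iso] H[unfolded U W Hdsum.simps]])
  then obtain \<alpha> \<beta> \<alpha>' \<beta>' where b: "(\<alpha>, \<beta>) \<in> Hhom \<Lambda> (?K, id, P) (dsum U1 W1, map_prod u w, dsum U2 W2)"
    and b': "(\<alpha>', \<beta>') \<in> Hhom \<Lambda> (dsum U1 W1, map_prod u w, dsum U2 W2) (?K, id, P)"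
    and "\<forall>x\<in>carrier ?K. \<alpha>' (\<alpha> x) = x" and bb: "\<forall>x\<in>carrier P. \<beta>' (\<beta> x) = x"
    and "\<forall>x\<in>carrier (dsum U1 W1). \<alpha> (\<alpha>' x) = x" and bb': "\<forall>x\<in>carrier (dsum U2 W2). \<beta> (\<beta>' x) = x"
    by (rule HisoE)
  note bD = HhomD[OF b] and b'D = HhomD[OF b']
  obtain DU rU where DU: "DU \<in> \<C>" "rU \<in> rhom \<Lambda> U2 DU" "rU ` carrier U2 = carrier DU"
    "\<forall>x\<in>carrier U2. rU x = \<zero>\<^bsub>DU\<^esub> \<longleftrightarrow> x \<in> u ` carrier U1" by (rule Smono_cok[OF C US])
  obtain DW rW where DW: "DW \<in> \<C>" "rW \<in> rhom \<Lambda> W2 DW" "rW ` carrier W2 = carrier DW"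
    "\<forall>x\<in>carrier W2. rW x = \<zero>\<^bsub>DW\<^esub> \<longleftrightarrow> x \<in> w ` carrier W1" by (rule Smono_cok[OF C WS])
  note fU = resolving_fgmod[OF C DU(1)] and fW = resolving_fgmod[OF C DW(1)]
  note rD = dsum_right_module[OF fgmodD(2)[OF fU] fgmodD(2)[OF fW]]
  \<comment> \<open>An epimorphism from \<open>P\<close> onto the sum of the cokernels with the same kernel as \<open>\<pi>\<close>.\<close>
  let ?r = "\<lambda>x. map_prod rU rW (\<beta> x)"
  have r: "?r \<in> rhom \<Lambda> P (dsum DU DW)" by (rule rhom_comp[OF rhom_map_prod[OF DU(2) DW(2)] bD(2)])
  have rs: "?r ` carrier P = carrier (dsum DU DW)"
  proof (intro equalityI subsetI)
    fix z assume "z \<in> carrier (dsum DU DW)"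
    then obtain d d' where z: "z = (d, d')" "d \<in> carrier DU" "d' \<in> carrier DW" by auto
    obtain a where a: "a \<in> carrier U2" "d = rU a" using z(2) DU(3) by auto
    obtain a' where a': "a' \<in> carrier W2" "d' = rW a'" using z(3) DW(3) by auto
    have c: "(a, a') \<in> carrier (dsum U2 W2)" using a a' by simp
    have "z = ?r (\<beta>' (a, a'))" using bspec[OF bb' c] a a' z by simp
    then show "z \<in> ?r ` carrier P" using rhom_closed[OF b'D(2) c] by (rule image_eqI)
  qed (use rhom_closed[OF r] in blast)
  have kin: "\<pi> (\<beta>' z) = \<zero>\<^bsub>M\<^esub>" if z: "z \<in> map_prod u w ` carrier (dsum U1 W1)" for z
  proof -
    obtain y where y: "y \<in> carrier (dsum U1 W1)" "z = map_prod u w y" using z by auto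
    have "\<beta>' z = \<alpha>' y" using b'D(3)[OF y(1)] y(2) by simp
    then show ?thesis using rhom_closed[OF b'D(1) y(1)] cK by simp
  qed
  have rk: "?r x = \<zero>\<^bsub>dsum DU DW\<^esub> \<longleftrightarrow> \<pi> x = \<zero>\<^bsub>M\<^esub>" if x: "x \<in> carrier P" for x
  proof
    assume 0: "?r x = \<zero>\<^bsub>dsum DU DW\<^esub>"
    obtain a a' where e: "\<beta> x = (a, a')" by (rule prod.exhaust)
    have aa: "a \<in> carrier U2" "a' \<in> carrier W2" using rhom_closed[OF bD(2) x] e by simp_all
    have "a \<in> u ` carrier U1" "a' \<in> w ` carrier W1" using 0 e DU(4) DW(4) aa by simp_all
    then have "\<beta> x \<in> map_prod u w ` carrier (dsum U1 W1)" unfolding e by auto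
    then show "\<pi> x = \<zero>\<^bsub>M\<^esub>" using kin bb x by force
  next
    assume "\<pi> x = \<zero>\<^bsub>M\<^esub>"
    then have k: "x \<in> carrier ?K" using x cK by simp
    obtain y y' where e: "\<alpha> x = (y, y')" by (rule prod.exhaust)
    have yy: "y \<in> carrier U1" "y' \<in> carrier W1" using rhom_closed[OF bD(1) k] e by simp_all
    have "\<beta> x = (u y, w y')" using bD(3)[OF k] e by simp
    then show "?r x = \<zero>\<^bsub>dsum DU DW\<^esub>"
      using DU(4) DW(4) yy rhom_closed[OF UD(5)] rhom_closed[OF WD(5)] by simp
  qed
  have "\<exists>s\<in>rhom \<Lambda> M (dsum DU DW). \<forall>x\<in>carrier P. s (\<pi> x) = ?r x"
    by (rule rhom_factor[OF rP rM rD \<pi> r]) (simp only: rk)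
  then obtain s where s: "s \<in> rhom \<Lambda> M (dsum DU DW)" "\<forall>x\<in>carrier P. s (\<pi> x) = ?r x" ..
  have "inj_on s (carrier M)"
    unfolding rhom_inj_iff[OF rM rD s(1)]
  proof (intro ballI impI)
    fix m assume m: "m \<in> carrier M" "s m = \<zero>\<^bsub>dsum DU DW\<^esub>"
    obtain x where x: "x \<in> carrier P" "m = \<pi> x" using m(1) \<pi>(2) by auto
    have "?r x = \<zero>\<^bsub>dsum DU DW\<^esub>" using bspec[OF s(2) x(1)] m(2) x(2) by simp
    then show "m = \<zero>\<^bsub>M\<^esub>" using rk[OF x(1)] x(2) by simp
  qed
  moreover have "s ` carrier M = carrier (dsum DU DW)"
  proof -
    have "s ` \<pi> ` carrier P = ?r ` carrier P" unfolding image_image using s(2) by (intro image_cong refl) simp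
    then show ?thesis by (simp only: \<pi>(2) rs)
  qed
  ultimately have "riso \<Lambda> M (dsum DU DW)" unfolding riso_def using s(1) by (intro bexI[of _ s]) (simp_all add: bij_betw_def)
  then have "zero_rmodule DU \<or> zero_rmodule DW" using M fU fW unfolding indecomposable_def by blast
  moreover have inl: "(\<lambda>a. \<beta>' (a, \<zero>\<^bsub>W2\<^esub>)) \<in> rhom \<Lambda> U2 P" and inr: "(\<lambda>a. \<beta>' (\<zero>\<^bsub>U2\<^esub>, a)) \<in> rhom \<Lambda> W2 P"
    by (rule rhom_comp[OF b'D(2) rhom_inl[OF rW2]], rule rhom_comp[OF b'D(2) rhom_inr[OF rU2]])
  have split: "\<exists>a\<in>carrier U2. \<exists>a'\<in>carrier W2. x = \<beta>' (a, \<zero>\<^bsub>W2\<^esub>) \<oplus>\<^bsub>P\<^esub> \<beta>' (\<zero>\<^bsub>U2\<^esub>, a')" if x: "x \<in> carrier P" for x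
  proof -
    obtain a a' where e: "\<beta> x = (a, a')" by (rule prod.exhaust)
    have aa: "a \<in> carrier U2" "a' \<in> carrier W2" using rhom_closed[OF bD(2) x] e by simp_all
    have "x = \<beta>' (a, a')" using bb x e by force
    then show ?thesis using copair_unique[OF rU2 rW2 rP b'D(2) aa] aa by auto
  qed
  have disj: "a = \<zero>\<^bsub>U2\<^esub> \<and> a' = \<zero>\<^bsub>W2\<^esub>"
    if "a \<in> carrier U2" "a' \<in> carrier W2" "\<beta>' (a, \<zero>\<^bsub>W2\<^esub>) = \<beta>' (\<zero>\<^bsub>U2\<^esub>, a')" for a a'
  proof -
    have c: "(a, \<zero>\<^bsub>W2\<^esub>) \<in> carrier (dsum U2 W2)" "(\<zero>\<^bsub>U2\<^esub>, a') \<in> carrier (dsum U2 W2)" using that by simp_all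
    have "(a, \<zero>\<^bsub>W2\<^esub>) = (\<zero>\<^bsub>U2\<^esub>, a')"
      using arg_cong[OF that(3), of \<beta>] unfolding bspec[OF bb' c(1)] bspec[OF bb' c(2)] .
    then show ?thesis by simp
  qed
  have u0: "u \<zero>\<^bsub>U1\<^esub> = \<zero>\<^bsub>U2\<^esub>" and w0: "w \<zero>\<^bsub>W1\<^esub> = \<zero>\<^bsub>W2\<^esub>"
    using rhom_zero[OF rU1 rU2 UD(5)] rhom_zero[OF rW1 rW2 WD(5)] by simp_all
  show "Hzero U \<or> Hzero W"
  proof (rule disjE[OF calculation(1)])
    assume z: "zero_rmodule DU"
    have "\<pi> (\<beta>' (a, \<zero>\<^bsub>W2\<^esub>)) = \<zero>\<^bsub>M\<^esub>" if a: "a \<in> carrier U2" for a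
    proof (rule kin)
      have "a \<in> u ` carrier U1" using DU(4) a rhom_closed[OF DU(2) a] z by (simp add: zero_rmodule_def)
      then obtain a1 where "a1 \<in> carrier U1" "a = u a1" by auto
      then show "(a, \<zero>\<^bsub>W2\<^esub>) \<in> map_prod u w ` carrier (dsum U1 W1)" by (intro image_eqI[of _ _ "(a1, \<zero>\<^bsub>W1\<^esub>)"]) (simp_all add: w0)
    qed
    then have "zero_rmodule U2"
    proof (intro cover_summand_zero[OF cov rU2 rW2 inl _ inr] ballI impI)
      fix x assume "x \<in> carrier P"
      then obtain a a' where "a \<in> carrier U2" "a' \<in> carrier W2" "x = \<beta>' (a, \<zero>\<^bsub>W2\<^esub>) \<oplus>\<^bsub>P\<^esub> \<beta>' (\<zero>\<^bsub>U2\<^esub>, a')" using split by blast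
      then show "\<exists>a\<in>carrier U2. \<exists>b\<in>carrier W2. x = \<beta>' (\<zero>\<^bsub>U2\<^esub>, b) \<oplus>\<^bsub>P\<^esub> \<beta>' (a, \<zero>\<^bsub>W2\<^esub>)"
        using P.M.a_comm[OF rhom_closed[OF inl] rhom_closed[OF inr]] by auto
    qed (use disj in auto)
    then show ?thesis unfolding U using Smono_zero[OF US] by simp
  next
    assume z: "zero_rmodule DW"
    have "\<pi> (\<beta>' (\<zero>\<^bsub>U2\<^esub>, a)) = \<zero>\<^bsub>M\<^esub>" if a: "a \<in> carrier W2" for a
    proof (rule kin)
      have "a \<in> w ` carrier W1" using DW(4) a rhom_closed[OF DW(2) a] z by (simp add: zero_rmodule_def)
      then obtain a1 where "a1 \<in> carrier W1" "a = w a1" by auto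
      then show "(\<zero>\<^bsub>U2\<^esub>, a) \<in> map_prod u w ` carrier (dsum U1 W1)" by (intro image_eqI[of _ _ "(\<zero>\<^bsub>U1\<^esub>, a1)"]) (simp_all add: u0)
    qed
    then have "zero_rmodule W2"
    proof (intro cover_summand_zero[OF cov rW2 rU2 inr _ inl] ballI impI)
      fix x assume "x \<in> carrier P"
      then show "\<exists>a\<in>carrier W2. \<exists>b\<in>carrier U2. x = \<beta>' (b, \<zero>\<^bsub>W2\<^esub>) \<oplus>\<^bsub>P\<^esub> \<beta>' (\<zero>\<^bsub>U2\<^esub>, a)" using split by blast
    next
      fix a b assume "a \<in> carrier W2" "b \<in> carrier U2" "\<beta>' (\<zero>\<^bsub>U2\<^esub>, a) = \<beta>' (b, \<zero>\<^bsub>W2\<^esub>)"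
      then show "a = \<zero>\<^bsub>W2\<^esub>" using disj[of b a] by simp
    qed simp
    then show ?thesis unfolding W using Smono_zero[OF WS] by simp
  qed
qed

subsection \<open>Endomorphisms of indecomposable objects\<close>

definition unit_in :: "('b \<Rightarrow> 'b) set \<Rightarrow> 'b set \<Rightarrow> ('b \<Rightarrow> 'b) \<Rightarrow> bool" where
  "unit_in E B e \<longleftrightarrow> (\<exists>v\<in>E. \<forall>b\<in>B. e (v b) = b \<and> v (e b) = b)"

lemma funpow_zero_inj:
  assumes "(e ^^ n) b = z" "b \<in> B" "\<And>b. b \<in> B \<Longrightarrow> e b \<in> B" "\<And>b. b \<in> B \<Longrightarrow> e b = z \<Longrightarrow> b = z"
  shows "b = z"
  using assms(1,2)
proof (induction n arbitrary: b)
  case (Suc n)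
  have "e b = z" by (rule Suc.IH) (use Suc.prems assms(3) in \<open>simp_all add: funpow_swap1\<close>)
  then show ?case using assms(4) Suc.prems(2) by blast
qed simp

context artin
begin

lemma indecomposable_nonzero:
  assumes "Hindecomposable \<Lambda> (Smono \<Lambda> \<C>) (A, f, B)"
  shows "(A, f, B) \<in> Smono \<Lambda> \<C>" "\<not> zero_rmodule B"
proof -
  show S: "(A, f, B) \<in> Smono \<Lambda> \<C>" using assms by (simp add: Hindecomposable_def)
  have "\<not> Hzero (A, f, B)" using assms by (simp add: Hindecomposable_def)
  then show "\<not> zero_rmodule B" using Smono_zero[OF S] by auto
qed

text \<open>The endomorphism ring is local. If both summands were nilpotent, then \<open>e'\<close> would be injective, since
  \<open>e' b = 0\<close> gives \<open>e b = b\<close> and hence \<open>b = 0\<close>; an injective nilpotent endomorphism forces the object to be zero.\<close>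

lemma sum_one_unit:
  assumes C: "resolving \<Lambda> \<C>" and ind: "Hindecomposable \<Lambda> (Smono \<Lambda> \<C>) (A, f, B)"
    and e: "e \<in> stab_end \<Lambda> B (f ` carrier A)" "e' \<in> stab_end \<Lambda> B (f ` carrier A)"
    and sum: "\<forall>b\<in>carrier B. e b \<oplus>\<^bsub>B\<^esub> e' b = b"
  shows "unit_in (stab_end \<Lambda> B (f ` carrier A)) (carrier B) e \<or> unit_in (stab_end \<Lambda> B (f ` carrier A)) (carrier B) e'"
proof (rule ccontr)
  assume no: "\<not> ?thesis"
  interpret B: right_module \<Lambda> B by (rule fgmodD(2)[OF SmonoD(4)[OF indecomposable_nonzero(1)[OF ind]]])
  have "\<exists>n. \<forall>b\<in>carrier B. (e ^^ n) b = \<zero>\<^bsub>B\<^esub>"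
    using fitting[OF C ind e(1)] no unfolding unit_in_def by (elim disjE) simp_all
  then obtain n where n: "\<forall>b\<in>carrier B. (e ^^ n) b = \<zero>\<^bsub>B\<^esub>" ..
  have "\<exists>n. \<forall>b\<in>carrier B. (e' ^^ n) b = \<zero>\<^bsub>B\<^esub>"
    using fitting[OF C ind e(2)] no unfolding unit_in_def by (elim disjE) simp_all
  then obtain m where m: "\<forall>b\<in>carrier B. (e' ^^ m) b = \<zero>\<^bsub>B\<^esub>" ..
  note ec = rhom_closed[OF stab_endD(1)[OF e(1)]] and ec' = rhom_closed[OF stab_endD(1)[OF e(2)]]
  have inj: "b = \<zero>\<^bsub>B\<^esub>" if b: "b \<in> carrier B" "e' b = \<zero>\<^bsub>B\<^esub>" for b
  proof -
    have "e b = b" using bspec[OF sum b(1)] b(2) ec[OF b(1)] by simp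
    then have "(e ^^ n) b = b" by (induction n) simp_all
    then show ?thesis using n b(1) by simp
  qed
  have "b = \<zero>\<^bsub>B\<^esub>" if b: "b \<in> carrier B" for b
    by (rule funpow_zero_inj[where e = e', OF bspec[OF m b] b ec' inj])
  then have "carrier B = {\<zero>\<^bsub>B\<^esub>}" using B.M.zero_closed by blast
  then show False using indecomposable_nonzero(2)[OF ind] by (simp add: zero_rmodule_def)
qed

lemma idempotent_trivial:
  assumes C: "resolving \<Lambda> \<C>" and ind: "Hindecomposable \<Lambda> (Smono \<Lambda> \<C>) (A, f, B)"
    and e: "e \<in> stab_end \<Lambda> B (f ` carrier A)" and idem: "\<forall>b\<in>carrier B. e (e b) = e b"
  shows "(\<forall>b\<in>carrier B. e b = \<zero>\<^bsub>B\<^esub>) \<or> (\<forall>b\<in>carrier B. e b = b)"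
proof -
  note rB = fgmodD(2)[OF SmonoD(4)[OF indecomposable_nonzero(1)[OF ind]]]
  note ec = rhom_closed[OF stab_endD(1)[OF e]]
  from fitting[OF C ind e] show ?thesis
  proof
    assume "\<exists>n. \<forall>b\<in>carrier B. (e ^^ n) b = \<zero>\<^bsub>B\<^esub>"
    then obtain n where n: "\<forall>b\<in>carrier B. (e ^^ n) b = \<zero>\<^bsub>B\<^esub>" ..
    have "e b = \<zero>\<^bsub>B\<^esub>" if b: "b \<in> carrier B" for b
    proof -
      have "(e ^^ n) (e b) = e b" using idem b by (induction n) simp_all
      then show ?thesis using n ec[OF b] by simp
    qed
    then show ?thesis by simp
  next
    assume "\<exists>v\<in>stab_end \<Lambda> B (f ` carrier A). \<forall>b\<in>carrier B. e (v b) = b \<and> v (e b) = b"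
    then obtain v where v: "v \<in> stab_end \<Lambda> B (f ` carrier A)" "\<forall>b\<in>carrier B. e (v b) = b \<and> v (e b) = b" ..
    have "e b = b" if b: "b \<in> carrier B" for b
    proof -
      have "v (e (e b)) = v (e b)" using idem b by simp
      then show ?thesis using v(2) b ec[OF b] by simp
    qed
    then show ?thesis by simp
  qed
qed

lemma indecomposable_second:
  assumes C: "resolving \<Lambda> \<C>" and ind: "Hindecomposable \<Lambda> (Smono \<Lambda> \<C>) (A, f, B)"
    and all: "\<And>e. e \<in> rhom \<Lambda> B B \<Longrightarrow> e \<in> stab_end \<Lambda> B (f ` carrier A)"
  shows "indecomposable \<Lambda> B"
  by (rule indecomposableI[OF SmonoD(4)[OF indecomposable_nonzero(1)[OF ind]] indecomposable_nonzero(2)[OF ind]])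
    (rule idempotent_trivial[OF C ind all])

text \<open>By locality one of the three summands in the decomposition of the identity is invertible. If it is the
  one through \<open>(A = A)\<close>, then \<open>f\<close> is onto; if it is \<open>b\<close>, then \<open>f\<close> vanishes because \<open>b f = 0\<close>; if it is the one
  through \<open>F\<close>, then \<open>B\<close> is a retract of \<open>F\<close>. Locality is applied twice: after the third summand is split off,
  the sum of the other two has an inverse \<open>v\<close>, and \<open>v\<close> times these two again adds up to the identity.\<close>

lemma projective_trichotomy:
  assumes C: "resolving \<Lambda> \<C>" and ind: "Hindecomposable \<Lambda> (Smono \<Lambda> \<C>) (A, f, B)"
    and P: "ex_projective \<Lambda> (Smono \<Lambda> \<C>) (Escw \<Lambda> \<C>) (A, f, B)"
  shows "f ` carrier A = carrier B \<or> f ` carrier A = {\<zero>\<^bsub>B\<^esub>} \<or> B \<in> prj \<Lambda>"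
proof -
  note SD = SmonoD[OF indecomposable_nonzero(1)[OF ind]]
  note rA = SD(7) and rB = SD(8)
  interpret A: right_module \<Lambda> A by (rule rA)
  interpret B: right_module \<Lambda> B by (rule rB)
  let ?E = "stab_end \<Lambda> B (f ` carrier A)"
  note I = rsubmodule_image[OF rA rB SD(5)]
  obtain F \<rho> a b d where F: "F \<in> prj \<Lambda>" and \<rho>: "\<rho> \<in> rhom \<Lambda> F B" and a: "a \<in> rhom \<Lambda> B A" and b: "b \<in> rhom \<Lambda> B B"
    and d: "d \<in> rhom \<Lambda> B F" and b0: "\<forall>x\<in>carrier A. b (f x) = \<zero>\<^bsub>B\<^esub>"
    and \<rho>d: "\<forall>x\<in>carrier A. \<rho> (d (f x)) \<in> f ` carrier A"
    and sum: "\<forall>y\<in>carrier B. (f (a y) \<oplus>\<^bsub>B\<^esub> b y) \<oplus>\<^bsub>B\<^esub> \<rho> (d y) = y"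
    by (rule projective_identity_decomposition[OF C P])
  have e1: "(\<lambda>y. f (a y)) \<in> ?E"
  proof (rule stab_endI[OF rhom_comp[OF SD(5) a]])
    fix x assume "x \<in> f ` carrier A"
    then have "x \<in> carrier B" using rsubmoduleD(1)[OF I] by auto
    then show "f (a x) \<in> f ` carrier A" using rhom_closed[OF a] by simp
  qed
  have e2: "b \<in> ?E" by (rule stab_endI[OF b]) (use b0 rsubmoduleD(2)[OF I] in auto)
  have e3: "(\<lambda>y. \<rho> (d y)) \<in> ?E" by (rule stab_endI[OF rhom_comp[OF \<rho> d]]) (use \<rho>d in auto)
  let ?e = "\<lambda>y. f (a y) \<oplus>\<^bsub>B\<^esub> b y"
  have e12: "?e \<in> ?E" by (rule stab_end_add[OF rB I e1 e2])
  have Ec: "h y \<in> carrier B" if "h \<in> ?E" "y \<in> carrier B" for h y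
    using rhom_closed[OF stab_endD(1)[OF that(1)] that(2)] .
  from sum_one_unit[OF C ind e12 e3 sum] show ?thesis
  proof
    assume "unit_in ?E (carrier B) (\<lambda>y. \<rho> (d y))"
    then obtain w where w: "w \<in> ?E" "\<forall>y\<in>carrier B. \<rho> (d (w y)) = y \<and> w (\<rho> (d y)) = y" unfolding unit_in_def ..
    have "B \<in> prj \<Lambda>"
      by (rule prj_retract[OF F SD(4) rhom_comp[OF d stab_endD(1)[OF w(1)]] \<rho>]) (use w(2) in simp)
    then show ?thesis by simp
  next
    assume "unit_in ?E (carrier B) ?e"
    then obtain v where v: "v \<in> ?E" "\<forall>y\<in>carrier B. ?e (v y) = y \<and> v (?e y) = y" unfolding unit_in_def ..
    have v1: "(\<lambda>y. v (f (a y))) \<in> ?E" by (rule stab_end_comp[OF v(1) e1])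
    have v2: "(\<lambda>y. v (b y)) \<in> ?E" by (rule stab_end_comp[OF v(1) e2])
    have "\<forall>y\<in>carrier B. v (f (a y)) \<oplus>\<^bsub>B\<^esub> v (b y) = y"
      using v(2) rhom_add[OF stab_endD(1)[OF v(1)] Ec[OF e1] Ec[OF e2]] by simp
    from sum_one_unit[OF C ind v1 v2 this] show ?thesis
    proof
      assume "unit_in ?E (carrier B) (\<lambda>y. v (f (a y)))"
      then obtain w where w: "w \<in> ?E" "\<forall>y\<in>carrier B. v (f (a (w y))) = y \<and> w (v (f (a y))) = y" unfolding unit_in_def ..
      have "y \<in> f ` carrier A" if y: "y \<in> carrier B" for y
      proof -
        note vy = Ec[OF v(1) y]
        note fw = Ec[OF e1 Ec[OF w(1) vy]]
        \<comment> \<open>Apply the inverse of \<open>v\<close> to \<open>v (f (a (w (v y)))) = v y\<close>.\<close>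
        have "?e (v (f (a (w (v y))))) = ?e (v y)" using w(2) vy by simp
        then have "f (a (w (v y))) = y" using v(2) y fw by simp
        then show ?thesis using rhom_closed[OF a Ec[OF w(1) vy]] by (metis imageI)
      qed
      then have "f ` carrier A = carrier B" using rsubmoduleD(1)[OF I] by blast
      then show ?thesis by simp
    next
      assume "unit_in ?E (carrier B) (\<lambda>y. v (b y))"
      then obtain w where w: "w \<in> ?E" "\<forall>y\<in>carrier B. v (b (w y)) = y \<and> w (v (b y)) = y" unfolding unit_in_def ..
      have "f x = \<zero>\<^bsub>B\<^esub>" if x: "x \<in> carrier A" for x
      proof -
        have "f x = w (v (b (f x)))" using w(2) rhom_closed[OF SD(5) x] by simp
        also have "\<dots> = w (v \<zero>\<^bsub>B\<^esub>)" using b0 x by simp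
        also have "\<dots> = \<zero>\<^bsub>B\<^esub>"
          by (simp add: rhom_zero[OF rB rB stab_endD(1)[OF v(1)]] rhom_zero[OF rB rB stab_endD(1)[OF w(1)]])
        finally show ?thesis .
      qed
      then have "f ` carrier A = {\<zero>\<^bsub>B\<^esub>}" using rsubmoduleD(2)[OF I] by auto
      then show ?thesis by simp
    qed
  qed
qed

text \<open>No projective cover has to be constructed. An endomorphism of \<open>B\<close> that is compatible with an
  endomorphism of \<open>D\<close> preserves \<open>Ker r = Im f\<close>, so that Fitting's lemma applies to it. If \<open>N + Ker r = B\<close>, then
  projectivity gives an endomorphism of \<open>B\<close> over the identity of \<open>D\<close> with values in \<open>N\<close>; it is not nilpotent,
  because \<open>r \<noteq> 0\<close>, and hence invertible, so \<open>N = B\<close>. An idempotent of \<open>D\<close> lifts to an endomorphism of \<open>B\<close>, which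
  is nilpotent or invertible, and so the idempotent is \<open>0\<close> or \<open>1\<close>.\<close>

lemma kernel_cover:
  assumes C: "resolving \<Lambda> \<C>" and ind: "Hindecomposable \<Lambda> (Smono \<Lambda> \<C>) (A, f, B)" and B: "B \<in> prj \<Lambda>"
    and ne: "f ` carrier A \<noteq> carrier B"
    and D: "D \<in> fgmod \<Lambda>" and r: "r \<in> rhom \<Lambda> B D" "r ` carrier B = carrier D"
    and ker: "\<forall>x\<in>carrier B. r x = \<zero>\<^bsub>D\<^esub> \<longleftrightarrow> x \<in> f ` carrier A"
  shows "projective_cover \<Lambda> B r D" "indecomposable \<Lambda> D"
proof -
  note SD = SmonoD[OF indecomposable_nonzero(1)[OF ind]]
  note rA = SD(7) and rB = SD(8) and rD = fgmodD(2)[OF D]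
  interpret B: right_module \<Lambda> B by (rule rB)
  interpret D: right_module \<Lambda> D by (rule rD)
  let ?E = "stab_end \<Lambda> B (f ` carrier A)"
  note I = rsubmodule_image[OF rA rB SD(5)]
  have IB: "x \<in> carrier B" if "x \<in> f ` carrier A" for x using rsubmoduleD(1)[OF I] that by auto
  obtain x0 where "x0 \<in> carrier B" "x0 \<notin> f ` carrier A" using ne rsubmoduleD(1)[OF I] by auto
  then have x0: "x0 \<in> carrier B" "r x0 \<noteq> \<zero>\<^bsub>D\<^esub>" using bspec[OF ker] by simp_all
  have stab: "h \<in> ?E" if h: "h \<in> rhom \<Lambda> B B" and hk: "\<forall>x\<in>carrier B. r x = \<zero>\<^bsub>D\<^esub> \<longrightarrow> r (h x) = \<zero>\<^bsub>D\<^esub>" for h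
  proof (rule stab_endI[OF h])
    fix x assume x: "x \<in> f ` carrier A"
    then have "r (h x) = \<zero>\<^bsub>D\<^esub>" using bspec[OF ker IB[OF x]] bspec[OF hk IB[OF x]] by simp
    then show "h x \<in> f ` carrier A" using bspec[OF ker rhom_closed[OF h IB[OF x]]] by simp
  qed
  show "projective_cover \<Lambda> B r D"
    unfolding projective_cover_def
  proof (intro conjI allI impI B r)
    fix N assume "rsubmodule \<Lambda> B N \<and> N <+>\<^bsub>B\<^esub> a_kernel B D r = carrier B"
    then have N: "rsubmodule \<Lambda> B N" and NK: "N <+>\<^bsub>B\<^esub> a_kernel B D r = carrier B" by simp_all
    have NB: "n \<in> carrier B" if "n \<in> N" for n using rsubmoduleD(1)[OF N] that by auto
    let ?N = "B\<lparr>carrier := N\<rparr>"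
    note rN = rsubmodule_right_module[OF rB N]
    have rNs: "carrier D \<subseteq> r ` N"
    proof
      fix y assume "y \<in> carrier D"
      then obtain x where x: "x \<in> carrier B" "y = r x" using r(2) by auto
      then have "x \<in> N <+>\<^bsub>B\<^esub> a_kernel B D r" using NK by simp
      then obtain n k where nk: "n \<in> N" "k \<in> a_kernel B D r" "x = n \<oplus>\<^bsub>B\<^esub> k" unfolding set_add_def' by blast
      then have "y = r n"
        using x(2) rhom_add[OF r(1) NB[OF nk(1)], of k] rhom_closed[OF r(1) NB[OF nk(1)]] by (simp add: a_kernel_iff)
      then show "y \<in> r ` N" using nk(1) by simp
    qed
    obtain S where S: "finite S" "S \<subseteq> carrier D" "\<And>K. rsubmodule \<Lambda> D K \<Longrightarrow> S \<subseteq> K \<Longrightarrow> K = carrier D"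
      by (rule fg_rmodule_gens[OF fgmodD(1)[OF D]]) blast
    have "S \<subseteq> r ` N" using S(2) rNs by blast
    then obtain T where T: "T \<subseteq> N" "finite T" "S = r ` T" using finite_subset_image[OF S(1)] by metis
    \<comment> \<open>\<open>N\<close> may fail to be finitely generated, so \<open>r\<close> is lifted to a projective \<open>F\<close> mapping into \<open>N\<close>.\<close>
    have "T \<subseteq> carrier ?N" using T(1) by simp
    from prj_hits_finite_set[OF rN T(2) this]
    obtain F h where F: "F \<in> prj \<Lambda>" "h \<in> rhom \<Lambda> F ?N" "T \<subseteq> h ` carrier F" by (elim bexE)
    note rF = fgmodD(2)[OF prj_fgmod[OF F(1)]]
    have hN: "h t \<in> N" if "t \<in> carrier F" for t using rhom_closed[OF F(2) that] by simp
    have hB: "h \<in> rhom \<Lambda> F B" using F(2) NB by (auto simp: rhom_def)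
    have rh: "(\<lambda>t. r (h t)) \<in> rhom \<Lambda> F D" by (rule rhom_comp[OF r(1) hB])
    have "S \<subseteq> (\<lambda>t. r (h t)) ` carrier F" using F(3) T(3) by auto
    then have rhs: "(\<lambda>t. r (h t)) ` carrier F = carrier D"
      by (rule S(3)[OF rsubmodule_image[OF rF rD rh]])
    obtain k where k: "k \<in> rhom \<Lambda> B F" "\<forall>x\<in>carrier B. r (h (k x)) = r x"
      using prj_lift[OF B fgmodD(1)[OF prj_fgmod[OF F(1)]] fgmodD(1)[OF D] rh rhs r(1)] by (elim bexE)
    let ?e = "\<lambda>x. h (k x)"
    have eh: "?e \<in> rhom \<Lambda> B B" by (rule rhom_comp[OF hB k(1)])
    have eE: "?e \<in> ?E" by (rule stab[OF eh]) (simp add: k(2))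
    have rpow: "r ((?e ^^ n) x) = r x" if x: "x \<in> carrier B" for n x
    proof (induction n)
      case (Suc n)
      have "(?e ^^ n) x \<in> carrier B" using rhom_closed[OF rhom_funpow[OF eh] x] .
      then show ?case using k(2) Suc.IH by simp
    qed simp
    from fitting[OF C ind eE] show "N = carrier B"
    proof
      assume "\<exists>n. \<forall>b\<in>carrier B. (?e ^^ n) b = \<zero>\<^bsub>B\<^esub>"
      then obtain n where "\<forall>b\<in>carrier B. (?e ^^ n) b = \<zero>\<^bsub>B\<^esub>" ..
      then have "r x0 = r \<zero>\<^bsub>B\<^esub>" using rpow[OF x0(1), of n] x0(1) by simp
      then show ?thesis using x0(2) rhom_zero[OF rB rD r(1)] by simp
    next
      assume "\<exists>v\<in>?E. \<forall>b\<in>carrier B. ?e (v b) = b \<and> v (?e b) = b"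
      then obtain v where v: "v \<in> ?E" "\<forall>b\<in>carrier B. ?e (v b) = b \<and> v (?e b) = b" ..
      have "b \<in> N" if b: "b \<in> carrier B" for b
      proof -
        have "h (k (v b)) \<in> N" by (rule hN[OF rhom_closed[OF k(1) rhom_closed[OF stab_endD(1)[OF v(1)] b]]])
        then show ?thesis using v(2) b by simp
      qed
      then show ?thesis using rsubmoduleD(1)[OF N] by blast
    qed
  qed
  show "indecomposable \<Lambda> D"
  proof (rule indecomposableI[OF D])
    show "\<not> zero_rmodule D" using x0 rhom_closed[OF r(1) x0(1)] by (auto simp: zero_rmodule_def)
    fix e assume e: "e \<in> rhom \<Lambda> D D" and idem: "\<forall>x\<in>carrier D. e (e x) = e x"
    obtain h where h: "h \<in> rhom \<Lambda> B B" "\<forall>x\<in>carrier B. r (h x) = e (r x)"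
      using prj_lift[OF B SD(9) fgmodD(1)[OF D] r rhom_comp[OF e r(1)]] by (elim bexE)
    have hE: "h \<in> ?E" by (rule stab[OF h(1)]) (simp add: h(2) rhom_zero[OF rD rD e])
    have rpow: "r ((h ^^ n) x) = (e ^^ n) (r x)" if x: "x \<in> carrier B" for n x
    proof (induction n)
      case (Suc n)
      have "(h ^^ n) x \<in> carrier B" using rhom_closed[OF rhom_funpow[OF h(1)] x] .
      then show ?case using h(2) Suc.IH by simp
    qed simp
    from fitting[OF C ind hE] show "(\<forall>x\<in>carrier D. e x = \<zero>\<^bsub>D\<^esub>) \<or> (\<forall>x\<in>carrier D. e x = x)"
    proof
      assume "\<exists>n. \<forall>b\<in>carrier B. (h ^^ n) b = \<zero>\<^bsub>B\<^esub>"
      then obtain n where n: "\<forall>b\<in>carrier B. (h ^^ n) b = \<zero>\<^bsub>B\<^esub>" ..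
      have "e y = \<zero>\<^bsub>D\<^esub>" if y: "y \<in> carrier D" for y
      proof -
        obtain x where x: "x \<in> carrier B" "e y = r x" using rhom_closed[OF e y] r(2) by (metis imageE)
        have "(e ^^ n) (e y) = e y" using idem y by (induction n) simp_all
        moreover have "(e ^^ n) (r x) = \<zero>\<^bsub>D\<^esub>" using rpow[OF x(1), of n] n x(1) rhom_zero[OF rB rD r(1)] by simp
        ultimately show ?thesis using x(2) by simp
      qed
      then show ?thesis by simp
    next
      assume "\<exists>v\<in>?E. \<forall>b\<in>carrier B. h (v b) = b \<and> v (h b) = b"
      then obtain v where v: "v \<in> ?E" "\<forall>b\<in>carrier B. h (v b) = b \<and> v (h b) = b" ..
      have "e y = y" if y: "y \<in> carrier D" for y
      proof -
        obtain x where x: "x \<in> carrier B" "y = r x" using y r(2) by auto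
        note vx = rhom_closed[OF stab_endD(1)[OF v(1)] x(1)]
        have "y = e (r (v x))" using h(2) vx v(2) x by force
        then show ?thesis using idem rhom_closed[OF r(1) vx] by simp
      qed
      then show ?thesis by simp
    qed
  qed
qed

end


subsection \<open>The classification\<close>

theorem proposition3p13:
  fixes R :: "('r, 's) ring_scheme" and \<Lambda> :: "('r, 'a) module" and \<C> :: "'a umod set"
  assumes "artin_algebra R \<Lambda>"
    and "resolving \<Lambda> \<C>"
    and "contravariantly_finite \<Lambda> \<C>"
  shows "(\<forall>X\<^sub>1 f X\<^sub>2. (X\<^sub>1, f, X\<^sub>2) \<in> Smono \<Lambda> \<C> \<longrightarrow>
            (Hindecomposable \<Lambda> (Smono \<Lambda> \<C>) (X\<^sub>1, f, X\<^sub>2) \<and>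
             ex_projective \<Lambda> (Smono \<Lambda> \<C>) (Escw \<Lambda> \<C>) (X\<^sub>1, f, X\<^sub>2)
             \<longleftrightarrow>
             (\<exists>M\<in>\<C>. indecomposable \<Lambda> M \<and> Hiso \<Lambda> (X\<^sub>1, f, X\<^sub>2) (M, id, M)) \<or>
             (\<exists>M\<in>\<C>. indecomposable \<Lambda> M \<and> Hiso \<Lambda> (X\<^sub>1, f, X\<^sub>2) (zero_sub M, id, M)) \<or>
             (\<exists>M\<in>\<C>. indecomposable \<Lambda> M \<and>
                (\<exists>P \<pi>. projective_cover \<Lambda> P \<pi> M \<and>
                   Hiso \<Lambda> (X\<^sub>1, f, X\<^sub>2) (ker_rmodule \<pi> P M, id, P)))))
         \<and> ex_enough_projectives \<Lambda> (Smono \<Lambda> \<C>) (Escw \<Lambda> \<C>)"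
proof (intro conjI allI impI iffI)
  interpret artin R \<Lambda> by (rule artin.intro[OF assms(1)])
  note C = assms(2)
  show "ex_enough_projectives \<Lambda> (Smono \<Lambda> \<C>) (Escw \<Lambda> \<C>)" by (rule enough_projectives[OF C])
  fix A f B assume S: "(A, f, B) \<in> Smono \<Lambda> \<C>"
  note SD = SmonoD[OF S]
  note rA = SD(7) and rB = SD(8)
  note incl = Hiso_inclusion[OF rA rB SD(5,6)]
  let ?one = "\<exists>M\<in>\<C>. indecomposable \<Lambda> M \<and> Hiso \<Lambda> (A, f, B) (M, id, M)"
  let ?two = "\<exists>M\<in>\<C>. indecomposable \<Lambda> M \<and> Hiso \<Lambda> (A, f, B) (zero_sub M, id, M)"
  let ?three = "\<exists>M\<in>\<C>. indecomposable \<Lambda> M \<and> (\<exists>P \<pi>. projective_cover \<Lambda> P \<pi> M \<and>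
                   Hiso \<Lambda> (A, f, B) (ker_rmodule \<pi> P M, id, P))"
  {
    assume "Hindecomposable \<Lambda> (Smono \<Lambda> \<C>) (A, f, B) \<and> ex_projective \<Lambda> (Smono \<Lambda> \<C>) (Escw \<Lambda> \<C>) (A, f, B)"
    then have ind: "Hindecomposable \<Lambda> (Smono \<Lambda> \<C>) (A, f, B)"
      and P: "ex_projective \<Lambda> (Smono \<Lambda> \<C>) (Escw \<Lambda> \<C>) (A, f, B)" by simp_all
    consider (iso) "f ` carrier A = carrier B" | (zero) "f ` carrier A = {\<zero>\<^bsub>B\<^esub>}"
      | (proj) "B \<in> prj \<Lambda>" "f ` carrier A \<noteq> carrier B"
      using projective_trichotomy[OF C ind P] by auto
    then show "?one \<or> ?two \<or> ?three"
    proof cases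
      case iso
      have "indecomposable \<Lambda> B"
      proof (rule indecomposable_second[OF C ind])
        fix e assume e: "e \<in> rhom \<Lambda> B B"
        then show "e \<in> stab_end \<Lambda> B (f ` carrier A)" unfolding iso by (rule stab_endI) (rule rhom_closed[OF e])
      qed
      moreover have "Hiso \<Lambda> (A, f, B) (B, id, B)" using incl unfolding iso by simp
      ultimately have ?one using SD(2) by (intro bexI[of _ B] conjI)
      then show ?thesis by (rule disjI1)
    next
      case zero
      have "indecomposable \<Lambda> B"
      proof (rule indecomposable_second[OF C ind])
        fix e assume e: "e \<in> rhom \<Lambda> B B"
        show "e \<in> stab_end \<Lambda> B (f ` carrier A)" unfolding zero by (rule stab_endI[OF e]) (simp add: rhom_zero[OF rB rB e])
      qed
      moreover have "Hiso \<Lambda> (A, f, B) (zero_sub B, id, B)" using incl unfolding zero zero_sub_def .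
      ultimately have ?two using SD(2) by (intro bexI[of _ B] conjI)
      then show ?thesis by (intro disjI2 disjI1)
    next
      case proj
      obtain D r where D: "D \<in> \<C>" "r \<in> rhom \<Lambda> B D" "r ` carrier B = carrier D"
        "\<forall>x\<in>carrier B. r x = \<zero>\<^bsub>D\<^esub> \<longleftrightarrow> x \<in> f ` carrier A" by (rule Smono_cok[OF C S])
      note cov = kernel_cover[OF C ind proj resolving_fgmod[OF C D(1)] D(2-4)]
      have "a_kernel B D r = f ` carrier A"
        by (rule Set.set_eqI) (use D(4) rhom_closed[OF SD(5)] in \<open>auto simp: a_kernel_iff\<close>)
      then have "Hiso \<Lambda> (A, f, B) (ker_rmodule r B D, id, B)" using incl by (simp only: ker_rmodule_def)
      with cov D(1) have ?three by (intro bexI[of _ D] exI[of _ B] exI[of _ r] conjI)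
      then show ?thesis by (intro disjI2)
    qed
  next
    assume "?one \<or> ?two \<or> ?three"
    then show "Hindecomposable \<Lambda> (Smono \<Lambda> \<C>) (A, f, B)"
    proof (elim disjE bexE conjE exE)
      fix M assume "indecomposable \<Lambda> M" "Hiso \<Lambda> (A, f, B) (M, id, M)"
      then show ?thesis by (intro Hindecomposable_second[OF S Hiso_riso])
    next
      fix M assume "indecomposable \<Lambda> M" "Hiso \<Lambda> (A, f, B) (zero_sub M, id, M)"
      then show ?thesis by (intro Hindecomposable_second[OF S Hiso_riso])
    next
      fix M P \<pi> assume "indecomposable \<Lambda> M" "projective_cover \<Lambda> P \<pi> M" "Hiso \<Lambda> (A, f, B) (ker_rmodule \<pi> P M, id, P)"
      then show ?thesis by (rule Hindecomposable_cover[OF C S])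
    qed
  next
    assume "?one \<or> ?two \<or> ?three"
    then have "scw_lifts \<Lambda> \<C> (A, f, B)"
    proof (elim disjE bexE conjE exE)
      fix M assume "Hiso \<Lambda> (A, f, B) (M, id, M)"
      then show ?thesis by (rule scw_lifts_Hiso[OF _ scw_lifts_identity])
    next
      fix M assume M: "M \<in> \<C>" and "Hiso \<Lambda> (A, f, B) (zero_sub M, id, M)"
      then show ?thesis by (intro scw_lifts_Hiso[OF _ scw_lifts_zero[OF fgmodD(2)[OF resolving_fgmod[OF C M]]]])
    next
      fix M P \<pi> assume M: "M \<in> \<C>" and cov: "projective_cover \<Lambda> P \<pi> M"
        and iso: "Hiso \<Lambda> (A, f, B) (ker_rmodule \<pi> P M, id, P)"
      have P: "P \<in> prj \<Lambda>" and \<pi>: "\<pi> \<in> rhom \<Lambda> P M"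
        using cov unfolding projective_cover_def by - (elim conjE, assumption)+
      note K = rsubmodule_a_kernel[OF fgmodD(2)[OF prj_fgmod[OF P]] resolving_right_module[OF C M] \<pi>]
      show ?thesis by (rule scw_lifts_Hiso[OF iso[unfolded ker_rmodule_def] scw_lifts_kernel[OF P K]])
    qed
    then show "ex_projective \<Lambda> (Smono \<Lambda> \<C>) (Escw \<Lambda> \<C>) (A, f, B)" using S by (simp only: ex_projective_iff)
  }
qed

end
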